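(* Let $3\le l<r$ and $1\le t\le l-2$ be integers, and let $\mathcal G_{SG}$ be the semi-global graph of a sub-block of an $(l,r,t)$ SC-LDPCL protograph. Let $\epsilon\in[0,1]$ be the channel erasure probability in this sub-block and let $\underline\delta_L,\underline\delta_R\in[0,1]^t$ be the incoming erasure fractions from the neighbor sub-blocks (held fixed during decoding). For an edge label $j$ let $x^{(j)}_\ell$ (resp. $u_\ell^{(j)}$) be the fraction of erased VN-to-CN (resp. CN-to-VN) messages over the edges of label $j$ at iteration $\ell$ of BP decoding over a random Tanner graph lifted from $\mathcal G_{SG}$, as the lifting parameter tends to infinity. Put $w=\lfloor r/(t+1)\rfloor$, $s_{k,t}=t+1+\frac{(k-1)(k-2)}2$, $v_{k,t}=2t+1+\frac{t(t-1)}2+\frac{(k-1)(2t-k)}2$. Then $x_0^{(j)}=1$ for all $j$, and for all $\ell\ge1$: (1) (Target sub-block.) For every $k\in\{1,\dots,t+1\}$, $$x_\ell^{(k)}=\epsilon\,(u_\ell^{(k)})^{l-t-1}\prod_{j=1}^{k-1}u_\ell^{(s_{k,t}+j)}\prod_{j=k}^{t}u_\ell^{(v_{k,t}+j)},$$ $$x_\ell^{(s_{k,t}+i)}=\epsilon\,(u_\ell^{(k)})^{l-t}\prod_{1\le j\le k-1,\,j\ne i}u_\ell^{(s_{k,t}+j)}\prod_{j=k}^{t}u_\ell^{(v_{k,t}+j)},\quad 1\le i\le k-1,$$ $$x_\ell^{(v_{k,t}+i)}=\epsilon\,(u_\ell^{(k)})^{l-t}\prod_{j=1}^{k-1}u_\ell^{(s_{k,t}+j)}\prod_{k\le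 j\le t,\,j\neq i}u_\ell^{(v_{k,t}+j)},\quad k\le i\le t,$$ where $$u_\ell^{(k)}=1-(1-x_{\ell-1}^{(k)})^{w-1}(1-x_{\ell-1}^{(t+1)})^{r-tw}\prod_{1\le j\le t,\,j\ne k}(1-x_{\ell-1}^{(j)})^{w},\quad 1\le k\le t,$$ $$u_\ell^{(t+1)}=1-(1-x_{\ell-1}^{(t+1)})^{r-tw-1}\prod_{j=1}^t(1-x_{\ell-1}^{(j)})^{w},$$ and for every $i\in\{1,\dots,t\}$, $$u_\ell^{(s_{k,t}+i)}=1-(1-\delta_{R,i})(1-x_{\ell-1}^{(s_{k,t}+i)})^{w-1}(1-x_{\ell-1}^{(s_{t+1,t}+i)})^{r-tw}\prod_{i+1\le j\le t,\,j\ne k}(1-x_{\ell-1}^{(s_{j,t}+i)})^{w},\quad i+1\le k\le t,$$ $$u_\ell^{(s_{t+1,t}+i)}=1-(1-\delta_{R,i})(1-x_{\ell-1}^{(s_{t+1,t}+i)})^{r-tw-1}\prod_{j=i+1}^t(1-x_{\ell-1}^{(s_{j,t}+i)})^{w},$$ $$u_\ell^{(v_{k,t}+i)}=1-(1-\delta_{L,i})(1-x_{\ell-1}^{(v_{k,t}+i)})^{w-1}\prod_{1\le j\le i,\,j\ne k}(1-x_{\ell-1}^{(v_{j,t}+i)})^{w},\quad 1\le k\le i.$$ (2) (Helper sub-block, to the right of the target, with incoming vector $\underline\delta_I=\underline\delta_R$.) For every $k\in\{1,\dots,t+1\}$, $$x_\ell^{(k)}=\epsilon\,(u_\ell^{(k)})^{l-t-1}\prod_{j=1}^{k-1}u_\ell^{(s_{k,t}+j)},\qquad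 x_\ell^{(s_{k,t}+i)}=\epsilon\,(u_\ell^{(k)})^{l-t}\prod_{1\le j\le k-1,\,j\neq i}u_\ell^{(s_{k,t}+j)}\quad(1\le i\le k-1),$$ with $u_\ell^{(k)}$ and $u_\ell^{(s_{k,t}+i)}$ given by the same formulas as in (1). Furthermore, with $u^{(j)}=\lim_{\ell\to\infty}u^{(j)}_\ell$, the outgoing erasure fractions are, for every $i\in\{1,\dots,t\}$, $$\delta_{O,i}=1-\prod_{k=1}^{i}\bigl(1-x^{(v_{k,t}+i)}\bigr)^{w},\qquad x^{(v_{k,t}+i)}=\epsilon\,(u^{(k)})^{l-t}\prod_{j=1}^{k-1}u^{(s_{k,t}+j)} .$$
   Context: Empty products equal $1$. Semi-global graph (target). $\mathcal G_{SG}$ is a bipartite graph with $r$ variable nodes (VNs) $v_1,\dots,v_r$ and $l+t$ check nodes (CNs): $l-t$ local checks (LCs), $t$ right coupling checks $c_{R,1},\dots,c_{R,t}$ and $t$ left coupling checks $c_{L,1},\dots,c_{L,t}$. There is one edge between every LC and every VN; $c_{R,i}$ has one edge to each $v_j$ with $iw<j\le r$; $c_{L,i}$ has one edge to each $v_j$ with $1\le j\le iw$. In addition $c_{R,i}$ (resp. $c_{L,i}$) has one external incoming edge $\delta_{R,i}$ (resp. $\delta_{L,i}$). A VN has label $k\in\{1,\dots,t+1\}$ if it is connected to exactly $k-1$ right coupling checks. An edge between a VN of label $k$ and a CN $c$ has label $k$ if $c$ is an LC, label $s_{k,t}+i$ if $c=c_{R,i}$, and label $v_{k,t}+i$ if $c=c_{L,i}$;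 the labels range over $\{1,\dots,(t+1)^2\}$. Helper (right of the target). Same graph, but the checks $c_{L,i}$, now denoted $c_{O,i}$, do not participate in the iterative decoding (equivalently $\underline\delta_L=(1,\dots,1)$). After decoding terminates (limit $\ell\to\infty$, taken after the lifting parameter has gone to infinity), each copy of $c_{O,i}$ sends to the neighboring sub-block one message, which is an erasure iff at least one message it receives from its VNs in this sub-block is an erasure; $\delta_{O,i}$ is the fraction of erased messages sent by the copies of $c_{O,i}$. Lifting. The lifted random Tanner graph with parameter $L$ has $L$ copies of each node, and each edge $\{v,c\}$ is replaced by a uniformly random perfect matching between the copies of $v$ and the copies of $c$, independently over edges. Each VN copy is erased independently with probability $\epsilon$. The external incoming message to each copy of $c_{R,i}$ (resp. $c_{L,i}$) is an erasure independently with probability $\delta_{R,i}$ (resp. $\delta_{L,i}$) and stays the same in all iterations. BP decoding over the erasure channel (flooding schedule). Before the first iteration all VN-to-CN messages are erasures. In iteration $\ell\ge1$, first each CN sends along each edge an erasure iff at least one message it received (in iteration $\ell-1$) on its other edges, including the external one, is an erasure; then each VN sends along each edge an erasure iff it is erased by the channel and all messages it received in iteration $\ell$ on its other edges are erasures. "Fraction as the lifting parameter tends to infinity" means the limit in probability, as $L\to\infty$, of the fraction of erased messages among the lifted copies of any protograph edge with the given label. *)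

theory Defs
  imports "HOL-Probability.Probability"
begin

section \<open>Belief propagation over the erasure channel on a Tanner graph\<close>

text \<open>
  A Tanner graph is given by a set \<open>A\<close> of edges and maps \<open>vn\<close>, \<open>cn\<close> sending an edge to its variable
  node and to its check node. The predicate \<open>ch\<close> says which variable nodes are erased by the channel,
  \<open>ext\<close> which check nodes have an erased external incoming message. A message is represented by
  the truth value of ``this message is an erasure''. The edge \<open>f\<close> carrying the outgoing message need
  not belong to \<open>A\<close>; if it does not, then \<open>vn_out\<close> is the message that a variable node sends to a
  check node that takes no part in the decoding over \<open>A\<close>.
\<close>

definition cn_out :: "'e set \<Rightarrow> ('e \<Rightarrow> 'c) \<Rightarrow> ('c \<Rightarrow> bool) \<Rightarrow> ('e \<Rightarrow> bool) \<Rightarrow> 'e \<Rightarrow> bool" where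
  "cn_out A cn ext m f \<longleftrightarrow> ext (cn f) \<or> (\<exists>g\<in>A. g \<noteq> f \<and> cn g = cn f \<and> m g)"

definition vn_out :: "'e set \<Rightarrow> ('e \<Rightarrow> 'v) \<Rightarrow> ('v \<Rightarrow> bool) \<Rightarrow> ('e \<Rightarrow> bool) \<Rightarrow> 'e \<Rightarrow> bool" where
  "vn_out A vn ch m f \<longleftrightarrow> ch (vn f) \<and> (\<forall>g\<in>A. g \<noteq> f \<and> vn g = vn f \<longrightarrow> m g)"

primrec bp_vn ::
  "'e set \<Rightarrow> ('e \<Rightarrow> 'v) \<Rightarrow> ('e \<Rightarrow> 'c) \<Rightarrow> ('v \<Rightarrow> bool) \<Rightarrow> ('c \<Rightarrow> bool) \<Rightarrow> nat \<Rightarrow> 'e \<Rightarrow> bool" where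
  "bp_vn A vn cn ch ext 0 = (\<lambda>f. True)"
| "bp_vn A vn cn ch ext (Suc n) = vn_out A vn ch (cn_out A cn ext (bp_vn A vn cn ch ext n))"

text \<open>Only iterations \<open>n \<ge> 1\<close> are meaningful for check-to-variable messages.\<close>

definition bp_cn ::
  "'e set \<Rightarrow> ('e \<Rightarrow> 'v) \<Rightarrow> ('e \<Rightarrow> 'c) \<Rightarrow> ('v \<Rightarrow> bool) \<Rightarrow> ('c \<Rightarrow> bool) \<Rightarrow> nat \<Rightarrow> 'e \<Rightarrow> bool" where
  "bp_cn A vn cn ch ext n = cn_out A cn ext (bp_vn A vn cn ch ext (n - 1))"


section \<open>The semi-global graph\<close>

text \<open>Variable nodes are \<open>1, \<dots>, r\<close>.\<close>

datatype check = Local nat | RightC nat | LeftC nat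

type_synonym edge = "nat \<times> check"

definition width :: "nat \<Rightarrow> nat \<Rightarrow> nat" where
  "width r t = r div (t + 1)"

definition sg_edges :: "nat \<Rightarrow> nat \<Rightarrow> nat \<Rightarrow> edge set" where
  "sg_edges l r t =
     {(v, Local m) | v m. v \<in> {1..r} \<and> m \<in> {1..l - t}}
   \<union> {(v, RightC i) | v i. i \<in> {1..t} \<and> i * width r t < v \<and> v \<le> r}
   \<union> {(v, LeftC i) | v i. i \<in> {1..t} \<and> 1 \<le> v \<and> v \<le> i * width r t}"

definition vn_label :: "nat \<Rightarrow> nat \<Rightarrow> nat \<Rightarrow> nat \<Rightarrow> nat" where
  "vn_label l r t v = card {i. (v, RightC i) \<in> sg_edges l r t} + 1"

text \<open>Both divisions are exact for \<open>1 \<le> k \<le> t + 1\<close>, \<open>1 \<le> t\<close>, and no subtraction truncates except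
  \<open>k - 2\<close> at \<open>k = 1\<close>, where the product vanishes anyway.\<close>

definition s_idx :: "nat \<Rightarrow> nat \<Rightarrow> nat" where
  "s_idx t k = t + 1 + (k - 1) * (k - 2) div 2"

definition v_idx :: "nat \<Rightarrow> nat \<Rightarrow> nat" where
  "v_idx t k = 2 * t + 1 + t * (t - 1) div 2 + (k - 1) * (2 * t - k) div 2"

fun edge_label :: "nat \<Rightarrow> nat \<Rightarrow> nat \<Rightarrow> edge \<Rightarrow> nat" where
  "edge_label l r t (v, Local m) = vn_label l r t v"
| "edge_label l r t (v, RightC i) = s_idx t (vn_label l r t v) + i"
| "edge_label l r t (v, LeftC i) = v_idx t (vn_label l r t v) + i"


section \<open>Random lifting\<close>

text \<open>
  A lifted edge \<open>((v, c), a)\<close> is the edge of the matching of \<open>{v, c}\<close> at copy \<open>a\<close> of \<open>v\<close>; its other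
  end is copy \<open>\<pi> (v, c) a\<close> of \<open>c\<close>.
\<close>

type_synonym ledge = "edge \<times> nat"

fun vn_end :: "ledge \<Rightarrow> nat \<times> nat" where
  "vn_end ((v, c), a) = (v, a)"

fun cn_end :: "(edge \<Rightarrow> nat \<Rightarrow> nat) \<Rightarrow> ledge \<Rightarrow> check \<times> nat" where
  "cn_end \<pi> ((v, c), a) = (c, \<pi> (v, c) a)"

text \<open>Edge permutations, channel erasures, erased external messages.\<close>

type_synonym sample =
  "(edge \<Rightarrow> nat \<Rightarrow> nat) \<times> (nat \<times> nat \<Rightarrow> bool) \<times> (check \<times> nat \<Rightarrow> bool)"

fun ext_prob :: "(nat \<Rightarrow> real) \<Rightarrow> (nat \<Rightarrow> real) \<Rightarrow> check \<Rightarrow> real" where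
  "ext_prob \<delta>L \<delta>R (Local m) = 0"
| "ext_prob \<delta>L \<delta>R (RightC i) = \<delta>R i"
| "ext_prob \<delta>L \<delta>R (LeftC i) = \<delta>L i"

text \<open>Local checks have no external edge; the default \<open>False\<close> of the last factor makes their
  external predicate constantly false.\<close>

definition sg_sample ::
  "nat \<Rightarrow> nat \<Rightarrow> nat \<Rightarrow> real \<Rightarrow> (nat \<Rightarrow> real) \<Rightarrow> (nat \<Rightarrow> real) \<Rightarrow> nat \<Rightarrow> sample pmf" where
  "sg_sample l r t \<epsilon> \<delta>L \<delta>R L =
     pair_pmf (Pi_pmf (sg_edges l r t) id (\<lambda>_. pmf_of_set {p. p permutes {..<L}}))
    (pair_pmf (Pi_pmf ({1..r} \<times> {..<L}) False (\<lambda>_. bernoulli_pmf \<epsilon>))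
              (Pi_pmf ((RightC ` {1..t} \<union> LeftC ` {1..t}) \<times> {..<L}) False
                 (\<lambda>(c, b). bernoulli_pmf (ext_prob \<delta>L \<delta>R c))))"

definition limit_in_prob :: "(nat \<Rightarrow> 'a pmf) \<Rightarrow> (nat \<Rightarrow> 'a \<Rightarrow> real) \<Rightarrow> real \<Rightarrow> bool" where
  "limit_in_prob M X p \<longleftrightarrow>
     (\<forall>\<eta>>0. (\<lambda>L. measure_pmf.prob (M L) {\<omega>. \<bar>X L \<omega> - p\<bar> > \<eta>}) \<longlonglongrightarrow> 0)"

text \<open>
  Decoding takes place on the lifts of the protograph edges in \<open>A\<close>: all edges for the target, the
  edges not incident to the inactive checks for the helper. The fractions are over the \<open>L\<close> copies of
  the protograph edge \<open>e\<close>, or over the \<open>L\<close> copies of the check \<open>LeftC i\<close>.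
\<close>

fun vn_fraction :: "edge set \<Rightarrow> nat \<Rightarrow> edge \<Rightarrow> nat \<Rightarrow> sample \<Rightarrow> real" where
  "vn_fraction A n e L (\<pi>, ch, ext) =
     real (card {a. a < L \<and> bp_vn (A \<times> {..<L}) vn_end (cn_end \<pi>) ch ext n (e, a)}) / real L"

fun cn_fraction :: "edge set \<Rightarrow> nat \<Rightarrow> edge \<Rightarrow> nat \<Rightarrow> sample \<Rightarrow> real" where
  "cn_fraction A n e L (\<pi>, ch, ext) =
     real (card {a. a < L \<and> bp_cn (A \<times> {..<L}) vn_end (cn_end \<pi>) ch ext n (e, a)}) / real L"

fun out_fraction ::
  "edge set \<Rightarrow> edge set \<Rightarrow> nat \<Rightarrow> nat \<Rightarrow> nat \<Rightarrow> sample \<Rightarrow> real" where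
  "out_fraction E A n i L (\<pi>, ch, ext) =
     real (card {b. b < L \<and> (\<exists>g \<in> E \<times> {..<L}. cn_end \<pi> g = (LeftC i, b) \<and>
        bp_vn (A \<times> {..<L}) vn_end (cn_end \<pi>) ch ext n g)}) / real L"


section \<open>Target sub-block\<close>

definition target_vn_limit ::
  "nat \<Rightarrow> nat \<Rightarrow> nat \<Rightarrow> real \<Rightarrow> (nat \<Rightarrow> real) \<Rightarrow> (nat \<Rightarrow> real) \<Rightarrow> nat \<Rightarrow> edge \<Rightarrow> real \<Rightarrow> bool" where
  "target_vn_limit l r t \<epsilon> \<delta>L \<delta>R n e p \<longleftrightarrow>
     limit_in_prob (sg_sample l r t \<epsilon> \<delta>L \<delta>R) (vn_fraction (sg_edges l r t) n e) p"

definition target_cn_limit ::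
  "nat \<Rightarrow> nat \<Rightarrow> nat \<Rightarrow> real \<Rightarrow> (nat \<Rightarrow> real) \<Rightarrow> (nat \<Rightarrow> real) \<Rightarrow> nat \<Rightarrow> edge \<Rightarrow> real \<Rightarrow> bool" where
  "target_cn_limit l r t \<epsilon> \<delta>L \<delta>R n e p \<longleftrightarrow>
     limit_in_prob (sg_sample l r t \<epsilon> \<delta>L \<delta>R) (cn_fraction (sg_edges l r t) n e) p"

definition target_x ::
  "nat \<Rightarrow> nat \<Rightarrow> nat \<Rightarrow> real \<Rightarrow> (nat \<Rightarrow> real) \<Rightarrow> (nat \<Rightarrow> real) \<Rightarrow> nat \<Rightarrow> nat \<Rightarrow> real" where
  "target_x l r t \<epsilon> \<delta>L \<delta>R n j =
     (THE p. \<forall>e \<in> sg_edges l r t. edge_label l r t e = j \<longrightarrow> target_vn_limit l r t \<epsilon> \<delta>L \<delta>R n e p)"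

definition target_u ::
  "nat \<Rightarrow> nat \<Rightarrow> nat \<Rightarrow> real \<Rightarrow> (nat \<Rightarrow> real) \<Rightarrow> (nat \<Rightarrow> real) \<Rightarrow> nat \<Rightarrow> nat \<Rightarrow> real" where
  "target_u l r t \<epsilon> \<delta>L \<delta>R n j =
     (THE p. \<forall>e \<in> sg_edges l r t. edge_label l r t e = j \<longrightarrow> target_cn_limit l r t \<epsilon> \<delta>L \<delta>R n e p)"


section \<open>Helper sub-block\<close>

text \<open>
  The checks \<open>LeftC i\<close> are inactive: decoding uses the remaining edges only. They stay in the lifted
  graph, and the messages sent to them by their variable nodes determine the outgoing messages.
  Their external messages are never looked at; the value \<open>1\<close> of the left erasure probabilities below
  is immaterial.
\<close>

definition helper_edges :: "nat \<Rightarrow> nat \<Rightarrow> nat \<Rightarrow> edge set" where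
  "helper_edges l r t = {(v, c) \<in> sg_edges l r t. \<forall>i. c \<noteq> LeftC i}"

definition helper_vn_limit ::
  "nat \<Rightarrow> nat \<Rightarrow> nat \<Rightarrow> real \<Rightarrow> (nat \<Rightarrow> real) \<Rightarrow> nat \<Rightarrow> edge \<Rightarrow> real \<Rightarrow> bool" where
  "helper_vn_limit l r t \<epsilon> \<delta>I n e p \<longleftrightarrow>
     limit_in_prob (sg_sample l r t \<epsilon> (\<lambda>_. 1) \<delta>I) (vn_fraction (helper_edges l r t) n e) p"

definition helper_cn_limit ::
  "nat \<Rightarrow> nat \<Rightarrow> nat \<Rightarrow> real \<Rightarrow> (nat \<Rightarrow> real) \<Rightarrow> nat \<Rightarrow> edge \<Rightarrow> real \<Rightarrow> bool" where
  "helper_cn_limit l r t \<epsilon> \<delta>I n e p \<longleftrightarrow>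
     limit_in_prob (sg_sample l r t \<epsilon> (\<lambda>_. 1) \<delta>I) (cn_fraction (helper_edges l r t) n e) p"

definition helper_out_limit ::
  "nat \<Rightarrow> nat \<Rightarrow> nat \<Rightarrow> real \<Rightarrow> (nat \<Rightarrow> real) \<Rightarrow> nat \<Rightarrow> nat \<Rightarrow> real \<Rightarrow> bool" where
  "helper_out_limit l r t \<epsilon> \<delta>I n i p \<longleftrightarrow>
     limit_in_prob (sg_sample l r t \<epsilon> (\<lambda>_. 1) \<delta>I)
       (out_fraction (sg_edges l r t) (helper_edges l r t) n i) p"

text \<open>Variable-to-check messages are considered on all edges, including those to inactive checks.\<close>

definition helper_x ::
  "nat \<Rightarrow> nat \<Rightarrow> nat \<Rightarrow> real \<Rightarrow> (nat \<Rightarrow> real) \<Rightarrow> nat \<Rightarrow> nat \<Rightarrow> real" where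
  "helper_x l r t \<epsilon> \<delta>I n j =
     (THE p. \<forall>e \<in> sg_edges l r t. edge_label l r t e = j \<longrightarrow> helper_vn_limit l r t \<epsilon> \<delta>I n e p)"

definition helper_u ::
  "nat \<Rightarrow> nat \<Rightarrow> nat \<Rightarrow> real \<Rightarrow> (nat \<Rightarrow> real) \<Rightarrow> nat \<Rightarrow> nat \<Rightarrow> real" where
  "helper_u l r t \<epsilon> \<delta>I n j =
     (THE p. \<forall>e \<in> helper_edges l r t. edge_label l r t e = j \<longrightarrow> helper_cn_limit l r t \<epsilon> \<delta>I n e p)"

definition helper_out ::
  "nat \<Rightarrow> nat \<Rightarrow> nat \<Rightarrow> real \<Rightarrow> (nat \<Rightarrow> real) \<Rightarrow> nat \<Rightarrow> nat \<Rightarrow> real" where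
  "helper_out l r t \<epsilon> \<delta>I n i = (THE p. helper_out_limit l r t \<epsilon> \<delta>I n i p)"

text \<open>The limit over iterations is taken after the limit over the lifting parameter.\<close>

definition helper_delta_O ::
  "nat \<Rightarrow> nat \<Rightarrow> nat \<Rightarrow> real \<Rightarrow> (nat \<Rightarrow> real) \<Rightarrow> nat \<Rightarrow> real" where
  "helper_delta_O l r t \<epsilon> \<delta>I i = lim (\<lambda>n. helper_out l r t \<epsilon> \<delta>I n i)"

end

theory Submission
  imports Defs
begin

text \<open>
  Fix the liftings of the edges. A message after \<open>n\<close> iterations is a Boolean function of the channel
  bits and external bits at the lifted nodes that are reached by non-backtracking words of bounded
  length. If distinct words end at distinct lifted nodes, these bits are independent and the message
  is an erasure with exactly the probability given by the density evolution recursion. Messages with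
  disjoint neighbourhoods are independent and every neighbourhood meets boundedly many others, so the
  second moment of the deviation of the erased fraction is controlled by the number of copies whose
  neighbourhood is not tree-like. Such a copy has a word whose last step is the first to hit its own
  trace; redirecting that step by a transposition shows that this has probability \<open>O(1/L)\<close>.

  The recursion on protograph edges depends on edge labels only, which gives the formulas of the
  target. The recursion of the helper is that of the target with all left external messages erased;
  its iterates decrease, hence converge.
\<close>

section \<open>Events depending on disjoint sets of coordinates\<close>

text \<open>Independence is at hand only for a fixed lifting, where channel and external bits form a
  product measure. The randomness of the lifting therefore enters solely through counting: how many
  liftings fail to be tree-like at a given copy.

  Three fractions are needed: messages to checks, messages to variable nodes, and messages sent out
  by inactive checks. All are counted over the copies of one check, because the matching of an edge
  is a bijection between the copies of its two ends. So words are rooted at a check, and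
  \<open>n\<close> iterations call for words of length \<open>2 * n + 1\<close>.

  The obstacle in the redirection is that the altered matching may already be crossed earlier in the
  same word, in either direction. Taking the first repetition and forbidding backtracking is what
  keeps all earlier positions unchanged.

  Words run over all edges of the semi-global graph even when decoding uses fewer, so one count
  serves target and helper.\<close>

definition depends_on :: "(('i \<Rightarrow> 'b) \<Rightarrow> bool) \<Rightarrow> 'i set \<Rightarrow> bool" where
  "depends_on F S \<longleftrightarrow> (\<forall>\<omega> \<omega>'. (\<forall>i\<in>S. \<omega> i = \<omega>' i) \<longrightarrow> F \<omega> = F \<omega>')"

lemma depends_onI:
  assumes "\<And>\<omega> \<omega>'. (\<And>i. i \<in> S \<Longrightarrow> \<omega> i = \<omega>' i) \<Longrightarrow> F \<omega> = F \<omega>'"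
  shows "depends_on F S"
  using assms unfolding depends_on_def by blast

lemma depends_onD:
  "depends_on F S \<Longrightarrow> (\<And>i. i \<in> S \<Longrightarrow> \<omega> i = \<omega>' i) \<Longrightarrow> F \<omega> = F \<omega>'"
  by (auto simp: depends_on_def)

lemma depends_on_mono: "depends_on F S \<Longrightarrow> S \<subseteq> T \<Longrightarrow> depends_on F T"
  unfolding depends_on_def by blast

lemma depends_on_not: "depends_on F S \<Longrightarrow> depends_on (\<lambda>\<omega>. \<not> F \<omega>) S"
  unfolding depends_on_def by blast

lemma depends_on_All:
  assumes "\<And>j. j \<in> J \<Longrightarrow> depends_on (F j) (S j)"
  shows "depends_on (\<lambda>\<omega>. \<forall>j\<in>J. F j \<omega>) (\<Union>j\<in>J. S j)"
proof (rule depends_onI)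
  fix \<omega> \<omega>' :: "'b \<Rightarrow> 'c"
  assume "\<And>i. i \<in> (\<Union>j\<in>J. S j) \<Longrightarrow> \<omega> i = \<omega>' i"
  then have "F j \<omega> = F j \<omega>'" if "j \<in> J" for j
    using that by (intro depends_onD[OF assms[OF that]]) auto
  then show "(\<forall>j\<in>J. F j \<omega>) = (\<forall>j\<in>J. F j \<omega>')"
    by auto
qed

lemma prob_pair_times:
  "measure_pmf.prob (pair_pmf M N) (A \<times> B) = measure_pmf.prob M A * measure_pmf.prob N B"
proof -
  have "measure_pmf.prob (pair_pmf M N) (A \<times> B)
      = measure_pmf.prob (pair_pmf M N) ((A \<times> B) \<inter> set_pmf (pair_pmf M N))"
    by (rule measure_Int_set_pmf[symmetric])
  also have "(A \<times> B) \<inter> set_pmf (pair_pmf M N) = (A \<inter> set_pmf M) \<times> (B \<inter> set_pmf N)"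
    by auto
  also have "measure_pmf.prob (pair_pmf M N) \<dots>
      = measure_pmf.prob M (A \<inter> set_pmf M) * measure_pmf.prob N (B \<inter> set_pmf N)"
    by (intro measure_pmf_prob_product) auto
  finally show ?thesis
    by (simp add: measure_Int_set_pmf)
qed

text \<open>Splitting \<open>I\<close> into \<open>I \<inter> S\<close> and \<open>I - S\<close>
  turns the product measure into two independent blocks; \<open>F\<close> factors through the first
  and \<open>G\<close> through the second. \<open>S\<close> and \<open>T\<close> may reach outside
  \<open>I\<close>, where the coordinates almost surely carry the default \<open>d\<close>.\<close>

lemma prob_Pi_pmf_conj:
  assumes "finite I" and F: "depends_on F S" and G: "depends_on G T" and "S \<inter> T = {}"
  shows "measure_pmf.prob (Pi_pmf I d p) {\<omega>. F \<omega> \<and> G \<omega>}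
       = measure_pmf.prob (Pi_pmf I d p) {\<omega>. F \<omega>} * measure_pmf.prob (Pi_pmf I d p) {\<omega>. G \<omega>}"
proof -
  define A B where "A = I \<inter> S" and "B = I - S"
  define P Q where "P = Pi_pmf A d p" and "Q = Pi_pmf B d p"
  define h where "h = (\<lambda>(f, g) x. if x \<in> A then f x else (g x :: 'b))"
  have I: "I = A \<union> B" and fin: "finite A" "finite B" "A \<inter> B = {}"
    using \<open>finite I\<close> by (auto simp: A_def B_def)
  have eq: "Pi_pmf I d p = map_pmf h (pair_pmf P Q)"
    unfolding I h_def P_def Q_def by (rule Pi_pmf_union[OF fin])
  define F' where "F' = (\<lambda>f. F (\<lambda>x. if x \<in> A then f x else d))"
  define G' where "G' = (\<lambda>g. G (\<lambda>x. if x \<in> A then d else g x))"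
  have out: "g x = d" if "g \<in> set_pmf Q" "x \<notin> B" for g x
    using that set_Pi_pmf_subset[OF fin(2), of d p] by (auto simp: Q_def)
  have hF: "F (h (f, g)) \<longleftrightarrow> F' f" if "g \<in> set_pmf Q" for f g
    unfolding F'_def h_def
    by (rule depends_onD[OF F]) (auto simp: A_def B_def intro!: out[OF that])
  have hG: "G (h (f, g)) \<longleftrightarrow> G' g" for f g
    unfolding G'_def h_def using \<open>S \<inter> T = {}\<close>
    by (intro depends_onD[OF G]) (auto simp: A_def)
  \<comment> \<open>Stated for arbitrary events so that it yields the joint probability and, with
    one event replaced by \<open>True\<close>, both marginals.\<close>
  have *: "measure_pmf.prob (Pi_pmf I d p) {\<omega>. F \<omega> \<and> G \<omega>} = measure_pmf.prob P {f. F' f} * measure_pmf.prob Q {g. G' g}"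
    if hF: "\<And>f g. g \<in> set_pmf Q \<Longrightarrow> F (h (f, g)) \<longleftrightarrow> F' f" and hG: "\<And>f g. G (h (f, g)) \<longleftrightarrow> G' g" for F F' G G'
  proof -
    have "measure_pmf.prob (Pi_pmf I d p) {\<omega>. F \<omega> \<and> G \<omega>}
        = measure_pmf.prob (pair_pmf P Q) (h -` {\<omega>. F \<omega> \<and> G \<omega>})"
      by (simp add: eq)
    also have "\<dots> = measure_pmf.prob (pair_pmf P Q) ({f. F' f} \<times> {g. G' g})"
      using hF hG by (intro measure_pmf.finite_measure_eq_AE) (auto simp: AE_measure_pmf_iff)
    finally show ?thesis
      by (simp add: prob_pair_times)
  qed
  have "measure_pmf.prob (Pi_pmf I d p) {\<omega>. F \<omega>} = measure_pmf.prob P {f. F' f}"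
    using *[of F F' "\<lambda>_. True" "\<lambda>_. True", OF hF] by simp
  moreover have "measure_pmf.prob (Pi_pmf I d p) {\<omega>. G \<omega>} = measure_pmf.prob Q {g. G' g}"
    using *[of "\<lambda>_. True" "\<lambda>_. True" G G', OF _ hG] by simp
  ultimately show ?thesis
    using *[of F F' G G', OF hF hG] by simp
qed

lemma prob_Pi_pmf_All:
  assumes "finite I" "finite J"
    and "\<And>j. j \<in> J \<Longrightarrow> depends_on (F j) (S j)"
    and "disjoint_family_on S J"
  shows "measure_pmf.prob (Pi_pmf I d p) {\<omega>. \<forall>j\<in>J. F j \<omega>}
       = (\<Prod>j\<in>J. measure_pmf.prob (Pi_pmf I d p) {\<omega>. F j \<omega>})"
  using assms(2-4)
proof (induction J rule: finite_induct)
  case (insert j J)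
  have "S j \<inter> (\<Union>i\<in>J. S i) = {}"
    using insert.prems(2) insert.hyps(2) unfolding disjoint_family_on_def by fastforce
  moreover have "depends_on (\<lambda>\<omega>. \<forall>i\<in>J. F i \<omega>) (\<Union>i\<in>J. S i)"
    using insert.prems(1) by (intro depends_on_All) auto
  moreover have "disjoint_family_on S J"
    using insert.prems(2) by (rule disjoint_family_on_mono[rotated]) auto
  ultimately show ?case
    using insert prob_Pi_pmf_conj[OF \<open>finite I\<close>, of "F j" "S j" "\<lambda>\<omega>. \<forall>i\<in>J. F i \<omega>" "\<Union>i\<in>J. S i" d p]
    by simp
qed simp

lemma prob_compl_pmf: "measure_pmf.prob M {\<omega>. \<not> F \<omega>} = 1 - measure_pmf.prob M {\<omega>. F \<omega>}"
proof -
  have "{\<omega>. \<not> F \<omega>} = space M - {\<omega>. F \<omega>}"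
    by auto
  then show ?thesis
    using measure_pmf.prob_compl[of "{\<omega>. F \<omega>}" M] by simp
qed

text \<open>Channel bits and external bits become one product over a sum type, so that a single
  independence lemma treats both kinds of lifted nodes.\<close>

lemma map_pair_Pi_pmf:
  fixes I :: "'a set" and J :: "'c set" and d :: 'b
  assumes "finite I" "finite J"
  shows "map_pmf (\<lambda>(f, g). case_sum f g) (pair_pmf (Pi_pmf I d p) (Pi_pmf J d q))
       = Pi_pmf (I <+> J) d (case_sum p q)"
proof (rule pmf_eqI)
  fix h :: "'a + 'c \<Rightarrow> 'b"
  define k where "k = (\<lambda>(f, g). case_sum f g :: 'a + 'c \<Rightarrow> 'b)"
  have inj: "inj k"
    by (auto simp: inj_def k_def fun_eq_iff split: sum.splits)
  have h: "h = k (h \<circ> Inl, h \<circ> Inr)"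
    by (auto simp: k_def fun_eq_iff split: sum.splits)
  have "(\<forall>x. x \<notin> I <+> J \<longrightarrow> h x = d)
      \<longleftrightarrow> (\<forall>x. x \<notin> I \<longrightarrow> h (Inl x) = d) \<and> (\<forall>x. x \<notin> J \<longrightarrow> h (Inr x) = d)" (is "?L \<longleftrightarrow> ?R")
    by (auto simp: split_sum_all)
  then have "pmf (Pi_pmf I d p) (h \<circ> Inl) * pmf (Pi_pmf J d q) (h \<circ> Inr) = pmf (Pi_pmf (I <+> J) d (case_sum p q)) h"
    using assms by (auto simp add: pmf_Pi prod.Plus)
  moreover have "pmf (map_pmf k (pair_pmf (Pi_pmf I d p) (Pi_pmf J d q))) h
      = pmf (Pi_pmf I d p) (h \<circ> Inl) * pmf (Pi_pmf J d q) (h \<circ> Inr)"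
    by (subst h, subst pmf_map_inj'[OF inj]) (simp add: pmf_pair)
  ultimately show "pmf (map_pmf (\<lambda>(f, g). case_sum f g) (pair_pmf (Pi_pmf I d p) (Pi_pmf J d q))) h
      = pmf (Pi_pmf (I <+> J) d (case_sum p q)) h"
    by (simp add: k_def)
qed

section \<open>Non-backtracking words and their lifts\<close>

text \<open>The dart \<open>(True, e)\<close> crosses \<open>e\<close> from its variable node to its check node. Words list their
  darts from the last one to the first one.\<close>

type_synonym dart = "bool \<times> edge"

definition rev_dart :: "dart \<Rightarrow> dart" where
  "rev_dart d = (\<not> fst d, snd d)"

definition dart_src :: "dart \<Rightarrow> nat + check" where
  "dart_src d = (if fst d then Inl (fst (snd d)) else Inr (snd (snd d)))"

definition dart_tgt :: "dart \<Rightarrow> nat + check" where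
  "dart_tgt d = dart_src (rev_dart d)"

definition dart_perm :: "(edge \<Rightarrow> nat \<Rightarrow> nat) \<Rightarrow> dart \<Rightarrow> nat \<Rightarrow> nat" where
  "dart_perm \<pi> d = (if fst d then \<pi> (snd d) else inv (\<pi> (snd d)))"

fun word_end :: "nat + check \<Rightarrow> dart list \<Rightarrow> nat + check" where
  "word_end \<rho> [] = \<rho>"
| "word_end \<rho> (d # U) = dart_tgt d"

fun word :: "edge set \<Rightarrow> nat + check \<Rightarrow> dart list \<Rightarrow> bool" where
  "word E \<rho> [] \<longleftrightarrow> True"
| "word E \<rho> (d # U) \<longleftrightarrow>
     snd d \<in> E \<and> dart_src d = word_end \<rho> U \<and> (U \<noteq> [] \<longrightarrow> hd U \<noteq> rev_dart d) \<and> word E \<rho> U"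

fun word_pos :: "(edge \<Rightarrow> nat \<Rightarrow> nat) \<Rightarrow> nat \<Rightarrow> dart list \<Rightarrow> nat" where
  "word_pos \<pi> b [] = b"
| "word_pos \<pi> b (d # U) = dart_perm \<pi> d (word_pos \<pi> b U)"

definition copy_of :: "nat + check \<Rightarrow> nat \<Rightarrow> (nat \<times> nat) + (check \<times> nat)" where
  "copy_of n a = map_sum (\<lambda>v. (v, a)) (\<lambda>c. (c, a)) n"

definition lift_end :: "(edge \<Rightarrow> nat \<Rightarrow> nat) \<Rightarrow> nat + check \<Rightarrow> nat \<Rightarrow> dart list \<Rightarrow> (nat \<times> nat) + (check \<times> nat)" where
  "lift_end \<pi> \<rho> b U = copy_of (word_end \<rho> U) (word_pos \<pi> b U)"

fun lift_trace :: "(edge \<Rightarrow> nat \<Rightarrow> nat) \<Rightarrow> nat + check \<Rightarrow> nat \<Rightarrow> dart list \<Rightarrow> ((nat \<times> nat) + (check \<times> nat)) list" where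
  "lift_trace \<pi> \<rho> b [] = [lift_end \<pi> \<rho> b []]"
| "lift_trace \<pi> \<rho> b (d # U) = lift_end \<pi> \<rho> b (d # U) # lift_trace \<pi> \<rho> b U"

definition words :: "edge set \<Rightarrow> nat + check \<Rightarrow> nat \<Rightarrow> dart list set" where
  "words E \<rho> M = {U. word E \<rho> U \<and> length U \<le> M}"

lemma rev_rev_dart [simp]: "rev_dart (rev_dart d) = d"
  and snd_rev_dart [simp]: "snd (rev_dart d) = snd d"
  and src_rev_dart [simp]: "dart_src (rev_dart d) = dart_tgt d"
  and tgt_rev_dart [simp]: "dart_tgt (rev_dart d) = dart_src d"
  by (cases d; simp add: rev_dart_def dart_tgt_def)+

lemma dart_cases_edge: "snd d' = snd d \<Longrightarrow> d' = d \<or> d' = rev_dart d"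
  by (cases d; cases d') (auto simp: rev_dart_def)

lemma copy_of_eq_iff [simp]: "copy_of n a = copy_of n' a' \<longleftrightarrow> n = n' \<and> a = a'"
  by (cases n; cases n') (auto simp: copy_of_def)

lemma length_lift_trace [simp]: "length (lift_trace \<pi> \<rho> b U) = Suc (length U)"
  by (induction U) auto

lemma lift_end_in_trace: "lift_end \<pi> \<rho> b V \<in> set (lift_trace \<pi> \<rho> b (W @ V))"
  by (induction W) (cases V; auto)+

lemma word_appendD: "word E \<rho> (W @ V) \<Longrightarrow> word E \<rho> V"
  by (induction W) auto

lemma word_edges: "word E \<rho> U \<Longrightarrow> snd ` set U \<subseteq> E"
  by (induction U) auto

lemma finite_words:
  assumes "finite E"
  shows "finite (words E \<rho> M)"
proof -
  have "words E \<rho> M \<subseteq> {U. set U \<subseteq> UNIV \<times> E \<and> length U \<le> M}"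
    using word_edges by (fastforce simp: words_def)
  then show ?thesis
    by (rule finite_subset) (use assms in \<open>auto intro!: finite_lists_length_le\<close>)
qed

text \<open>Every \<open>\<pi> e\<close> is a permutation, also for pairs \<open>e\<close> that are
  no protograph edges; sampled families satisfy this because their default is
  \<open>id\<close>.\<close>

locale lift_perms =
  fixes \<pi> :: "edge \<Rightarrow> nat \<Rightarrow> nat" and L :: nat
  assumes perm: "\<pi> e permutes {..<L}"
begin

lemma dart_perm_permutes: "dart_perm \<pi> d permutes {..<L}"
  by (simp add: dart_perm_def perm permutes_inv)

lemma dart_perm_eq_iff [simp]: "dart_perm \<pi> d a = dart_perm \<pi> d a' \<longleftrightarrow> a = a'"
  by (rule inj_eq[OF permutes_inj[OF dart_perm_permutes]])

lemma dart_perm_less_iff [simp]: "dart_perm \<pi> d a < L \<longleftrightarrow> a < L"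
  using permutes_in_image[OF dart_perm_permutes, of d a] by simp

lemma dart_perm_rev [simp]: "dart_perm \<pi> (rev_dart d) (dart_perm \<pi> d a) = a"
  using permutes_inverses[OF perm] by (auto simp: dart_perm_def rev_dart_def)

lemma word_pos_less_iff [simp]: "word_pos \<pi> b U < L \<longleftrightarrow> b < L"
  by (induction U) auto

lemma word_pos_inj: "word_pos \<pi> b U = word_pos \<pi> b' U \<Longrightarrow> b = b'"
  by (induction U) auto

text \<open>Walking \<open>V\<close> backwards from the common end returns to the root. Only the
  junction could backtrack, and there the condition on the heads excludes it. After one step the new
  head is \<open>rev_dart d\<close>, and the condition persists because \<open>V\<close> itself does
  not backtrack.\<close>

lemma closed_word_rev_append:
  assumes "word E \<rho> V" "word E \<rho> U" "lift_end \<pi> \<rho> b U = lift_end \<pi> \<rho> b V"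
    and "V \<noteq> [] \<Longrightarrow> U \<noteq> [] \<Longrightarrow> hd U \<noteq> hd V"
  shows "word E \<rho> (rev (map rev_dart V) @ U) \<and>
         lift_end \<pi> \<rho> b (rev (map rev_dart V) @ U) = lift_end \<pi> \<rho> b []"
  using assms
proof (induction V arbitrary: U)
  case (Cons d V)
  have "lift_end \<pi> \<rho> b (rev_dart d # U) = lift_end \<pi> \<rho> b V"
    using Cons.prems by (simp add: lift_end_def)
  moreover have "word E \<rho> (rev_dart d # U)"
    using Cons.prems by (auto simp: lift_end_def)
  moreover have "hd V \<noteq> rev_dart d" if "V \<noteq> []"
    using Cons.prems(1) that by auto
  ultimately show ?case
    using Cons.IH[of "rev_dart d # U"] Cons.prems(1) by fastforce
qed simp

text \<open>Common last darts are cancelled, their lifts being injective. Since the words differ,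
  what remains is either a single nonempty closed word or two words with different last darts, and
  then the second can be walked backwards after the first.\<close>

lemma ex_closed_word:
  assumes "word E \<rho> U" "word E \<rho> V" "U \<noteq> V" "lift_end \<pi> \<rho> b U = lift_end \<pi> \<rho> b V"
  shows "\<exists>W. word E \<rho> W \<and> W \<noteq> [] \<and> length W \<le> length U + length V \<and>
             lift_end \<pi> \<rho> b W = lift_end \<pi> \<rho> b []"
  using assms
proof (induction U arbitrary: V)
  case Nil
  then show ?case
    by (intro exI[of _ V]) auto
next
  case (Cons d U)
  show ?case
  proof (cases V)
    case Nil
    then show ?thesis
      using Cons.prems by (intro exI[of _ "d # U"]) auto
  next
    case V: (Cons d' V')
    show ?thesis
    proof (cases "d = d'")
      case True
      then have eq: "lift_end \<pi> \<rho> b U = lift_end \<pi> \<rho> b V'"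
        using Cons.prems V by (auto simp: lift_end_def)
      have "word E \<rho> U" "word E \<rho> V'" "U \<noteq> V'"
        using Cons.prems V True by simp_all
      from Cons.IH[OF this eq] obtain W where "word E \<rho> W" "W \<noteq> []"
          "length W \<le> length U + length V'" "lift_end \<pi> \<rho> b W = lift_end \<pi> \<rho> b []"
        by blast
      then show ?thesis
        using V by (intro exI[of _ W]) auto
    next
      case False
      then show ?thesis
        using closed_word_rev_append[of E \<rho> V "d # U" b] Cons.prems V
        by (intro exI[of _ "rev (map rev_dart V) @ d # U"]) (simp del: word.simps)
    qed
  qed
qed

text \<open>Two words of length at most \<open>M\<close> combine to a closed word of length at most
  \<open>2 * M\<close>; this is the origin of the doubled radius in the counting.\<close>

lemma inj_on_lift_end:
  assumes "\<And>W. W \<in> words E \<rho> (2 * M) \<Longrightarrow> W \<noteq> [] \<Longrightarrow> lift_end \<pi> \<rho> b W \<noteq> lift_end \<pi> \<rho> b []"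
  shows "inj_on (lift_end \<pi> \<rho> b) (words E \<rho> M)"
proof (rule inj_onI, rule ccontr)
  fix U V assume "U \<in> words E \<rho> M" "V \<in> words E \<rho> M" "lift_end \<pi> \<rho> b U = lift_end \<pi> \<rho> b V" "U \<noteq> V"
  then obtain W where "word E \<rho> W" "W \<noteq> []" "length W \<le> 2 * M" "lift_end \<pi> \<rho> b W = lift_end \<pi> \<rho> b []"
    using ex_closed_word[of E \<rho> U V b] by (fastforce simp: words_def)
  then show False
    using assms[of W] by (auto simp: words_def)
qed

text \<open>Redirection asks for a step that is the first to meet the trace, and a closed word may
  have met its own trace long before it closes.\<close>

lemma ex_first_repetition:
  assumes "\<not> distinct (lift_trace \<pi> \<rho> b W)" "word E \<rho> W"
  shows "\<exists>d U. word E \<rho> (d # U) \<and> length (d # U) \<le> length W \<and> distinct (lift_trace \<pi> \<rho> b U)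
      \<and> lift_end \<pi> \<rho> b (d # U) \<in> set (lift_trace \<pi> \<rho> b U)"
  using assms
proof (induction W)
  case (Cons a W)
  show ?case
  proof (cases "distinct (lift_trace \<pi> \<rho> b W)")
    case True
    with Cons.prems show ?thesis
      by (intro exI[of _ a] exI[of _ W]) auto
  next
    case False
    then obtain d' U where "word E \<rho> (d' # U)" "length (d' # U) \<le> length W"
        "distinct (lift_trace \<pi> \<rho> b U)" "lift_end \<pi> \<rho> b (d' # U) \<in> set (lift_trace \<pi> \<rho> b U)"
      using Cons.IH[OF False] Cons.prems(2) unfolding word.simps by blast
    then show ?thesis
      by (intro exI[of _ d'] exI[of _ U]) (simp del: word.simps)
  qed
qed simp

lemma closed_word_not_distinct:
  assumes "W \<noteq> []" "lift_end \<pi> \<rho> b W = lift_end \<pi> \<rho> b []"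
  shows "\<not> distinct (lift_trace \<pi> \<rho> b W)"
  using assms lift_end_in_trace[of \<pi> \<rho> b "[]" "tl W"] by (cases W) auto

end

section \<open>Redirecting one step by a transposition\<close>

definition switch :: "dart \<Rightarrow> nat \<Rightarrow> nat \<Rightarrow> (edge \<Rightarrow> nat \<Rightarrow> nat) \<Rightarrow> edge \<Rightarrow> nat \<Rightarrow> nat" where
  "switch d x y \<pi> = \<pi>(snd d := (if fst d then Transposition.transpose x y \<circ> \<pi> (snd d) else \<pi> (snd d) \<circ> Transposition.transpose x y))"

lemma switch_switch [simp]: "switch d x y (switch d x y \<pi>) = \<pi>"
  by (auto simp: switch_def fun_eq_iff)

lemma (in lift_perms) switch_perms:
  assumes "x < L" "y < L"
  shows "lift_perms (switch d x y \<pi>) L"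
proof
  fix e
  have "Transposition.transpose x y permutes {..<L}"
    using assms by (intro permutes_swap_id) auto
  then show "switch d x y \<pi> e permutes {..<L}"
    by (auto simp: switch_def perm permutes_compose)
qed

text \<open>\<open>switch\<close> composes on the side that puts the transposition after the step
  along \<open>d\<close>, whichever way \<open>d\<close> crosses its edge. The swapped
  \<open>x\<close> and \<open>y\<close> are thus copies of the target of \<open>d\<close>, and only
  steps along \<open>d\<close> or \<open>rev_dart d\<close> can notice.\<close>

lemma (in lift_perms) dart_perm_switch:
  assumes "x < L" "y < L"
  shows "dart_perm (switch d x y \<pi>) d = Transposition.transpose x y \<circ> dart_perm \<pi> d"
    and "dart_perm (switch d x y \<pi>) (rev_dart d) = dart_perm \<pi> (rev_dart d) \<circ> Transposition.transpose x y"
    and "snd d' \<noteq> snd d \<Longrightarrow> dart_perm (switch d x y \<pi>) d' = dart_perm \<pi> d'"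
  using permutes_bij[OF perm[of "snd d"]]
  by (auto simp: dart_perm_def switch_def rev_dart_def o_inv_distrib)

context lift_perms
begin

text \<open>An earlier step along \<open>d\<close> that arrives at \<open>x\<close>, or along
  \<open>rev_dart d\<close> that leaves \<open>x\<close>, has its other end at the end of
  \<open>U\<close>, because \<open>d\<close> leads from there to \<open>x\<close>. This repeats a
  node of the trace of \<open>U\<close>, unless the reversed step is the last one of
  \<open>U\<close>, which non-backtracking forbids. Copy \<open>y\<close> is avoided by
  assumption.\<close>

lemma word_pos_switch:
  assumes "word E \<rho> (d # U)" "b < L" "y < L"
    and x: "x = word_pos \<pi> b (d # U)"
    and dist: "distinct (lift_trace \<pi> \<rho> b U)"
    and y: "\<And>V W. U = W @ V \<Longrightarrow> y \<noteq> word_pos \<pi> b V"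
    and "U = W @ V"
  shows "word_pos (switch d x y \<pi>) b V = word_pos \<pi> b V"
  using \<open>U = W @ V\<close>
proof (induction V arbitrary: W)
  case (Cons d1 V)
  have IH: "word_pos (switch d x y \<pi>) b V = word_pos \<pi> b V"
    using Cons.IH[of "W @ [d1]"] Cons.prems by simp
  have "x < L"
    using x \<open>b < L\<close> by simp
  note sw = dart_perm_switch[OF \<open>x < L\<close> \<open>y < L\<close>, where d = d]
  have word: "word E \<rho> (d1 # V)"
    using assms(1) word_appendD[of E \<rho> W "d1 # V"] unfolding Cons.prems word.simps(2)[of E \<rho> d] by blast
  consider "d1 = d" | "d1 = rev_dart d" | "snd d1 \<noteq> snd d"
    using dart_cases_edge by blast
  then show ?case
  proof cases
    case 1
    have "word_pos \<pi> b (d1 # V) \<noteq> x"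
    proof
      assume "word_pos \<pi> b (d1 # V) = x"
      then have "lift_end \<pi> \<rho> b V = lift_end \<pi> \<rho> b U"
        using x 1 word assms(1) by (auto simp: lift_end_def)
      moreover obtain d2 U' W' where "U = d2 # U'" "U' = W' @ V"
        using Cons.prems by (cases W) auto
      ultimately show False
        using dist lift_end_in_trace[of \<pi> \<rho> b V W'] by simp
    qed
    moreover have "word_pos \<pi> b (d1 # V) \<noteq> y"
      using y[OF Cons.prems] by auto
    ultimately show ?thesis
      using 1 IH by (simp add: sw)
  next
    case 2
    have "word_pos \<pi> b V \<noteq> y"
      using y[of "W @ [d1]" V] Cons.prems by auto
    moreover have "word_pos \<pi> b V \<noteq> x"
    proof
      assume eq: "word_pos \<pi> b V = x"
      then have eq: "lift_end \<pi> \<rho> b (d1 # V) = lift_end \<pi> \<rho> b U"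
        using x 2 word assms(1) by (auto simp: lift_end_def)
      show False
      proof (cases W)
        case Nil
        then show False
          using Cons.prems 2 assms(1) by auto
      next
        case (Cons d2 W')
        then show False
          using eq dist lift_end_in_trace[of \<pi> \<rho> b "d1 # V" W'] \<open>U = W @ d1 # V\<close> by auto
      qed
    qed
    ultimately show ?thesis
      using 2 IH by (simp add: sw)
  next
    case 3
    then show ?thesis
      using IH by (simp add: sw)
  qed
qed simp

end

lemma trace_cong:
  assumes "\<And>V W. U = W @ V \<Longrightarrow> word_pos \<pi>' b V = word_pos \<pi> b V"
  shows "lift_trace \<pi>' \<rho> b U = lift_trace \<pi> \<rho> b U"
  using assms
proof (induction U)
  case Nil
  show ?case by (simp add: lift_end_def)
next
  case (Cons d U)
  have "word_pos \<pi>' b (d # U) = word_pos \<pi> b (d # U)"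
    using Cons.prems[of "[]"] by simp
  moreover have "lift_trace \<pi>' \<rho> b U = lift_trace \<pi> \<rho> b U"
    using Cons.prems by (intro Cons.IH) (metis append_Cons)
  ultimately show ?case
    by (simp add: lift_end_def)
qed

definition edge_perms :: "edge set \<Rightarrow> nat \<Rightarrow> (edge \<Rightarrow> nat \<Rightarrow> nat) set" where
  "edge_perms E L = PiE_dflt E id (\<lambda>_. {p. p permutes {..<L}})"

lemma edge_perms_lift_perms: "\<pi> \<in> edge_perms E L \<Longrightarrow> lift_perms \<pi> L"
proof
  fix e assume "\<pi> \<in> edge_perms E L"
  then show "\<pi> e permutes {..<L}"
    by (cases "e \<in> E") (simp_all add: edge_perms_def PiE_dflt_def permutes_id del: split_paired_All)
qed

lemma finite_edge_perms: "finite E \<Longrightarrow> finite (edge_perms E L)"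
  by (auto simp: edge_perms_def intro!: finite_PiE_dflt finite_permutations)

lemma edge_perms_nonempty: "edge_perms E L \<noteq> {}"
  by (auto simp: edge_perms_def intro: permutes_id)

lemma switch_edge_perms:
  assumes "\<pi> \<in> edge_perms E L" "x < L" "y < L" "snd d \<in> E"
  shows "switch d x y \<pi> \<in> edge_perms E L"
proof -
  interpret lift_perms \<pi> L
    using assms(1) by (rule edge_perms_lift_perms)
  interpret s: lift_perms "switch d x y \<pi>" L
    using assms by (intro switch_perms)
  show ?thesis
    using s.perm assms by (auto simp: edge_perms_def PiE_dflt_def switch_def)
qed

lemma finite_suffix_positions:
  "finite {word_pos \<pi> b V | V W. U = W @ V} \<and> card {word_pos \<pi> b V | V W. U = W @ V} \<le> Suc (length U)"
proof (induction U)
  case (Cons d U)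
  have "{word_pos \<pi> b V | V W. d # U = W @ V} = insert (word_pos \<pi> b (d # U)) {word_pos \<pi> b V | V W. U = W @ V}"
    unfolding Cons_eq_append_conv by blast
  then show ?case
    using Cons by (auto intro: card_insert_le_m1 order_trans[OF card_insert_le_m1])
qed auto

text \<open>Redirecting the last step of the word to a copy \<open>y\<close> off the trace is injective in the pair of
  lifting and \<open>y\<close>: the new lifting still shows \<open>y\<close> as its end point and the former end point as
  entry \<open>j\<close> of the trace.\<close>

lemma card_repetition_le:
  assumes "finite E" "word E \<rho> (d # U)" "b < L" "j \<le> length U"
  defines "R \<equiv> {\<pi> \<in> edge_perms E L. distinct (lift_trace \<pi> \<rho> b U) \<and> lift_end \<pi> \<rho> b (d # U) = lift_trace \<pi> \<rho> b U ! j}"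
  shows "card R * (L - Suc (length U)) \<le> card (edge_perms E L)"
proof -
  \<comment> \<open>\<open>y\<close> avoids every copy index of the trace, whatever node it belongs
    to; at least \<open>L - Suc (length U)\<close> choices remain.\<close>
  define Y where "Y = (\<lambda>\<pi>. {..<L} - {word_pos \<pi> b V | V W. U = W @ V})"
  define f where "f = (\<lambda>(\<pi>, y). switch d (word_pos \<pi> b (d # U)) y \<pi>)"
  have finR: "finite R"
    unfolding R_def using finite_edge_perms[OF \<open>finite E\<close>] by simp
  have main: "f (\<pi>, y) \<in> edge_perms E L \<and> word_pos (f (\<pi>, y)) b (d # U) = y \<and>
      copy_of (dart_tgt d) (word_pos \<pi> b (d # U)) = lift_trace (f (\<pi>, y)) \<rho> b U ! j"
    if "\<pi> \<in> R" "y \<in> Y \<pi>" for \<pi> y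
  proof -
    have \<pi>: "\<pi> \<in> edge_perms E L" "distinct (lift_trace \<pi> \<rho> b U)" "lift_end \<pi> \<rho> b (d # U) = lift_trace \<pi> \<rho> b U ! j"
      using that(1) by (auto simp: R_def)
    have y: "y < L" "\<And>V W. U = W @ V \<Longrightarrow> y \<noteq> word_pos \<pi> b V"
      using that(2) by (auto simp: Y_def)
    interpret lift_perms \<pi> L
      using \<pi>(1) by (rule edge_perms_lift_perms)
    define x where "x = word_pos \<pi> b (d # U)"
    have "x < L"
      using \<open>b < L\<close> by (simp add: x_def)
    have pos: "word_pos (switch d x y \<pi>) b V = word_pos \<pi> b V" if "U = W @ V" for V W
      using word_pos_switch[OF assms(2,3) y(1) x_def \<pi>(2) y(2) that] .
    have "lift_trace (switch d x y \<pi>) \<rho> b U = lift_trace \<pi> \<rho> b U"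
      using pos by (rule trace_cong)
    moreover have "word_pos (switch d x y \<pi>) b (d # U) = y"
      using pos[of "[]" U] dart_perm_switch(1)[OF \<open>x < L\<close> y(1), of d] by (simp add: x_def)
    moreover have "switch d x y \<pi> \<in> edge_perms E L"
      using \<pi>(1) \<open>x < L\<close> y(1) assms(2) by (intro switch_edge_perms) auto
    ultimately show ?thesis
      using \<pi>(3) by (simp add: f_def x_def lift_end_def del: word_pos.simps)
  qed
  have "inj_on f (SIGMA \<pi>:R. Y \<pi>)"
  proof (rule inj_onI, clarify)
    fix \<pi> y \<pi>' y'
    assume *: "\<pi> \<in> R" "y \<in> Y \<pi>" "\<pi>' \<in> R" "y' \<in> Y \<pi>'" "f (\<pi>, y) = f (\<pi>', y')"
    define x x' where "x = word_pos \<pi> b (d # U)" and "x' = word_pos \<pi>' b (d # U)"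
    have "y = y'"
      using main[OF *(1,2)] main[OF *(3,4)] *(5) by metis
    moreover have "copy_of (dart_tgt d) x = copy_of (dart_tgt d) x'"
      using main[OF *(1,2)] main[OF *(3,4)] *(5) unfolding x_def x'_def by metis
    then have "x = x'"
      by simp
    \<comment> \<open>\<open>switch\<close> undoes itself, so the common image together with
      \<open>d\<close>, \<open>x\<close> and \<open>y\<close> gives back the lifting.\<close>
    moreover have "switch d x y (switch d x y \<pi>) = switch d x y (switch d x' y' \<pi>')"
      using *(5) by (simp add: f_def x_def x'_def del: word_pos.simps switch_switch)
    ultimately show "\<pi> = \<pi>' \<and> y = y'"
      by simp
  qed
  moreover have "f ` (SIGMA \<pi>:R. Y \<pi>) \<subseteq> edge_perms E L"
    using main by auto
  ultimately have "card (SIGMA \<pi>:R. Y \<pi>) \<le> card (edge_perms E L)"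
    by (rule card_inj_on_le) (rule finite_edge_perms[OF \<open>finite E\<close>])
  moreover have "card R * (L - Suc (length U)) \<le> card (SIGMA \<pi>:R. Y \<pi>)"
  proof -
    have "card R * (L - Suc (length U)) = (\<Sum>\<pi>\<in>R. L - Suc (length U))"
      by simp
    also have "\<dots> \<le> (\<Sum>\<pi>\<in>R. card (Y \<pi>))"
    proof (rule sum_mono)
      fix \<pi> assume "\<pi> \<in> R"
      have "L - Suc (length U) \<le> card {..<L} - card {word_pos \<pi> b V | V W. U = W @ V}"
        using finite_suffix_positions[of \<pi> b U] by (simp add: diff_le_mono2)
      also have "\<dots> \<le> card (Y \<pi>)"
        unfolding Y_def using finite_suffix_positions[of \<pi> b U] by (intro diff_card_le_card_Diff) simp
      finally show "L - Suc (length U) \<le> card (Y \<pi>)" .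
    qed
    also have "\<dots> = card (SIGMA \<pi>:R. Y \<pi>)"
      using finR by (intro card_SigmaI[symmetric]) (auto simp: Y_def)
    finally show ?thesis .
  qed
  ultimately show ?thesis
    by (rule order_trans[rotated])
qed

section \<open>Messages over tree-like neighbourhoods\<close>

definition other_at_vn :: "edge set \<Rightarrow> edge \<Rightarrow> edge set" where
  "other_at_vn A e = {g \<in> A. fst g = fst e \<and> g \<noteq> e}"

definition other_at_cn :: "edge set \<Rightarrow> edge \<Rightarrow> edge set" where
  "other_at_cn A e = {g \<in> A. snd g = snd e \<and> g \<noteq> e}"

definition de_cn :: "edge set \<Rightarrow> (check \<Rightarrow> real) \<Rightarrow> (edge \<Rightarrow> real) \<Rightarrow> edge \<Rightarrow> real" where
  "de_cn A q x g = 1 - (1 - q (snd g)) * (\<Prod>h\<in>other_at_cn A g. 1 - x h)"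

text \<open>Density evolution edge by edge. The edge \<open>e\<close> may lie outside
  \<open>A\<close>, which covers the messages sent to inactive checks; in that case the product runs
  over all active edges at the variable node.\<close>

primrec de_vn :: "edge set \<Rightarrow> real \<Rightarrow> (check \<Rightarrow> real) \<Rightarrow> nat \<Rightarrow> edge \<Rightarrow> real" where
  "de_vn A \<epsilon> q 0 = (\<lambda>e. 1)"
| "de_vn A \<epsilon> q (Suc n) = (\<lambda>e. \<epsilon> * (\<Prod>g\<in>other_at_vn A e. de_cn A q (de_vn A \<epsilon> q n) g))"

definition lift_msg ::
  "edge set \<Rightarrow> (edge \<Rightarrow> nat \<Rightarrow> nat) \<Rightarrow> nat \<Rightarrow> nat \<Rightarrow> edge \<Rightarrow> nat \<Rightarrow> ((nat \<times> nat) + (check \<times> nat) \<Rightarrow> bool) \<Rightarrow> bool" where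
  "lift_msg A \<pi> L n e a \<omega> =
     bp_vn (A \<times> {..<L}) vn_end (cn_end \<pi>) (\<lambda>x. \<omega> (Inl x)) (\<lambda>x. \<omega> (Inr x)) n (e, a)"

text \<open>The common form of the three fractions. With \<open>H = {e}\<close> and no external bit
  it is the message along \<open>e\<close> to its check; with the other active edges at the check
  and the external bit it is the message from the check; with all edges at a left check and no
  external bit it is the outgoing message.\<close>

definition cn_event ::
  "edge set \<Rightarrow> (edge \<Rightarrow> nat \<Rightarrow> nat) \<Rightarrow> nat \<Rightarrow> nat \<Rightarrow> bool \<Rightarrow> edge set \<Rightarrow> check \<Rightarrow> nat
    \<Rightarrow> ((nat \<times> nat) + (check \<times> nat) \<Rightarrow> bool) \<Rightarrow> bool" where
  "cn_event A \<pi> L n flag H c b \<omega> \<longleftrightarrow>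
     (flag \<and> \<omega> (Inr (c, b))) \<or> (\<exists>h\<in>H. lift_msg A \<pi> L n h (inv (\<pi> h) b) \<omega>)"

lemma vn_end_eq: "vn_end (e, a) = (fst e, a)"
  by (cases e) simp

lemma cn_end_eq: "cn_end \<pi> (e, a) = (snd e, \<pi> e a)"
  by (cases e) simp

context lift_perms
begin

lemma perm_less: "a < L \<Longrightarrow> \<pi> e a < L"
  using permutes_in_image[OF perm, of e a] by simp

lemma inv_perm_less: "b < L \<Longrightarrow> inv (\<pi> e) b < L"
  using permutes_in_image[OF permutes_inv[OF perm], of e b] by simp

lemma perm_inv [simp]: "\<pi> e (inv (\<pi> e) b) = b" "inv (\<pi> e) (\<pi> e a) = a"
  using permutes_inverses[OF perm] by auto

text \<open>Each copy of a check lies on exactly one lift of every protograph edge at that check.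
  The remaining lifted edges at the copy are therefore lifts of the remaining protograph edges, one
  each.\<close>

lemma cn_out_lift:
  assumes "a < L"
  shows "cn_out (A \<times> {..<L}) (cn_end \<pi>) ext m (g, a) \<longleftrightarrow>
    ext (snd g, \<pi> g a) \<or> (\<exists>h\<in>other_at_cn A g. m (h, inv (\<pi> h) (\<pi> g a)))"
proof -
  have "(\<exists>f\<in>A \<times> {..<L}. f \<noteq> (g, a) \<and> cn_end \<pi> f = cn_end \<pi> (g, a) \<and> m f)
    \<longleftrightarrow> (\<exists>h\<in>other_at_cn A g. m (h, inv (\<pi> h) (\<pi> g a)))" (is "?L \<longleftrightarrow> ?R")
  proof
    assume ?L
    then obtain h a' where h: "h \<in> A" "a' < L" "(h, a') \<noteq> (g, a)" "snd h = snd g" "\<pi> h a' = \<pi> g a" "m (h, a')"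
      by (auto simp: cn_end_eq simp del: cn_end.simps split_paired_Ex split_paired_All)
    have "a' = inv (\<pi> h) (\<pi> g a)"
      using h(5)[symmetric] by simp
    moreover have "h \<noteq> g"
      using h(3,5) \<open>a' = inv (\<pi> h) (\<pi> g a)\<close> by auto
    ultimately show ?R
      using h by (intro bexI[of _ h]) (auto simp: other_at_cn_def)
  next
    assume ?R
    then obtain h where "h \<in> other_at_cn A g" "m (h, inv (\<pi> h) (\<pi> g a))"
      by blast
    then show ?L
      using assms perm_less inv_perm_less
      by (intro bexI[of _ "(h, inv (\<pi> h) (\<pi> g a))"]) (auto simp: cn_end_eq other_at_cn_def simp del: cn_end.simps)
  qed
  then show ?thesis
    by (simp add: cn_out_def cn_end_eq del: cn_end.simps)
qed

lemma vn_out_lift: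
  assumes "a < L"
  shows "vn_out (A \<times> {..<L}) vn_end ch m (e, a) \<longleftrightarrow> ch (fst e, a) \<and> (\<forall>g\<in>other_at_vn A e. m (g, a))"
  using assms by (auto simp: vn_out_def vn_end_eq other_at_vn_def simp del: vn_end.simps)

lemma lift_msg_0: "lift_msg A \<pi> L 0 e a \<omega>"
  by (simp add: lift_msg_def)

lemma lift_msg_Suc:
  assumes "a < L"
  shows "lift_msg A \<pi> L (Suc n) e a \<omega> \<longleftrightarrow> \<omega> (Inl (fst e, a)) \<and>
    (\<forall>g\<in>other_at_vn A e. \<omega> (Inr (snd g, \<pi> g a)) \<or>
       (\<exists>h\<in>other_at_cn A g. lift_msg A \<pi> L n h (inv (\<pi> h) (\<pi> g a)) \<omega>))"
  using assms by (simp add: lift_msg_def vn_out_lift cn_out_lift)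

end

section \<open>Subtrees of words and the bits that a message reads\<close>

definition extensions :: "edge set \<Rightarrow> nat + check \<Rightarrow> nat \<Rightarrow> dart list \<Rightarrow> dart list set" where
  "extensions E \<rho> M U = {V \<in> words E \<rho> M. \<exists>W. V = W @ U}"

lemma extensions_Cons: "extensions E \<rho> M (d # U) \<subseteq> extensions E \<rho> M U"
  by (auto simp: extensions_def intro: append.assoc[symmetric])

lemma self_in_extensions: "U \<in> words E \<rho> M \<Longrightarrow> U \<in> extensions E \<rho> M U"
  by (auto simp: extensions_def)

lemma extensions_subset_words: "extensions E \<rho> M U \<subseteq> words E \<rho> M"
  by (auto simp: extensions_def)

text \<open>Words put later darts in front, so the subtree below \<open>U\<close> consists of the
  words that have \<open>U\<close> as a suffix, and a list has only one suffix of a given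
  length.\<close>

lemma extensions_disjoint:
  "length U = length V \<Longrightarrow> U \<noteq> V \<Longrightarrow> extensions E \<rho> M U \<inter> extensions E \<rho> M V = {}"
  by (auto simp: extensions_def)

lemma not_in_extensions_Cons: "U \<notin> extensions E \<rho> M (d # U)"
  by (auto simp: extensions_def dest: arg_cong[where f = length])

text \<open>Two edge sets: words and trees use \<open>E\<close>, decoding uses \<open>A\<close>. The
  bits are kept abstract as a product measure whose marginals at the ends of edges of
  \<open>E\<close> are the prescribed erasure probabilities.\<close>

locale lift_bits = lift_perms \<pi> L for \<pi> L +
  fixes E A :: "edge set" and I :: "((nat \<times> nat) + (check \<times> nat)) set" and p \<epsilon> q
  assumes finite_E: "finite E" and A_subset: "A \<subseteq> E" and finite_I: "finite I"
    and prob_vn: "e \<in> E \<Longrightarrow> a < L \<Longrightarrow>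
      measure_pmf.prob (Pi_pmf I False p) {\<omega>. \<omega> (Inl (fst e, a))} = \<epsilon>"
    and prob_cn: "e \<in> E \<Longrightarrow> b < L \<Longrightarrow>
      measure_pmf.prob (Pi_pmf I False p) {\<omega>. \<omega> (Inr (snd e, b))} = q (snd e)"
begin

abbreviation bits :: "((nat \<times> nat) + (check \<times> nat) \<Rightarrow> bool) pmf" where
  "bits \<equiv> Pi_pmf I False p"

text \<open>The event reads the bit at the end of \<open>V\<close> and, through each
  \<open>h\<close> in \<open>H\<close>, the subtree entered by \<open>(False, h)\<close>. The
  condition on \<open>hd V\<close> says that the edge on which the word arrived is not among those
  read, so each continuation is non-backtracking.\<close>

lemma cn_event_depends:
  assumes V: "word E \<rho> V" "word_end \<rho> V = Inr c" "length V < M"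
    and H: "H \<subseteq> {h \<in> E. snd h = c}" "\<And>h. h \<in> H \<Longrightarrow> V \<noteq> [] \<Longrightarrow> hd V \<noteq> (True, h)"
    and msg: "\<And>h. h \<in> H \<Longrightarrow> word E \<rho> ((False, h) # V) \<Longrightarrow>
        depends_on (lift_msg A \<pi> L n h (word_pos \<pi> b ((False, h) # V)))
          (lift_end \<pi> \<rho> b ` extensions E \<rho> M ((False, h) # V))"
  shows "depends_on (cn_event A \<pi> L n flag H c (word_pos \<pi> b V)) (lift_end \<pi> \<rho> b ` extensions E \<rho> M V)"
proof -
  define S where "S = lift_end \<pi> \<rho> b ` extensions E \<rho> M V"
  have V_words: "V \<in> words E \<rho> M"
    using V by (simp add: words_def)
  have "Inr (c, word_pos \<pi> b V) = lift_end \<pi> \<rho> b V"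
    using V(2) by (simp add: lift_end_def copy_of_def)
  then have in_S: "Inr (c, word_pos \<pi> b V) \<in> S"
    using self_in_extensions[OF V_words] by (simp add: S_def)
  have word: "word E \<rho> ((False, h) # V)" if "h \<in> H" for h
    using V H that by (auto simp: dart_src_def rev_dart_def)
  have "depends_on (lift_msg A \<pi> L n h (inv (\<pi> h) (word_pos \<pi> b V))) S" if "h \<in> H" for h
    using msg[OF that word[OF that]] extensions_Cons[of E \<rho> M "(False, h)" V]
    unfolding S_def by (auto simp: dart_perm_def intro: depends_on_mono[OF _ image_mono])
  note dep = this
  show ?thesis
    unfolding S_def[symmetric]
  proof (rule depends_onI)
    fix \<omega> \<omega>' :: "(nat \<times> nat) + (check \<times> nat) \<Rightarrow> bool"
    assume eq: "\<And>i. i \<in> S \<Longrightarrow> \<omega> i = \<omega>' i"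
    have "(\<exists>h\<in>H. lift_msg A \<pi> L n h (inv (\<pi> h) (word_pos \<pi> b V)) \<omega>)
      \<longleftrightarrow> (\<exists>h\<in>H. lift_msg A \<pi> L n h (inv (\<pi> h) (word_pos \<pi> b V)) \<omega>')"
      by (rule bex_cong[OF refl]) (rule depends_onD[OF dep eq])
    then show "cn_event A \<pi> L n flag H c (word_pos \<pi> b V) \<omega> = cn_event A \<pi> L n flag H c (word_pos \<pi> b V) \<omega>'"
      unfolding cn_event_def eq[OF in_S] by blast
  qed
qed

text \<open>Injectivity on words turns disjoint subtrees into disjoint sets of lifted nodes. The
  absence of any erasure is then a conjunction of independent events, which gives the
  product.\<close>

lemma prob_cn_event:
  assumes inj: "inj_on (lift_end \<pi> \<rho> b) (words E \<rho> M)" and "b < L"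
    and V: "word E \<rho> V" "word_end \<rho> V = Inr c" "length V < M" "c \<in> snd ` E"
    and H: "H \<subseteq> {h \<in> E. snd h = c}" "\<And>h. h \<in> H \<Longrightarrow> V \<noteq> [] \<Longrightarrow> hd V \<noteq> (True, h)"
    and msg: "\<And>h. h \<in> H \<Longrightarrow> word E \<rho> ((False, h) # V) \<Longrightarrow>
        depends_on (lift_msg A \<pi> L n h (word_pos \<pi> b ((False, h) # V)))
          (lift_end \<pi> \<rho> b ` extensions E \<rho> M ((False, h) # V))"
    and prob_msg: "\<And>h. h \<in> H \<Longrightarrow> word E \<rho> ((False, h) # V) \<Longrightarrow>
        measure_pmf.prob bits {\<omega>. lift_msg A \<pi> L n h (word_pos \<pi> b ((False, h) # V)) \<omega>} = de_vn A \<epsilon> q n h"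
  shows "measure_pmf.prob bits {\<omega>. cn_event A \<pi> L n flag H c (word_pos \<pi> b V) \<omega>}
       = 1 - (1 - of_bool flag * q c) * (\<Prod>h\<in>H. 1 - de_vn A \<epsilon> q n h)"
proof -
  define S where "S = (\<lambda>h. lift_end \<pi> \<rho> b ` extensions E \<rho> M ((False, h) # V))"
  define m where "m = (\<lambda>h. lift_msg A \<pi> L n h (inv (\<pi> h) (word_pos \<pi> b V)))"
  define F where "F = (\<lambda>\<omega> :: (nat \<times> nat) + (check \<times> nat) \<Rightarrow> bool. flag \<and> \<omega> (Inr (c, word_pos \<pi> b V)))"
  have "finite H"
    using H(1) finite_E by (auto intro: finite_subset)
  have pos: "word_pos \<pi> b ((False, h) # V) = inv (\<pi> h) (word_pos \<pi> b V)" for h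
    by (simp add: dart_perm_def)
  have word: "word E \<rho> ((False, h) # V)" if "h \<in> H" for h
    using V H that by (auto simp: dart_src_def rev_dart_def)
  have V_words: "V \<in> words E \<rho> M"
    using V by (simp add: words_def)
  have ends: "lift_end \<pi> \<rho> b ` X \<inter> lift_end \<pi> \<rho> b ` Y = {}"
    if "X \<inter> Y = {}" "X \<subseteq> words E \<rho> M" "Y \<subseteq> words E \<rho> M" for X Y
    using inj_on_image_Int[OF inj that(2,3)] that(1) by simp
  have dep_m: "depends_on (\<lambda>\<omega>. \<not> m h \<omega>) (S h)" if "h \<in> H" for h
    using msg[OF that word[OF that]] unfolding pos S_def m_def by (rule depends_on_not)
  have Sh: "S h \<inter> S h' = {}" if "h \<noteq> h'" for h h'
    unfolding S_def using that by (intro ends extensions_disjoint extensions_subset_words) auto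
  \<comment> \<open>The root \<open>V\<close> of the subtrees belongs to none of them, so the
    external bit is independent of all the messages.\<close>
  have "lift_end \<pi> \<rho> b ` {V} \<inter> S h = {}" for h
    unfolding S_def using V_words not_in_extensions_Cons[of V E \<rho> M "(False, h)"]
    by (intro ends extensions_subset_words) auto
  then have SV: "{lift_end \<pi> \<rho> b V} \<inter> (\<Union>h\<in>H. S h) = {}"
    by auto
  have eq: "Inr (c, word_pos \<pi> b V) = lift_end \<pi> \<rho> b V"
    using V(2) by (simp add: lift_end_def copy_of_def)
  have dep_F: "depends_on (\<lambda>\<omega>. \<not> F \<omega>) {lift_end \<pi> \<rho> b V}"
    unfolding F_def eq by (rule depends_onI) simp
  obtain e where e: "e \<in> E" "snd e = c"
    using V(4) by auto
  have "word_pos \<pi> b V < L"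
    using \<open>b < L\<close> by simp
  then have "measure_pmf.prob bits {\<omega>. F \<omega>} = of_bool flag * q c"
    using prob_cn[OF e(1)] e(2) by (cases flag) (auto simp: F_def)
  then have F: "measure_pmf.prob bits {\<omega>. \<not> F \<omega>} = 1 - of_bool flag * q c"
    by (simp add: prob_compl_pmf)
  have "measure_pmf.prob bits {\<omega>. \<forall>h\<in>H. \<not> m h \<omega>} = (\<Prod>h\<in>H. measure_pmf.prob bits {\<omega>. \<not> m h \<omega>})"
    using dep_m Sh by (intro prob_Pi_pmf_All[OF finite_I \<open>finite H\<close>, of _ S]) (auto simp: disjoint_family_on_def)
  also have "\<dots> = (\<Prod>h\<in>H. 1 - de_vn A \<epsilon> q n h)"
    using prob_msg[OF _ word] by (intro prod.cong) (auto simp: prob_compl_pmf m_def pos simp del: word_pos.simps)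
  finally have m: "measure_pmf.prob bits {\<omega>. \<forall>h\<in>H. \<not> m h \<omega>} = (\<Prod>h\<in>H. 1 - de_vn A \<epsilon> q n h)" .
  have "measure_pmf.prob bits {\<omega>. \<not> cn_event A \<pi> L n flag H c (word_pos \<pi> b V) \<omega>}
      = measure_pmf.prob bits {\<omega>. \<not> F \<omega> \<and> (\<forall>h\<in>H. \<not> m h \<omega>)}"
    by (rule arg_cong[where f = "measure_pmf.prob bits"]) (auto simp: cn_event_def F_def m_def)
  also have "\<dots> = (1 - of_bool flag * q c) * (\<Prod>h\<in>H. 1 - de_vn A \<epsilon> q n h)"
    using prob_Pi_pmf_conj[OF finite_I dep_F depends_on_All[OF dep_m] SV] F m by simp
  finally show ?thesis
    using prob_compl_pmf[of bits "cn_event A \<pi> L n flag H c (word_pos \<pi> b V)"] by linarith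
qed

lemma lift_msg_Suc_cn_event:
  assumes "a < L"
  shows "lift_msg A \<pi> L (Suc n) e a \<omega> \<longleftrightarrow> \<omega> (Inl (fst e, a)) \<and>
    (\<forall>g\<in>other_at_vn A e. cn_event A \<pi> L n True (other_at_cn A g) (snd g) (\<pi> g a) \<omega>)"
  using assms by (simp add: lift_msg_Suc cn_event_def)

lemma word_step_to_check:
  assumes "word E \<rho> ((False, e) # U)" "g \<in> other_at_vn A e"
  shows "word E \<rho> ((True, g) # (False, e) # U)"
  using assms A_subset by (auto simp: other_at_vn_def dart_src_def dart_tgt_def rev_dart_def)

text \<open>Valid in every lifting, tree-like or not: only independence needs distinct ends. Each
  iteration adds two darts, to a check and on to a variable node, whence the bound on
  \<open>M\<close>.\<close>

lemma lift_msg_depends: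
  assumes "word E \<rho> ((False, e) # U)" "Suc (length U) + 2 * n \<le> M" "b < L"
  shows "depends_on (lift_msg A \<pi> L n e (word_pos \<pi> b ((False, e) # U)))
           (lift_end \<pi> \<rho> b ` extensions E \<rho> M ((False, e) # U))"
  using assms
proof (induction n arbitrary: e U)
  case 0
  show ?case
    by (rule depends_onI) (simp add: lift_msg_0)
next
  case (Suc n)
  define V where "V = (False, e) # U"
  define a where "a = word_pos \<pi> b V"
  define S where "S = lift_end \<pi> \<rho> b ` extensions E \<rho> M V"
  have "a < L"
    unfolding a_def using Suc.prems by (subst word_pos_less_iff)
  have V: "V \<in> words E \<rho> M"
    using Suc.prems by (simp add: words_def V_def del: word.simps)
  have "lift_end \<pi> \<rho> b V = Inl (fst e, a)"
    by (simp add: lift_end_def copy_of_def a_def V_def dart_tgt_def dart_src_def rev_dart_def)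
  then have in_S: "Inl (fst e, a) \<in> S"
    using self_in_extensions[OF V] unfolding S_def by force
  have "depends_on (cn_event A \<pi> L n True (other_at_cn A g) (snd g) (\<pi> g a)) S" if g: "g \<in> other_at_vn A e" for g
  proof -
    have "depends_on (cn_event A \<pi> L n True (other_at_cn A g) (snd g) (word_pos \<pi> b ((True, g) # V)))
            (lift_end \<pi> \<rho> b ` extensions E \<rho> M ((True, g) # V))"
      using word_step_to_check[OF Suc.prems(1) g] Suc.prems A_subset unfolding V_def
      by (intro cn_event_depends Suc.IH) (auto simp: dart_tgt_def dart_src_def rev_dart_def other_at_cn_def simp del: word.simps word_pos.simps)
    then show ?thesis
      using extensions_Cons[of E \<rho> M "(True, g)" V] unfolding S_def a_def
      by (auto simp: dart_perm_def intro: depends_on_mono[OF _ image_mono])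
  qed
  note dep = this
  show ?case
    unfolding V_def[symmetric] a_def[symmetric] S_def[symmetric]
  proof (rule depends_onI)
    fix \<omega> \<omega>' :: "(nat \<times> nat) + (check \<times> nat) \<Rightarrow> bool"
    assume eq: "\<And>i. i \<in> S \<Longrightarrow> \<omega> i = \<omega>' i"
    have "(\<forall>g\<in>other_at_vn A e. cn_event A \<pi> L n True (other_at_cn A g) (snd g) (\<pi> g a) \<omega>)
      \<longleftrightarrow> (\<forall>g\<in>other_at_vn A e. cn_event A \<pi> L n True (other_at_cn A g) (snd g) (\<pi> g a) \<omega>')"
      by (rule ball_cong[OF refl]) (rule depends_onD[OF dep eq])
    then show "lift_msg A \<pi> L (Suc n) e a \<omega> = lift_msg A \<pi> L (Suc n) e a \<omega>'"
      unfolding lift_msg_Suc_cn_event[OF \<open>a < L\<close>] eq[OF in_S] by blast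
  qed
qed

text \<open>The channel bit of a variable copy and the check events behind its other edges occupy
  disjoint parts of the tree, so their probabilities multiply. Each check event is evaluated by
  \<open>prob_cn_event\<close> with the induction hypothesis.\<close>

lemma prob_lift_msg:
  assumes inj: "inj_on (lift_end \<pi> \<rho> b) (words E \<rho> M)" and "b < L"
    and "word E \<rho> ((False, e) # U)" "Suc (length U) + 2 * n \<le> M"
  shows "measure_pmf.prob bits {\<omega>. lift_msg A \<pi> L n e (word_pos \<pi> b ((False, e) # U)) \<omega>} = de_vn A \<epsilon> q n e"
  using assms(3,4)
proof (induction n arbitrary: e U)
  case 0
  show ?case
    by (simp add: lift_msg_0)
next
  case (Suc n)
  define V where "V = (False, e) # U"
  define a where "a = word_pos \<pi> b V"
  define J where "J = other_at_vn A e"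
  define S where "S = (\<lambda>g. lift_end \<pi> \<rho> b ` extensions E \<rho> M ((True, g) # V))"
  define G where "G = (\<lambda>g. cn_event A \<pi> L n True (other_at_cn A g) (snd g) (\<pi> g a))"
  have "finite J"
    using finite_subset[OF A_subset finite_E] by (auto simp: J_def other_at_vn_def)
  have "a < L"
    unfolding a_def using \<open>b < L\<close> by (subst word_pos_less_iff)
  have V: "V \<in> words E \<rho> M"
    using Suc.prems by (simp add: words_def V_def del: word.simps)
  have pos: "word_pos \<pi> b ((True, g) # V) = \<pi> g a" for g
    by (simp add: dart_perm_def a_def)
  have ends: "lift_end \<pi> \<rho> b ` X \<inter> lift_end \<pi> \<rho> b ` Y = {}"
    if "X \<inter> Y = {}" "X \<subseteq> words E \<rho> M" "Y \<subseteq> words E \<rho> M" for X Y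
    using inj_on_image_Int[OF inj that(2,3)] that(1) by simp
  have dep_G: "depends_on (G g) (S g)" if g: "g \<in> J" for g
    using word_step_to_check[OF Suc.prems(1)] g Suc.prems A_subset \<open>b < L\<close>
    unfolding V_def G_def S_def J_def pos[symmetric, unfolded V_def]
    by (intro cn_event_depends lift_msg_depends)
       (auto simp: dart_tgt_def dart_src_def rev_dart_def other_at_cn_def simp del: word.simps word_pos.simps)
  have prob_G: "measure_pmf.prob bits {\<omega>. G g \<omega>} = de_cn A q (de_vn A \<epsilon> q n) g" if g: "g \<in> J" for g
  proof -
    have "snd g \<in> snd ` E"
      using g A_subset by (auto simp: J_def other_at_vn_def)
    then have "measure_pmf.prob bits {\<omega>. cn_event A \<pi> L n True (other_at_cn A g) (snd g) (word_pos \<pi> b ((True, g) # V)) \<omega>}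
      = 1 - (1 - of_bool True * q (snd g)) * (\<Prod>h\<in>other_at_cn A g. 1 - de_vn A \<epsilon> q n h)"
      using word_step_to_check[OF Suc.prems(1)] g Suc.prems A_subset \<open>b < L\<close> unfolding V_def J_def
      by (intro prob_cn_event[OF inj] lift_msg_depends Suc.IH)
         (auto simp: dart_tgt_def dart_src_def rev_dart_def other_at_cn_def simp del: word.simps word_pos.simps)
    then show ?thesis
      unfolding G_def pos by (simp add: de_cn_def)
  qed
  have SS: "S g \<inter> S g' = {}" if "g \<noteq> g'" for g g'
    unfolding S_def using that by (intro ends extensions_disjoint extensions_subset_words) auto
  have "lift_end \<pi> \<rho> b ` {V} \<inter> S g = {}" for g
    unfolding S_def using V not_in_extensions_Cons[of V E \<rho> M "(True, g)"]
    by (intro ends extensions_subset_words) auto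
  then have SV: "{lift_end \<pi> \<rho> b V} \<inter> (\<Union>g\<in>J. S g) = {}"
    by auto
  have eq: "Inl (fst e, a) = lift_end \<pi> \<rho> b V"
    by (simp add: lift_end_def copy_of_def a_def V_def dart_tgt_def dart_src_def rev_dart_def)
  have dep: "depends_on (\<lambda>\<omega>. \<omega> (Inl (fst e, a))) {lift_end \<pi> \<rho> b V}"
    unfolding eq by (rule depends_onI) simp
  have "e \<in> E"
    using Suc.prems by simp
  have "measure_pmf.prob bits {\<omega>. \<forall>g\<in>J. G g \<omega>} = (\<Prod>g\<in>J. measure_pmf.prob bits {\<omega>. G g \<omega>})"
    using dep_G SS by (intro prob_Pi_pmf_All[OF finite_I \<open>finite J\<close>, of _ S]) (auto simp: disjoint_family_on_def)
  also have "\<dots> = (\<Prod>g\<in>J. de_cn A q (de_vn A \<epsilon> q n) g)"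
    by (intro prod.cong prob_G) auto
  finally have "measure_pmf.prob bits {\<omega>. \<omega> (Inl (fst e, a)) \<and> (\<forall>g\<in>J. G g \<omega>)} = de_vn A \<epsilon> q (Suc n) e"
    using prob_Pi_pmf_conj[OF finite_I dep depends_on_All[OF dep_G] SV] prob_vn[OF \<open>e \<in> E\<close> \<open>a < L\<close>]
    by (simp add: J_def)
  then show ?case
    unfolding V_def[symmetric] a_def[symmetric] lift_msg_Suc_cn_event[OF \<open>a < L\<close>] G_def J_def .
qed

end

section \<open>Concentration for a fixed lifting\<close>

text \<open>Markov's inequality for the square of the centred sum. A pair of copies outside
  \<open>B\<close> and not related by \<open>R\<close> has covariance \<open>0\<close>, every other
  pair contributes at most \<open>1\<close>, and there are at most
  \<open>L * (K + 2 * card B)\<close> of those.\<close>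

lemma second_moment_fraction:
  fixes P :: "'a pmf" and Z :: "nat \<Rightarrow> 'a \<Rightarrow> bool"
  assumes fin: "finite (set_pmf P)" and p: "0 \<le> p" "p \<le> 1" and "\<eta> > 0" and "L > 0"
    and B: "B \<subseteq> {..<L}" and R: "\<And>b. b < L \<Longrightarrow> R b \<subseteq> {..<L} \<and> card (R b) \<le> K"
    and prob: "\<And>b. b < L \<Longrightarrow> b \<notin> B \<Longrightarrow> measure_pmf.prob P {\<omega>. Z b \<omega>} = p"
    and prob2: "\<And>b b'. b < L \<Longrightarrow> b' < L \<Longrightarrow> b \<notin> B \<Longrightarrow> b' \<notin> B \<Longrightarrow> b' \<notin> R b \<Longrightarrow>
        measure_pmf.prob P {\<omega>. Z b \<omega> \<and> Z b' \<omega>} = p\<^sup>2"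
  shows "measure_pmf.prob P {\<omega>. \<bar>real (card {b. b < L \<and> Z b \<omega>}) / real L - p\<bar> > \<eta>}
       \<le> (real K + 2 * real (card B)) / (\<eta>\<^sup>2 * real L)"
proof -
  define Y where "Y = (\<lambda>b \<omega>. of_bool (Z b \<omega>) - p :: real)"
  define S where "S = (\<lambda>\<omega>. \<Sum>b<L. Y b \<omega>)"
  have int [simp]: "integrable P f" for f :: "'a \<Rightarrow> real"
    by (rule integrable_measure_pmf_finite[OF fin])
  have Y1: "\<bar>Y b \<omega>\<bar> \<le> 1" for b \<omega>
    using p by (auto simp: Y_def)
  have E_of_bool: "measure_pmf.expectation P (\<lambda>\<omega>. of_bool (F \<omega>)) = measure_pmf.prob P {\<omega>. F \<omega>}" for F
  proof -
    have "(\<lambda>\<omega>. of_bool (F \<omega>) :: real) = indicator {\<omega>. F \<omega>}"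
      by (auto simp: indicator_def)
    then show ?thesis
      by simp
  qed
  have E: "measure_pmf.expectation P (\<lambda>\<omega>. Y b \<omega> * Y b' \<omega>) \<le> of_bool (b \<in> B) + of_bool (b' \<in> B) + of_bool (b' \<in> R b)"
    if "b < L" "b' < L" for b b'
  proof (cases "b \<in> B \<or> b' \<in> B \<or> b' \<in> R b")
    case True
    have "Y b \<omega> * Y b' \<omega> \<le> 1" for \<omega>
      using mult_mono[OF Y1[of b \<omega>] Y1[of b' \<omega>]] by (simp add: abs_mult[symmetric])
    then have "measure_pmf.expectation P (\<lambda>\<omega>. Y b \<omega> * Y b' \<omega>) \<le> measure_pmf.expectation P (\<lambda>\<omega>. 1)"
      by (intro integral_mono) auto
    also have "\<dots> \<le> of_bool (b \<in> B) + of_bool (b' \<in> B) + of_bool (b' \<in> R b)"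
      using True by auto
    finally show ?thesis .
  next
    case False
    have "(\<lambda>\<omega>. Y b \<omega> * Y b' \<omega>)
        = (\<lambda>\<omega>. of_bool (Z b \<omega> \<and> Z b' \<omega>) - p * of_bool (Z b \<omega>) - p * of_bool (Z b' \<omega>) + p\<^sup>2)"
      by (auto simp: Y_def algebra_simps power2_eq_square)
    then have "measure_pmf.expectation P (\<lambda>\<omega>. Y b \<omega> * Y b' \<omega>)
        = measure_pmf.prob P {\<omega>. Z b \<omega> \<and> Z b' \<omega>} - p * measure_pmf.prob P {\<omega>. Z b \<omega>}
          - p * measure_pmf.prob P {\<omega>. Z b' \<omega>} + p\<^sup>2"
      by (simp add: E_of_bool)
    then show ?thesis
      using False prob[OF that(1)] prob[OF that(2)] prob2[OF that] by (simp add: power2_eq_square)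
  qed
  have sumB: "(\<Sum>b<L. of_bool (b \<in> B)) = real (card B)"
    using B by (simp add: sum.If_cases of_bool_def Int_absorb1)
  have sumR: "(\<Sum>b'<L. of_bool (b' \<in> R b)) \<le> real K" if "b < L" for b
    using R[OF that] by (simp add: sum.If_cases of_bool_def Int_absorb1)
  have "measure_pmf.expectation P (\<lambda>\<omega>. (S \<omega>)\<^sup>2) = (\<Sum>b<L. \<Sum>b'<L. measure_pmf.expectation P (\<lambda>\<omega>. Y b \<omega> * Y b' \<omega>))"
    by (simp add: S_def power2_eq_square sum_product)
  also have "\<dots> \<le> (\<Sum>b<L. \<Sum>b'<L. of_bool (b \<in> B) + of_bool (b' \<in> B) + of_bool (b' \<in> R b))"
    by (intro sum_mono E) auto
  also have "\<dots> = (\<Sum>b<L. real L * of_bool (b \<in> B) + real (card B) + (\<Sum>b'<L. of_bool (b' \<in> R b)))"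
    by (simp only: sum.distrib sumB) simp
  also have "\<dots> \<le> (\<Sum>b<L. real L * of_bool (b \<in> B) + real (card B) + real K)"
    using sumR by (intro sum_mono add_mono) auto
  also have "\<dots> = real L * (real K + 2 * real (card B))"
    by (simp add: sum.distrib sum_distrib_left[symmetric] sumB algebra_simps)
  finally have second: "measure_pmf.expectation P (\<lambda>\<omega>. (S \<omega>)\<^sup>2) \<le> real L * (real K + 2 * real (card B))" .
  have "\<bar>real (card {b. b < L \<and> Z b \<omega>}) / real L - p\<bar> > \<eta> \<Longrightarrow> (S \<omega>)\<^sup>2 \<ge> (\<eta> * real L)\<^sup>2" for \<omega>
  proof -
    assume *: "\<bar>real (card {b. b < L \<and> Z b \<omega>}) / real L - p\<bar> > \<eta>"
    have "{..<L} \<inter> {b. Z b \<omega>} = {b. b < L \<and> Z b \<omega>}"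
      by auto
    then have "S \<omega> = real (card {b. b < L \<and> Z b \<omega>}) - real L * p"
      by (simp add: S_def Y_def sum_subtractf sum.If_cases of_bool_def)
    then have "S \<omega> = real L * (real (card {b. b < L \<and> Z b \<omega>}) / real L - p)"
      using \<open>L > 0\<close> by (simp add: right_diff_distrib)
    then have "\<bar>S \<omega>\<bar> = real L * \<bar>real (card {b. b < L \<and> Z b \<omega>}) / real L - p\<bar>"
      by (simp add: abs_mult)
    also have "\<dots> \<ge> real L * \<eta>"
      using * by (intro mult_left_mono) auto
    finally have "\<bar>\<eta> * real L\<bar> \<le> \<bar>S \<omega>\<bar>"
      using \<open>\<eta> > 0\<close> by (simp add: mult.commute)
    then show ?thesis
      by (simp only: abs_le_square_iff)
  qed
  then have "measure_pmf.prob P {\<omega>. \<bar>real (card {b. b < L \<and> Z b \<omega>}) / real L - p\<bar> > \<eta>}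
      \<le> measure_pmf.prob P {\<omega> \<in> space P. (S \<omega>)\<^sup>2 \<ge> (\<eta> * real L)\<^sup>2}"
    by (intro measure_pmf.finite_measure_mono) auto
  also have "\<dots> \<le> measure_pmf.expectation P (\<lambda>\<omega>. (S \<omega>)\<^sup>2) / (\<eta> * real L)\<^sup>2"
    using \<open>\<eta> > 0\<close> \<open>L > 0\<close> by (intro integral_Markov_inequality_measure[where A = "{}"]) auto
  also have "\<dots> \<le> real L * (real K + 2 * real (card B)) / (\<eta> * real L)\<^sup>2"
    using second by (intro divide_right_mono) auto
  also have "\<dots> = (real K + 2 * real (card B)) / (\<eta>\<^sup>2 * real L)"
    using \<open>L > 0\<close> by (simp add: power2_eq_square)
  finally show ?thesis .
qed

section \<open>Rarity of copies that are not tree-like\<close>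

definition tree_like :: "edge set \<Rightarrow> (edge \<Rightarrow> nat \<Rightarrow> nat) \<Rightarrow> nat + check \<Rightarrow> nat \<Rightarrow> nat \<Rightarrow> bool" where
  "tree_like E \<pi> \<rho> M b \<longleftrightarrow> inj_on (lift_end \<pi> \<rho> b) (words E \<rho> M)"

text \<open>Union bound over the word \<open>V\<close> whose last step is the first to meet its
  trace and over the trace entry \<open>j\<close> that it meets. For each such pair
  \<open>card_repetition_le\<close> bounds the share of liftings by
  \<open>1 / (L - 2 * M)\<close>.\<close>

lemma card_not_tree_like_le:
  assumes "finite E" "b < L" "2 * M < L"
  shows "real (card {\<pi> \<in> edge_perms E L. \<not> tree_like E \<pi> \<rho> M b})
       \<le> real (card (words E \<rho> (2 * M)) * (2 * M)) / real (L - 2 * M) * real (card (edge_perms E L))"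
proof -
  define R where "R = (\<lambda>(V, j). {\<pi> \<in> edge_perms E L. distinct (lift_trace \<pi> \<rho> b (tl V)) \<and>
      lift_end \<pi> \<rho> b V = lift_trace \<pi> \<rho> b (tl V) ! j})"
  define X where "X = (words E \<rho> (2 * M) - {[]}) \<times> {..<2 * M}"
  \<comment> \<open>The trace of \<open>tl V\<close> has exactly \<open>length V\<close>
    entries.\<close>
  define X' where "X' = {(V, j) \<in> X. j < length V}"
  have "finite X"
    using finite_words[OF \<open>finite E\<close>] by (auto simp: X_def)
  moreover have "X' \<subseteq> X"
    by (auto simp: X'_def)
  ultimately have finX: "finite X" "finite X'"
    by (auto intro: finite_subset)
  have finR: "finite (R Vj)" for Vj
    using finite_edge_perms[OF \<open>finite E\<close>] by (auto simp: R_def split: prod.splits)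
  have sub: "{\<pi> \<in> edge_perms E L. \<not> tree_like E \<pi> \<rho> M b} \<subseteq> (\<Union>Vj\<in>X'. R Vj)"
  proof
    fix \<pi> assume \<pi>: "\<pi> \<in> {\<pi> \<in> edge_perms E L. \<not> tree_like E \<pi> \<rho> M b}"
    then interpret lift_perms \<pi> L
      using edge_perms_lift_perms by blast
    obtain W where W: "W \<in> words E \<rho> (2 * M)" "W \<noteq> []" "lift_end \<pi> \<rho> b W = lift_end \<pi> \<rho> b []"
      using \<pi> inj_on_lift_end[of E \<rho> M b] unfolding tree_like_def by blast
    obtain d U where U: "word E \<rho> (d # U)" "length (d # U) \<le> length W" "distinct (lift_trace \<pi> \<rho> b U)"
      "lift_end \<pi> \<rho> b (d # U) \<in> set (lift_trace \<pi> \<rho> b U)"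
      using ex_first_repetition[OF closed_word_not_distinct[OF W(2,3)]] W(1) unfolding words_def by blast
    then obtain j where j: "j < length (d # U)" "lift_end \<pi> \<rho> b (d # U) = lift_trace \<pi> \<rho> b U ! j"
      by (auto simp: in_set_conv_nth)
    have "d # U \<in> words E \<rho> (2 * M)"
      using U W(1) by (simp add: words_def)
    moreover have "j < 2 * M"
      using j(1) U(2) W(1) by (simp add: words_def)
    ultimately have "(d # U, j) \<in> X'"
      using j(1) by (auto simp: X'_def X_def)
    moreover have "\<pi> \<in> R (d # U, j)"
      using \<pi> U j by (simp add: R_def)
    ultimately show "\<pi> \<in> (\<Union>Vj\<in>X'. R Vj)"
      by blast
  qed
  have card_R: "real (card (R Vj)) \<le> real (card (edge_perms E L)) / real (L - 2 * M)" if Vj: "Vj \<in> X'" for Vj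
  proof -
    obtain d U j where [simp]: "Vj = (d # U, j)"
      using Vj by (cases Vj; cases "fst Vj") (auto simp: X'_def X_def)
    have "word E \<rho> (d # U)" "length U < 2 * M" "j \<le> length U"
      using Vj by (auto simp: X'_def X_def words_def)
    then have "card (R Vj) * (L - Suc (length U)) \<le> card (edge_perms E L)"
      using card_repetition_le[OF \<open>finite E\<close> _ \<open>b < L\<close>, of \<rho> d U j] by (simp add: R_def)
    moreover have "card (R Vj) * (L - 2 * M) \<le> card (R Vj) * (L - Suc (length U))"
      using \<open>length U < 2 * M\<close> by (intro mult_le_mono) auto
    ultimately have "real (card (R Vj) * (L - 2 * M)) \<le> real (card (edge_perms E L))"
      by (intro of_nat_mono) linarith
    then show ?thesis
      using \<open>2 * M < L\<close> by (subst pos_le_divide_eq) (simp_all only: of_nat_mult of_nat_0_less_iff zero_less_diff)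
  qed
  have "real (card {\<pi> \<in> edge_perms E L. \<not> tree_like E \<pi> \<rho> M b}) \<le> real (card (\<Union>Vj\<in>X'. R Vj))"
    using finX finR by (intro of_nat_mono card_mono[OF _ sub]) auto
  also have "\<dots> \<le> (\<Sum>Vj\<in>X'. real (card (R Vj)))"
    using card_UN_le[OF finX(2), of R] by (simp only: of_nat_sum[symmetric] of_nat_le_iff)
  also have "\<dots> \<le> real (card X') * (real (card (edge_perms E L)) / real (L - 2 * M))"
    using card_R by (rule sum_bounded_above)
  also have "\<dots> \<le> real (card (words E \<rho> (2 * M)) * (2 * M)) * (real (card (edge_perms E L)) / real (L - 2 * M))"
  proof (intro mult_right_mono of_nat_mono)
    have "card X' \<le> card X"
      using finX by (intro card_mono) (auto simp: X'_def)
    also have "\<dots> = card (words E \<rho> (2 * M) - {[]}) * (2 * M)"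
      by (simp add: X_def card_cartesian_product)
    also have "\<dots> \<le> card (words E \<rho> (2 * M)) * (2 * M)"
      using finite_words[OF \<open>finite E\<close>] by (intro mult_right_mono card_mono) auto
    finally show "card X' \<le> card (words E \<rho> (2 * M)) * (2 * M)" .
  qed auto
  finally show ?thesis
    by simp
qed

text \<open>A common node is the end of some word \<open>U\<close> from \<open>b\<close> and of some
  word \<open>V\<close> from \<open>b'\<close>; walking \<open>V\<close> backwards shows that
  \<open>U\<close> and \<open>V\<close> determine \<open>b'\<close>. The bound does not grow with
  \<open>L\<close>.\<close>

lemma (in lift_perms) card_overlap_le:
  assumes "finite E"
  shows "card {b'. b' < L \<and> lift_end \<pi> \<rho> b ` words E \<rho> M \<inter> lift_end \<pi> \<rho> b' ` words E \<rho> M \<noteq> {}}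
       \<le> (card (words E \<rho> M))\<^sup>2"
proof -
  define f where "f = (\<lambda>(U, V). inv (\<lambda>b. word_pos \<pi> b V) (word_pos \<pi> b U))"
  have fin: "finite (words E \<rho> M \<times> words E \<rho> M)"
    using finite_words[OF assms] by simp
  have "{b'. b' < L \<and> lift_end \<pi> \<rho> b ` words E \<rho> M \<inter> lift_end \<pi> \<rho> b' ` words E \<rho> M \<noteq> {}}
      \<subseteq> f ` (words E \<rho> M \<times> words E \<rho> M)"
  proof clarify
    fix b' i assume "lift_end \<pi> \<rho> b ` words E \<rho> M \<inter> lift_end \<pi> \<rho> b' ` words E \<rho> M \<noteq> {}"
    then obtain U V where UV: "U \<in> words E \<rho> M" "V \<in> words E \<rho> M" "lift_end \<pi> \<rho> b U = lift_end \<pi> \<rho> b' V"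
      by blast
    have "inj (\<lambda>b. word_pos \<pi> b V)"
      using word_pos_inj by (auto intro: injI)
    then have "f (U, V) = b'"
      using UV(3) inv_f_f[of "\<lambda>b. word_pos \<pi> b V" b'] by (simp add: f_def lift_end_def)
    then show "b' \<in> f ` (words E \<rho> M \<times> words E \<rho> M)"
      using UV by (metis SigmaI image_eqI)
  qed
  then have "card {b'. b' < L \<and> lift_end \<pi> \<rho> b ` words E \<rho> M \<inter> lift_end \<pi> \<rho> b' ` words E \<rho> M \<noteq> {}}
      \<le> card (f ` (words E \<rho> M \<times> words E \<rho> M))"
    using fin by (intro card_mono) auto
  also have "\<dots> \<le> card (words E \<rho> M \<times> words E \<rho> M)"
    by (rule card_image_le[OF fin])
  finally show ?thesis
    by (simp add: power2_eq_square card_cartesian_product)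
qed

definition cn_value :: "edge set \<Rightarrow> real \<Rightarrow> (check \<Rightarrow> real) \<Rightarrow> nat \<Rightarrow> bool \<Rightarrow> edge set \<Rightarrow> check \<Rightarrow> real" where
  "cn_value A \<epsilon> q n flag H c = 1 - (1 - of_bool flag * q c) * (\<Prod>h\<in>H. 1 - de_vn A \<epsilon> q n h)"

lemma unit_one_minus: "(x::real) \<in> {0..1} \<Longrightarrow> 1 - x \<in> {0..1}"
  by auto

lemma unit_mult: "(x::real) \<in> {0..1} \<Longrightarrow> y \<in> {0..1} \<Longrightarrow> x * y \<in> {0..1}"
  by (auto intro: mult_le_one)

lemma unit_prod: "(\<And>i. i \<in> I \<Longrightarrow> (f i :: real) \<in> {0..1}) \<Longrightarrow> prod f I \<in> {0..1}"
  by (auto intro!: prod_nonneg prod_le_1)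

lemma de_vn_unit:
  assumes "\<epsilon> \<in> {0..1}" "\<And>g. g \<in> A \<Longrightarrow> q (snd g) \<in> {0..1}"
  shows "de_vn A \<epsilon> q n e \<in> {0..1}"
proof (induction n arbitrary: e)
  case (Suc n)
  have "q (snd g) \<in> {0..1}" if "g \<in> other_at_vn A e" for g
    using that assms(2)[of g] by (simp add: other_at_vn_def)
  with Suc show ?case
    unfolding de_vn.simps(2) de_cn_def using assms(1)
    by (intro unit_mult unit_prod unit_one_minus)
qed simp

lemma cn_value_unit:
  assumes "\<epsilon> \<in> {0..1}" "\<And>g. g \<in> A \<Longrightarrow> q (snd g) \<in> {0..1}" "q c \<in> {0..1}"
  shows "cn_value A \<epsilon> q n flag H c \<in> {0..1}"
proof -
  have "of_bool flag * q c \<in> {0..1}"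
    using assms(3) by (cases flag) auto
  then show ?thesis
    unfolding cn_value_def
    by (intro unit_one_minus[OF unit_mult[OF unit_one_minus unit_prod[OF unit_one_minus[OF de_vn_unit]]]] assms(1,2))
qed

context lift_bits
begin

lemma finite_set_bits: "finite (set_pmf bits)"
  by (simp add: set_Pi_pmf[OF finite_I] finite_PiE_dflt finite_I)

text \<open>From the check copy one dart leads to a variable node and each of the \<open>n\<close>
  iterations adds two, hence \<open>M = 2 * n + 1\<close>. In the second moment bound,
  \<open>R\<close> collects the copies with overlapping neighbourhoods and \<open>B\<close> those
  that are not tree-like.\<close>

lemma prob_cn_fraction_deviates:
  assumes "\<eta> > 0" "L > 0" "\<epsilon> \<in> {0..1}" "\<And>g. g \<in> E \<Longrightarrow> q (snd g) \<in> {0..1}"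
    and c: "c \<in> snd ` E" and H: "H \<subseteq> {h \<in> E. snd h = c}"
    and M: "M = 2 * n + 1"
  shows "measure_pmf.prob bits
      {\<omega>. \<bar>real (card {b. b < L \<and> cn_event A \<pi> L n flag H c b \<omega>}) / real L - cn_value A \<epsilon> q n flag H c\<bar> > \<eta>}
    \<le> (real ((card (words E (Inr c) M))\<^sup>2) + 2 * real (card {b. b < L \<and> \<not> tree_like E \<pi> (Inr c) M b}))
       / (\<eta>\<^sup>2 * real L)"
proof -
  define D where "D = (\<lambda>b. lift_end \<pi> (Inr c) b ` words E (Inr c) M)"
  define B where "B = {b. b < L \<and> \<not> tree_like E \<pi> (Inr c) M b}"
  have card_D: "card {b'. b' < L \<and> D b \<inter> D b' \<noteq> {}} \<le> (card (words E (Inr c) M))\<^sup>2" for b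
    unfolding D_def by (rule card_overlap_le[OF finite_E])
  have dep: "depends_on (cn_event A \<pi> L n flag H c b) (D b)" if "b < L" for b
  proof -
    have "extensions E (Inr c) M [] = words E (Inr c) M"
      by (auto simp: extensions_def)
    moreover have "depends_on (cn_event A \<pi> L n flag H c (word_pos \<pi> b [])) (lift_end \<pi> (Inr c) b ` extensions E (Inr c) M [])"
      using H that M by (intro cn_event_depends lift_msg_depends) auto
    ultimately show ?thesis
      by (simp add: D_def)
  qed
  have prob: "measure_pmf.prob bits {\<omega>. cn_event A \<pi> L n flag H c b \<omega>} = cn_value A \<epsilon> q n flag H c"
    if "b < L" "b \<notin> B" for b
  proof -
    have inj: "inj_on (lift_end \<pi> (Inr c) b) (words E (Inr c) M)"
      using that by (simp add: tree_like_def B_def)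
    have "measure_pmf.prob bits {\<omega>. cn_event A \<pi> L n flag H c (word_pos \<pi> b []) \<omega>} = cn_value A \<epsilon> q n flag H c"
      unfolding cn_value_def using H c that M
      by (intro prob_cn_event[OF inj] prob_lift_msg[OF inj] lift_msg_depends) auto
    then show ?thesis
      by simp
  qed
  have prob2: "measure_pmf.prob bits {\<omega>. cn_event A \<pi> L n flag H c b \<omega> \<and> cn_event A \<pi> L n flag H c b' \<omega>}
      = (cn_value A \<epsilon> q n flag H c)\<^sup>2"
    if b: "b < L" "b' < L" "b \<notin> B" "b' \<notin> B" "b' \<notin> {b'. b' < L \<and> D b \<inter> D b' \<noteq> {}}" for b b'
  proof -
    have "D b \<inter> D b' = {}"
      using b by blast
    then show ?thesis
      using prob_Pi_pmf_conj[OF finite_I dep[OF b(1)] dep[OF b(2)]] prob[OF b(1,3)] prob[OF b(2,4)]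
      by (simp add: power2_eq_square)
  qed
  have "cn_value A \<epsilon> q n flag H c \<in> {0..1}"
    using assms(3,4) A_subset c by (intro cn_value_unit) auto
  then show ?thesis
    using assms(1,2) prob prob2 card_D unfolding B_def[symmetric]
    by (intro second_moment_fraction[OF finite_set_bits, where R = "\<lambda>b. {b'. b' < L \<and> D b \<inter> D b' \<noteq> {}}"])
       (auto simp: B_def)
qed

end

text \<open>Conditioning on the lifting: this is how bounds for fixed liftings reach the joint
  measure.\<close>

lemma prob_pair_pmf_of_set:
  assumes "finite S" "S \<noteq> {}" "finite (set_pmf Q)"
  shows "measure_pmf.prob (pair_pmf (pmf_of_set S) Q) {(\<pi>, \<omega>). F \<pi> \<omega>}
       = (\<Sum>\<pi>\<in>S. measure_pmf.prob Q {\<omega>. F \<pi> \<omega>}) / real (card S)"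
proof -
  have "pair_pmf (pmf_of_set S) Q = pmf_of_set S \<bind> (\<lambda>\<pi>. map_pmf (Pair \<pi>) Q)"
    by (simp add: pair_pmf_def map_pmf_def)
  then have "measure_pmf.prob (pair_pmf (pmf_of_set S) Q) {(\<pi>, \<omega>). F \<pi> \<omega>}
      = measure_pmf.expectation (pmf_of_set S \<bind> (\<lambda>\<pi>. map_pmf (Pair \<pi>) Q)) (indicator {(\<pi>, \<omega>). F \<pi> \<omega>})"
    by simp
  also have "\<dots> = (\<Sum>\<pi>\<in>S. measure_pmf.expectation (map_pmf (Pair \<pi>) Q) (indicator {(\<pi>, \<omega>). F \<pi> \<omega>}) /\<^sub>R real (card S))"
    using assms by (intro pmf_expectation_bind_pmf_of_set) auto
  also have "\<dots> = (\<Sum>\<pi>\<in>S. measure_pmf.prob Q {\<omega>. F \<pi> \<omega>} / real (card S))"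
  proof (rule sum.cong[OF refl])
    fix \<pi>
    have "measure_pmf.expectation (map_pmf (Pair \<pi>) Q) (indicator {(\<pi>, \<omega>). F \<pi> \<omega>})
        = measure_pmf.prob (map_pmf (Pair \<pi>) Q) {(\<pi>, \<omega>). F \<pi> \<omega>}"
      by (simp del: integral_map_pmf measure_map_pmf)
    then show "measure_pmf.expectation (map_pmf (Pair \<pi>) Q) (indicator {(\<pi>, \<omega>). F \<pi> \<omega>}) /\<^sub>R real (card S)
        = measure_pmf.prob Q {\<omega>. F \<pi> \<omega>} / real (card S)"
      by (simp add: divide_inverse_commute vimage_def del: integral_map_pmf)
  qed
  finally show ?thesis
    by (simp add: sum_divide_distrib)
qed

section \<open>Limits in probability of the erased fractions\<close>

lemma limit_in_prob_cong:
  assumes "\<And>L \<omega>. \<omega> \<in> set_pmf (M L) \<Longrightarrow> X L \<omega> = Y L \<omega>"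
  shows "limit_in_prob M X p \<longleftrightarrow> limit_in_prob M Y p"
proof -
  have "measure_pmf.prob (M L) {\<omega>. \<bar>X L \<omega> - p\<bar> > \<eta>} = measure_pmf.prob (M L) {\<omega>. \<bar>Y L \<omega> - p\<bar> > \<eta>}" for L \<eta>
    using assms by (intro measure_pmf.finite_measure_eq_AE) (auto simp: AE_measure_pmf_iff)
  then show ?thesis
    by (simp add: limit_in_prob_def)
qed

text \<open>The fractions in the statement are definite descriptions \<open>THE p\<close>, whose
  evaluation requires uniqueness.\<close>

lemma limit_in_prob_unique:
  assumes "limit_in_prob M X p" "limit_in_prob M X p'"
  shows "p = p'"
proof (rule ccontr)
  assume "p \<noteq> p'"
  \<comment> \<open>With a third of the distance no value is within \<open>\<eta>\<close> of both
    limits, so the two deviation events cover the whole space.\<close>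
  define \<eta> where "\<eta> = \<bar>p - p'\<bar> / 3"
  have "\<eta> > 0"
    using \<open>p \<noteq> p'\<close> by (simp add: \<eta>_def)
  define f where "f = (\<lambda>p L. measure_pmf.prob (M L) {\<omega>. \<bar>X L \<omega> - p\<bar> > \<eta>})"
  have "1 \<le> f p L + f p' L" for L
  proof -
    have "\<bar>X L \<omega> - p\<bar> > \<eta> \<or> \<bar>X L \<omega> - p'\<bar> > \<eta>" for \<omega>
    proof -
      have "3 * \<eta> \<le> \<bar>X L \<omega> - p\<bar> + \<bar>X L \<omega> - p'\<bar>"
        by (simp add: \<eta>_def)
      then show ?thesis
        using \<open>\<eta> > 0\<close> by linarith
    qed
    then have "{\<omega>. \<bar>X L \<omega> - p\<bar> > \<eta>} \<union> {\<omega>. \<bar>X L \<omega> - p'\<bar> > \<eta>} = UNIV"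
      by blast
    then have "1 = measure_pmf.prob (M L) ({\<omega>. \<bar>X L \<omega> - p\<bar> > \<eta>} \<union> {\<omega>. \<bar>X L \<omega> - p'\<bar> > \<eta>})"
      by simp
    also have "\<dots> \<le> f p L + f p' L"
      unfolding f_def by (rule measure_Un_le) auto
    finally show ?thesis .
  qed
  moreover have "f p \<longlonglongrightarrow> 0" "f p' \<longlonglongrightarrow> 0"
    using assms \<open>\<eta> > 0\<close> by (auto simp: f_def limit_in_prob_def)
  then have "(\<lambda>L. f p L + f p' L) \<longlonglongrightarrow> 0 + 0"
    by (rule tendsto_add)
  ultimately have "1 \<le> (0 + 0 :: real)"
    by (intro LIMSEQ_le_const) auto
  then show False
    by simp
qed

section \<open>The semi-global sample as a random lifting with independent bits\<close>

lemma mult_width_le: "i \<le> t + 1 \<Longrightarrow> i * width r t \<le> r"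
  using mult_le_mono1[of i "t + 1" "r div (t + 1)"] div_times_less_eq_dividend[of r "t + 1"]
  by (simp add: width_def mult.commute)

lemma fst_sg_edges: "e \<in> sg_edges l r t \<Longrightarrow> fst e \<in> {1..r}"
  using mult_width_le[of _ t r] by (fastforce simp: sg_edges_def)

lemma finite_sg_edges: "finite (sg_edges l r t)"
proof (rule finite_subset)
  have "snd e \<in> Local ` {1..l - t} \<union> RightC ` {1..t} \<union> LeftC ` {1..t}" if "e \<in> sg_edges l r t" for e
    using that by (auto simp: sg_edges_def)
  then show "sg_edges l r t \<subseteq> {1..r} \<times> (Local ` {1..l - t} \<union> RightC ` {1..t} \<union> LeftC ` {1..t})"
    by (intro subsetI) (simp only: mem_Times_iff fst_sg_edges simp_thms)
qed auto

definition sg_bits ::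
  "nat \<Rightarrow> nat \<Rightarrow> real \<Rightarrow> (nat \<Rightarrow> real) \<Rightarrow> (nat \<Rightarrow> real) \<Rightarrow> nat \<Rightarrow> ((nat \<times> nat) + (check \<times> nat) \<Rightarrow> bool) pmf" where
  "sg_bits r t \<epsilon> \<delta>L \<delta>R L =
     Pi_pmf (({1..r} \<times> {..<L}) <+> ((RightC ` {1..t} \<union> LeftC ` {1..t}) \<times> {..<L})) False
       (case_sum (\<lambda>_. bernoulli_pmf \<epsilon>) (\<lambda>(c, b). bernoulli_pmf (ext_prob \<delta>L \<delta>R c)))"

lemma map_sg_sample:
  "map_pmf (\<lambda>(\<pi>, ch, ext). (\<pi>, case_sum ch ext)) (sg_sample l r t \<epsilon> \<delta>L \<delta>R L)
   = pair_pmf (pmf_of_set (edge_perms (sg_edges l r t) L)) (sg_bits r t \<epsilon> \<delta>L \<delta>R L)"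
proof -
  have "Pi_pmf (sg_edges l r t) id (\<lambda>_. pmf_of_set {p. p permutes {..<L}})
      = pmf_of_set (edge_perms (sg_edges l r t) L)"
    unfolding edge_perms_def
    by (rule Pi_pmf_of_set) (auto simp: finite_sg_edges finite_permutations intro: permutes_id)
  moreover have "map_pmf (\<lambda>(\<pi>, ch, ext). (\<pi>, case_sum ch ext)) (pair_pmf P (pair_pmf Q R))
      = pair_pmf P (map_pmf (\<lambda>(f, g). case_sum f g) (pair_pmf Q R))"
    for P :: "(edge \<Rightarrow> nat \<Rightarrow> nat) pmf" and Q :: "(nat \<times> nat \<Rightarrow> bool) pmf" and R :: "(check \<times> nat \<Rightarrow> bool) pmf"
    unfolding pair_map_pmf2 by (rule map_pmf_cong) auto
  ultimately show ?thesis
    unfolding sg_sample_def sg_bits_def by (subst map_pair_Pi_pmf[symmetric]) auto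
qed

lemma set_sg_sample:
  assumes "(\<pi>, ch, ext) \<in> set_pmf (sg_sample l r t \<epsilon> \<delta>L \<delta>R L)"
  shows "lift_perms \<pi> L"
proof -
  have "(\<pi>, case_sum ch ext) \<in> (\<lambda>(\<pi>, ch, ext). (\<pi>, case_sum ch ext)) ` set_pmf (sg_sample l r t \<epsilon> \<delta>L \<delta>R L)"
    using assms by force
  then have "\<pi> \<in> set_pmf (pmf_of_set (edge_perms (sg_edges l r t) L))"
    unfolding set_map_pmf[symmetric] map_sg_sample by simp
  then show ?thesis
    using edge_perms_nonempty finite_edge_perms[OF finite_sg_edges] by (auto intro: edge_perms_lift_perms)
qed

lemma prob_Pi_pmf_bit:
  assumes "finite I"
  shows "measure_pmf.prob (Pi_pmf I False p) {\<omega>. \<omega> i} = (if i \<in> I then pmf (p i) True else 0)"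
proof -
  have "measure_pmf.prob (Pi_pmf I False p) {\<omega>. \<omega> i}
      = measure_pmf.prob (map_pmf (\<lambda>\<omega>. \<omega> i) (Pi_pmf I False p)) {True}"
    by (simp add: vimage_def)
  also have "\<dots> = (if i \<in> I then pmf (p i) True else 0)"
    by (simp add: Pi_pmf_component[OF assms] measure_pmf_single del: measure_map_pmf)
  finally show ?thesis .
qed

lemma sg_lift_bits:
  assumes "lift_perms \<pi> L" "A \<subseteq> sg_edges l r t" "\<epsilon> \<in> {0..1}"
    and "\<forall>i\<in>{1..t}. \<delta>L i \<in> {0..1}" "\<forall>i\<in>{1..t}. \<delta>R i \<in> {0..1}"
  shows "lift_bits \<pi> L (sg_edges l r t) A
    (({1..r} \<times> {..<L}) <+> ((RightC ` {1..t} \<union> LeftC ` {1..t}) \<times> {..<L}))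
    (case_sum (\<lambda>_. bernoulli_pmf \<epsilon>) (\<lambda>(c, b). bernoulli_pmf (ext_prob \<delta>L \<delta>R c)))
    \<epsilon> (ext_prob \<delta>L \<delta>R)"
proof -
  interpret lift_perms \<pi> L
    by fact
  show ?thesis
  proof
    show "finite (sg_edges l r t)"
      by (rule finite_sg_edges)
    fix e a assume e: "e \<in> sg_edges l r t" and "a < L"
    then have "fst e \<in> {1..r}"
      using fst_sg_edges by blast
    with \<open>a < L\<close> show "measure_pmf.prob (Pi_pmf (({1..r} \<times> {..<L}) <+> ((RightC ` {1..t} \<union> LeftC ` {1..t}) \<times> {..<L})) False
      (case_sum (\<lambda>_. bernoulli_pmf \<epsilon>) (\<lambda>(c, b). bernoulli_pmf (ext_prob \<delta>L \<delta>R c)))) {\<omega>. \<omega> (Inl (fst e, a))} = \<epsilon>"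
      using assms(3) by (subst prob_Pi_pmf_bit) auto
    \<comment> \<open>A local check has no coordinate in the product; its bit is the default
      \<open>False\<close>, which matches the value \<open>0\<close> of
      \<open>ext_prob\<close>.\<close>
    have "(\<exists>m. snd e = Local m) \<or> (\<exists>i\<in>{1..t}. snd e = RightC i) \<or> (\<exists>i\<in>{1..t}. snd e = LeftC i)"
      using e by (auto simp: sg_edges_def)
    with \<open>a < L\<close> show "measure_pmf.prob (Pi_pmf (({1..r} \<times> {..<L}) <+> ((RightC ` {1..t} \<union> LeftC ` {1..t}) \<times> {..<L})) False
      (case_sum (\<lambda>_. bernoulli_pmf \<epsilon>) (\<lambda>(c, b). bernoulli_pmf (ext_prob \<delta>L \<delta>R c)))) {\<omega>. \<omega> (Inr (snd e, a))}
      = ext_prob \<delta>L \<delta>R (snd e)"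
      using assms(4,5) by (subst prob_Pi_pmf_bit) auto
  qed (use assms in auto)
qed

definition cn_event_fraction ::
  "edge set \<Rightarrow> nat \<Rightarrow> bool \<Rightarrow> edge set \<Rightarrow> check \<Rightarrow> nat \<Rightarrow> sample \<Rightarrow> real" where
  "cn_event_fraction A n flag H c L = (\<lambda>(\<pi>, ch, ext).
     real (card {b. b < L \<and> cn_event A \<pi> L n flag H c b (case_sum ch ext)}) / real L)"

lemma ext_prob_unit:
  assumes "\<forall>i\<in>{1..t}. \<delta>L i \<in> {0..1}" "\<forall>i\<in>{1..t}. \<delta>R i \<in> {0..1}" "g \<in> sg_edges l r t"
  shows "ext_prob \<delta>L \<delta>R (snd g) \<in> {0..1}"
  using assms by (auto simp: sg_edges_def)

text \<open>Averaging the bound for fixed liftings leaves the mean number of bad copies, at most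
  \<open>L * C / (L - 2 * M)\<close>. After division by \<open>\<eta>\<^sup>2 * L\<close> this
  vanishes, as does the overlap term, since \<open>K\<close> does not depend on
  \<open>L\<close>.\<close>

lemma cn_event_fraction_limit:
  assumes "A \<subseteq> sg_edges l r t" and \<epsilon>: "\<epsilon> \<in> {0..1}"
    and \<delta>: "\<forall>i\<in>{1..t}. \<delta>L i \<in> {0..1}" "\<forall>i\<in>{1..t}. \<delta>R i \<in> {0..1}"
    and c: "c \<in> snd ` sg_edges l r t" and H: "H \<subseteq> {h \<in> sg_edges l r t. snd h = c}"
  shows "limit_in_prob (sg_sample l r t \<epsilon> \<delta>L \<delta>R) (cn_event_fraction A n flag H c)
           (cn_value A \<epsilon> (ext_prob \<delta>L \<delta>R) n flag H c)"
  unfolding limit_in_prob_def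
proof (intro allI impI)
  fix \<eta> :: real assume "\<eta> > 0"
  define E where "E = sg_edges l r t"
  define p where "p = cn_value A \<epsilon> (ext_prob \<delta>L \<delta>R) n flag H c"
  define M where "M = 2 * n + 1"
  define K where "K = (card (words E (Inr c) M))\<^sup>2"
  define C where "C = card (words E (Inr c) (2 * M)) * (2 * M)"
  define f where "f = (\<lambda>L. measure_pmf.prob (sg_sample l r t \<epsilon> \<delta>L \<delta>R L)
    {\<omega>. \<bar>cn_event_fraction A n flag H c L \<omega> - p\<bar> > \<eta>})"
  have finE: "finite E"
    by (simp add: E_def finite_sg_edges)
  have bound: "f L \<le> (real K / \<eta>\<^sup>2) / real L + (2 * real C / \<eta>\<^sup>2) / real (L - 2 * M)" if L: "L > 2 * M" for L
  proof -
    define \<Omega> where "\<Omega> = edge_perms E L"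
    define B where "B = (\<lambda>\<pi>. {b. b < L \<and> \<not> tree_like E \<pi> (Inr c) M b})"
    define F where "F = (\<lambda>\<pi> \<omega>. \<bar>real (card {b. b < L \<and> cn_event A \<pi> L n flag H c b \<omega>}) / real L - p\<bar> > \<eta>)"
    define Q where "Q = sg_bits r t \<epsilon> \<delta>L \<delta>R L"
    have fin\<Omega>: "finite \<Omega>" and "\<Omega> \<noteq> {}"
      using finite_edge_perms[OF finE] edge_perms_nonempty by (auto simp: \<Omega>_def)
    then have card_pos: "real (card \<Omega>) > 0"
      by (simp add: card_gt_0_iff)
    have Qfin: "finite (set_pmf Q)"
      unfolding Q_def sg_bits_def by (subst set_Pi_pmf) (auto intro!: finite_PiE_dflt)
    have "f L = measure_pmf.prob (map_pmf (\<lambda>(\<pi>, ch, ext). (\<pi>, case_sum ch ext)) (sg_sample l r t \<epsilon> \<delta>L \<delta>R L)) {(\<pi>, \<omega>). F \<pi> \<omega>}"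
      unfolding f_def F_def cn_event_fraction_def by (simp add: vimage_def split_def)
    also have "\<dots> = (\<Sum>\<pi>\<in>\<Omega>. measure_pmf.prob Q {\<omega>. F \<pi> \<omega>}) / real (card \<Omega>)"
      unfolding map_sg_sample Q_def[symmetric] E_def[symmetric] \<Omega>_def[symmetric]
      by (rule prob_pair_pmf_of_set[OF fin\<Omega> \<open>\<Omega> \<noteq> {}\<close> Qfin])
    also have "\<dots> \<le> (\<Sum>\<pi>\<in>\<Omega>. (real K + 2 * real (card (B \<pi>))) / (\<eta>\<^sup>2 * real L)) / real (card \<Omega>)"
    proof (intro divide_right_mono sum_mono)
      fix \<pi> assume "\<pi> \<in> \<Omega>"
      then have "lift_perms \<pi> L"
        unfolding \<Omega>_def by (rule edge_perms_lift_perms)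
      from sg_lift_bits[OF this assms(1) \<epsilon> \<delta>] show "measure_pmf.prob Q {\<omega>. F \<pi> \<omega>} \<le> (real K + 2 * real (card (B \<pi>))) / (\<eta>\<^sup>2 * real L)"
        unfolding Q_def sg_bits_def F_def p_def K_def B_def E_def
        by (rule lift_bits.prob_cn_fraction_deviates)
           (use \<open>\<eta> > 0\<close> L \<epsilon> ext_prob_unit[OF \<delta>] c H M_def in auto)
    qed auto
    also have "\<dots> = (real (card \<Omega>) * real K + 2 * (\<Sum>\<pi>\<in>\<Omega>. real (card (B \<pi>)))) / (\<eta>\<^sup>2 * real L) / real (card \<Omega>)"
      by (simp add: sum_divide_distrib[symmetric] sum.distrib sum_distrib_left)
    \<comment> \<open>Double counting: bad copies of each lifting against bad liftings of each copy;
      the latter are what redirection bounds.\<close>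
    also have "(\<Sum>\<pi>\<in>\<Omega>. real (card (B \<pi>))) = (\<Sum>b<L. real (card {\<pi>\<in>\<Omega>. \<not> tree_like E \<pi> (Inr c) M b}))"
    proof -
      have "(\<Sum>\<pi>\<in>\<Omega>. card {b\<in>{..<L}. \<not> tree_like E \<pi> (Inr c) M b}) = (\<Sum>b<L. card {\<pi>\<in>\<Omega>. \<not> tree_like E \<pi> (Inr c) M b})"
        by (rule sum_multicount_gen) (use fin\<Omega> in auto)
      then show ?thesis
        unfolding B_def by (simp only: of_nat_sum[symmetric] lessThan_iff)
    qed
    also have "(real (card \<Omega>) * real K + 2 * (\<Sum>b<L. real (card {\<pi>\<in>\<Omega>. \<not> tree_like E \<pi> (Inr c) M b}))) / (\<eta>\<^sup>2 * real L) / real (card \<Omega>)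
        \<le> (real (card \<Omega>) * real K + 2 * (\<Sum>b<L. real C / real (L - 2 * M) * real (card \<Omega>))) / (\<eta>\<^sup>2 * real L) / real (card \<Omega>)"
      using card_not_tree_like_le[OF finE _ L, of _ "Inr c"]
      unfolding C_def \<Omega>_def by (intro divide_right_mono add_left_mono mult_left_mono sum_mono) auto
    also have "\<dots> = (real K / \<eta>\<^sup>2) / real L + (2 * real C / \<eta>\<^sup>2) / real (L - 2 * M)"
      using card_pos L \<open>\<eta> > 0\<close> by (simp add: field_simps)
    finally show ?thesis .
  qed
  have "(\<lambda>L. (2 * real C / \<eta>\<^sup>2) / real (L - 2 * M)) \<longlonglongrightarrow> 0"
    by (rule LIMSEQ_offset[where k = "2 * M"]) (simp only: add_diff_cancel_right' lim_const_over_n)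
  then have "(\<lambda>L. (real K / \<eta>\<^sup>2) / real L + (2 * real C / \<eta>\<^sup>2) / real (L - 2 * M)) \<longlonglongrightarrow> 0 + 0"
    by (intro tendsto_add lim_const_over_n)
  then have lim: "(\<lambda>L. (real K / \<eta>\<^sup>2) / real L + (2 * real C / \<eta>\<^sup>2) / real (L - 2 * M)) \<longlonglongrightarrow> 0"
    unfolding add_0 .
  have "\<forall>\<^sub>F L in sequentially. f L \<le> (real K / \<eta>\<^sup>2) / real L + (2 * real C / \<eta>\<^sup>2) / real (L - 2 * M)"
    using eventually_gt_at_top[of "2 * M"] by (rule eventually_mono) (rule bound)
  then have "f \<longlonglongrightarrow> 0"
    by (rule tendsto_sandwich[OF _ _ tendsto_const lim, rotated]) (simp add: f_def)
  then show "(\<lambda>L. measure_pmf.prob (sg_sample l r t \<epsilon> \<delta>L \<delta>R L)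
      {\<omega>. \<eta> < \<bar>cn_event_fraction A n flag H c L \<omega> - cn_value A \<epsilon> (ext_prob \<delta>L \<delta>R) n flag H c\<bar>}) \<longlonglongrightarrow> 0"
    by (simp add: f_def p_def)
qed

text \<open>The matching of \<open>e\<close> maps the copies of \<open>e\<close>, numbered by their
  variable ends, bijectively to the copies of the check, so both counts agree.\<close>

lemma vn_fraction_eq:
  assumes "lift_perms \<pi> L"
  shows "vn_fraction A n e L (\<pi>, ch, ext) = cn_event_fraction A n False {e} (snd e) L (\<pi>, ch, ext)"
proof -
  interpret lift_perms \<pi> L by fact
  have "bij_betw (\<pi> e) {a. a < L \<and> lift_msg A \<pi> L n e a (case_sum ch ext)}
          {b. b < L \<and> lift_msg A \<pi> L n e (inv (\<pi> e) b) (case_sum ch ext)}"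
    by (rule bij_betwI[where g = "inv (\<pi> e)"]) (auto simp: perm_less inv_perm_less)
  from bij_betw_same_card[OF this] show ?thesis
    by (simp add: cn_event_fraction_def cn_event_def lift_msg_def)
qed

lemma cn_fraction_eq:
  assumes "lift_perms \<pi> L"
  shows "cn_fraction A n e L (\<pi>, ch, ext) = cn_event_fraction A (n - 1) True (other_at_cn A e) (snd e) L (\<pi>, ch, ext)"
proof -
  interpret lift_perms \<pi> L by fact
  have "bp_cn (A \<times> {..<L}) vn_end (cn_end \<pi>) ch ext n (e, a) \<longleftrightarrow>
      cn_event A \<pi> L (n - 1) True (other_at_cn A e) (snd e) (\<pi> e a) (case_sum ch ext)" if "a < L" for a
    using that by (simp add: bp_cn_def cn_out_lift cn_event_def lift_msg_def)
  then have "{a. a < L \<and> bp_cn (A \<times> {..<L}) vn_end (cn_end \<pi>) ch ext n (e, a)}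
      = {a. a < L \<and> cn_event A \<pi> L (n - 1) True (other_at_cn A e) (snd e) (\<pi> e a) (case_sum ch ext)}"
    by blast
  moreover have "bij_betw (\<pi> e) {a. a < L \<and> cn_event A \<pi> L (n - 1) True (other_at_cn A e) (snd e) (\<pi> e a) (case_sum ch ext)}
      {b. b < L \<and> cn_event A \<pi> L (n - 1) True (other_at_cn A e) (snd e) b (case_sum ch ext)}"
    by (rule bij_betwI[where g = "inv (\<pi> e)"]) (auto simp: perm_less inv_perm_less)
  ultimately show ?thesis
    using bij_betw_same_card by (fastforce simp: cn_event_fraction_def)
qed

text \<open>Each edge \<open>h\<close> at the left check has exactly one lift through copy
  \<open>b\<close>, starting at copy \<open>inv (\<pi> h) b\<close> of its variable node.\<close>

lemma out_fraction_eq: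
  assumes "lift_perms \<pi> L"
  shows "out_fraction E A n i L (\<pi>, ch, ext)
       = cn_event_fraction A n False {h \<in> E. snd h = LeftC i} (LeftC i) L (\<pi>, ch, ext)"
proof -
  interpret lift_perms \<pi> L by fact
  have "(\<exists>g\<in>E \<times> {..<L}. cn_end \<pi> g = (LeftC i, b) \<and> bp_vn (A \<times> {..<L}) vn_end (cn_end \<pi>) ch ext n g)
      \<longleftrightarrow> cn_event A \<pi> L n False {h \<in> E. snd h = LeftC i} (LeftC i) b (case_sum ch ext)" (is "?L \<longleftrightarrow> ?R")
    if "b < L" for b
  proof
    assume ?L
    then obtain h a where h: "h \<in> E" "snd h = LeftC i" "\<pi> h a = b" "bp_vn (A \<times> {..<L}) vn_end (cn_end \<pi>) ch ext n (h, a)"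
      by (auto simp: cn_end_eq simp del: cn_end.simps split_paired_Ex split_paired_All)
    have "a = inv (\<pi> h) b"
      using h(3) by auto
    then show ?R
      using h unfolding cn_event_def lift_msg_def by (intro disjI2 bexI[of _ h]) auto
  next
    assume ?R
    then obtain h where h: "h \<in> E" "snd h = LeftC i" "bp_vn (A \<times> {..<L}) vn_end (cn_end \<pi>) ch ext n (h, inv (\<pi> h) b)"
      by (auto simp: cn_event_def lift_msg_def)
    then show ?L
      using \<open>b < L\<close> inv_perm_less
      by (intro bexI[of _ "(h, inv (\<pi> h) b)"]) (auto simp: cn_end_eq simp del: cn_end.simps)
  qed
  then have "{b. b < L \<and> (\<exists>g\<in>E \<times> {..<L}. cn_end \<pi> g = (LeftC i, b) \<and> bp_vn (A \<times> {..<L}) vn_end (cn_end \<pi>) ch ext n g)}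
      = {b. b < L \<and> cn_event A \<pi> L n False {h \<in> E. snd h = LeftC i} (LeftC i) b (case_sum ch ext)}"
    by blast
  then show ?thesis
    by (simp add: cn_event_fraction_def)
qed

context
  fixes l r t :: nat and \<epsilon> :: real and \<delta>L \<delta>R :: "nat \<Rightarrow> real" and A :: "edge set"
  assumes A: "A \<subseteq> sg_edges l r t" and \<epsilon>: "\<epsilon> \<in> {0..1}"
    and \<delta>: "\<forall>i\<in>{1..t}. \<delta>L i \<in> {0..1}" "\<forall>i\<in>{1..t}. \<delta>R i \<in> {0..1}"
begin

lemma vn_fraction_limit:
  assumes "e \<in> sg_edges l r t"
  shows "limit_in_prob (sg_sample l r t \<epsilon> \<delta>L \<delta>R) (vn_fraction A n e) (de_vn A \<epsilon> (ext_prob \<delta>L \<delta>R) n e)"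
proof -
  have "limit_in_prob (sg_sample l r t \<epsilon> \<delta>L \<delta>R) (cn_event_fraction A n False {e} (snd e))
      (cn_value A \<epsilon> (ext_prob \<delta>L \<delta>R) n False {e} (snd e))"
    using assms by (intro cn_event_fraction_limit A \<epsilon> \<delta>) auto
  moreover have "vn_fraction A n e L \<omega> = cn_event_fraction A n False {e} (snd e) L \<omega>"
    if "\<omega> \<in> set_pmf (sg_sample l r t \<epsilon> \<delta>L \<delta>R L)" for L \<omega>
    using that vn_fraction_eq set_sg_sample by (cases \<omega>) blast
  ultimately show ?thesis
    using limit_in_prob_cong[of "sg_sample l r t \<epsilon> \<delta>L \<delta>R" "vn_fraction A n e"] by (simp add: cn_value_def)
qed

lemma cn_fraction_limit:
  assumes "e \<in> sg_edges l r t"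
  shows "limit_in_prob (sg_sample l r t \<epsilon> \<delta>L \<delta>R) (cn_fraction A n e)
    (de_cn A (ext_prob \<delta>L \<delta>R) (de_vn A \<epsilon> (ext_prob \<delta>L \<delta>R) (n - 1)) e)"
proof -
  have "limit_in_prob (sg_sample l r t \<epsilon> \<delta>L \<delta>R) (cn_event_fraction A (n - 1) True (other_at_cn A e) (snd e))
      (cn_value A \<epsilon> (ext_prob \<delta>L \<delta>R) (n - 1) True (other_at_cn A e) (snd e))"
    using assms A by (intro cn_event_fraction_limit A \<epsilon> \<delta>) (auto simp: other_at_cn_def)
  moreover have "cn_fraction A n e L \<omega> = cn_event_fraction A (n - 1) True (other_at_cn A e) (snd e) L \<omega>"
    if "\<omega> \<in> set_pmf (sg_sample l r t \<epsilon> \<delta>L \<delta>R L)" for L \<omega>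
    using that cn_fraction_eq set_sg_sample by (cases \<omega>) blast
  ultimately show ?thesis
    using limit_in_prob_cong[of "sg_sample l r t \<epsilon> \<delta>L \<delta>R" "cn_fraction A n e"] by (simp add: cn_value_def de_cn_def)
qed

lemma out_fraction_limit:
  assumes "(v, LeftC i) \<in> sg_edges l r t"
  shows "limit_in_prob (sg_sample l r t \<epsilon> \<delta>L \<delta>R) (out_fraction (sg_edges l r t) A n i)
    (1 - (\<Prod>h\<in>{h \<in> sg_edges l r t. snd h = LeftC i}. 1 - de_vn A \<epsilon> (ext_prob \<delta>L \<delta>R) n h))"
proof -
  define H where "H = {h \<in> sg_edges l r t. snd h = LeftC i}"
  have "limit_in_prob (sg_sample l r t \<epsilon> \<delta>L \<delta>R) (cn_event_fraction A n False H (LeftC i))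
      (cn_value A \<epsilon> (ext_prob \<delta>L \<delta>R) n False H (LeftC i))"
    using assms by (intro cn_event_fraction_limit A \<epsilon> \<delta>) (force simp: H_def)+
  moreover have "out_fraction (sg_edges l r t) A n i L \<omega> = cn_event_fraction A n False H (LeftC i) L \<omega>"
    if "\<omega> \<in> set_pmf (sg_sample l r t \<epsilon> \<delta>L \<delta>R L)" for L \<omega>
    using that out_fraction_eq set_sg_sample unfolding H_def by (cases \<omega>) blast
  ultimately show ?thesis
    using limit_in_prob_cong[of "sg_sample l r t \<epsilon> \<delta>L \<delta>R" "out_fraction (sg_edges l r t) A n i"]
    by (simp add: cn_value_def H_def)
qed

end

section \<open>Edge labels\<close>

text \<open>A variable node of label \<open>k\<close> meets \<open>k - 1\<close> right coupling
  checks, so the blocks of labels \<open>s_idx t k + i\<close> for successive \<open>k\<close>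
  follow one another without gap. Monotonicity, injectivity and surjectivity rest on this recursion
  instead of the halved product.\<close>

lemma s_idx_Suc: "1 \<le> k \<Longrightarrow> s_idx t (Suc k) = s_idx t k + (k - 1)"
proof -
  assume "1 \<le> k"
  then obtain m where k: "k = Suc m"
    by (cases k) auto
  have "Suc m * m = m * (m - 1) + 2 * m"
    by (cases m) auto
  then have "Suc m * m div 2 = m * (m - 1) div 2 + m"
    by simp
  then show ?thesis
    by (simp add: s_idx_def k numeral_2_eq_2)
qed

text \<open>Block \<open>k\<close> of the left labels runs from \<open>v_idx t k + k\<close> to
  \<open>v_idx t k + t\<close>. Because it starts at offset \<open>k\<close>, adjacent blocks touch
  although \<open>v_idx\<close> grows by \<open>t - k\<close> only; the quantity that orders the
  blocks is \<open>v_idx t k + k\<close>.\<close>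

lemma v_idx_Suc: "1 \<le> k \<Longrightarrow> k \<le> t \<Longrightarrow> v_idx t (Suc k) = v_idx t k + (t - k)"
proof -
  assume "1 \<le> k" "k \<le> t"
  then obtain m d where k: "k = Suc m" and t: "t = Suc m + d"
    by (cases k) (auto simp: le_iff_add)
  have "Suc m * (2 * t - Suc (Suc m)) = m * (2 * t - Suc m) + 2 * d"
    by (cases m) (auto simp: t algebra_simps)
  then have "Suc m * (2 * t - Suc (Suc m)) div 2 = m * (2 * t - Suc m) div 2 + d"
    by simp
  then show ?thesis
    by (simp add: v_idx_def k t)
qed

lemma s_idx_1: "s_idx t 1 = t + 1"
  by (simp add: s_idx_def)

text \<open>No gap and no overlap between right and left labels: the left ones begin right after
  \<open>v_idx t 1\<close>.\<close>

lemma s_idx_last: "1 \<le> t \<Longrightarrow> s_idx t (t + 1) + t = v_idx t 1"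
  by (simp add: s_idx_def v_idx_def mult.commute)

text \<open>Block \<open>t + 1\<close> of the left labels is empty, so this value is the largest
  label of all.\<close>

lemma v_idx_last: "1 \<le> t \<Longrightarrow> v_idx t (t + 1) + t = (t + 1)\<^sup>2"
proof -
  assume "1 \<le> t"
  \<comment> \<open>The halved product occurs twice in the sum, and the two halves must add up
    exactly.\<close>
  have "even (t * (t - 1))"
    by (cases t) auto
  then have "2 * (t * (t - 1) div 2) = t * (t - 1)"
    by simp
  then have "v_idx t (t + 1) = 2 * t + 1 + t * (t - 1)"
    by (simp add: v_idx_def)
  also have "t * (t - 1) = t * t - t"
    by (simp add: diff_mult_distrib2)
  finally show ?thesis
    using \<open>1 \<le> t\<close> by (simp add: power2_eq_square)
qed

lemma s_idx_mono: "1 \<le> k \<Longrightarrow> k \<le> k' \<Longrightarrow> s_idx t k \<le> s_idx t k'"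
  by (rotate_tac, induction k' rule: dec_induct) (auto simp: s_idx_Suc)

lemma v_idx_add_mono: "1 \<le> k \<Longrightarrow> k \<le> k' \<Longrightarrow> k' \<le> t + 1 \<Longrightarrow> v_idx t k + k \<le> v_idx t k' + k'"
  by (rotate_tac, induction k' rule: dec_induct) (auto simp: v_idx_Suc)

lemma s_idx_step: "1 \<le> k \<Longrightarrow> k < k' \<Longrightarrow> i \<le> k - 1 \<Longrightarrow> s_idx t k + i \<le> s_idx t k'"
  using s_idx_mono[of "Suc k" k' t] s_idx_Suc[of k t] by simp

lemma v_idx_step: "1 \<le> k \<Longrightarrow> k < k' \<Longrightarrow> k' \<le> t + 1 \<Longrightarrow> i \<le> t \<Longrightarrow> v_idx t k + i < v_idx t k' + k'"
  using v_idx_add_mono[of "Suc k" k' t] v_idx_Suc[of k t] by simp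

lemma s_idx_inj:
  assumes "k \<in> {1..t + 1}" "i \<in> {1..k - 1}" "k' \<in> {1..t + 1}" "i' \<in> {1..k' - 1}"
    and "s_idx t k + i = s_idx t k' + i'"
  shows "k = k' \<and> i = i'"
proof -
  have "\<not> k < k'" "\<not> k' < k"
    using s_idx_step[of k k' i t] s_idx_step[of k' k i' t] assms by auto
  then show ?thesis
    using assms by auto
qed

lemma v_idx_inj:
  assumes "k \<in> {1..t + 1}" "i \<in> {k..t}" "k' \<in> {1..t + 1}" "i' \<in> {k'..t}"
    and "v_idx t k + i = v_idx t k' + i'"
  shows "k = k' \<and> i = i'"
proof -
  have "\<not> k < k'" "\<not> k' < k"
    using v_idx_step[of k k' t i] v_idx_step[of k' k t i'] assms by auto
  then show ?thesis
    using assms by auto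
qed

lemma s_idx_bounds:
  assumes "1 \<le> t" "k \<in> {1..t + 1}" "i \<in> {1..k - 1}"
  shows "t + 1 < s_idx t k + i \<and> s_idx t k + i \<le> v_idx t 1"
  using s_idx_mono[of 1 k t] s_idx_mono[of k "t + 1" t] assms s_idx_1[of t] s_idx_last[of t] by auto

lemma v_idx_bound:
  assumes "k \<in> {1..t + 1}" "i \<in> {k..t}"
  shows "v_idx t 1 < v_idx t k + i"
  using v_idx_add_mono[of 1 k t] assms by auto

lemma s_idx_surj:
  assumes "t + 1 < j" "j \<le> s_idx t (Suc K)"
  shows "\<exists>k\<in>{1..K}. \<exists>i\<in>{1..k - 1}. j = s_idx t k + i"
  using assms(2)
proof (induction K)
  case 0
  then show ?case
    using assms(1) s_idx_1[of t] by simp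
next
  case (Suc K)
  show ?case
  proof (cases "j \<le> s_idx t (Suc K)")
    case True
    then show ?thesis
      using Suc.IH by fastforce
  next
    case False
    then show ?thesis
      using Suc.prems s_idx_Suc[of "Suc K" t]
      by (intro bexI[of _ "Suc K"] bexI[of _ "j - s_idx t (Suc K)"]) auto
  qed
qed

lemma v_idx_surj:
  assumes "v_idx t 1 < j" "j \<le> v_idx t (Suc K) + K" "K \<le> t"
  shows "\<exists>k\<in>{1..K}. \<exists>i\<in>{k..t}. j = v_idx t k + i"
  using assms(2,3)
proof (induction K)
  case 0
  then show ?case
    using assms(1) by simp
next
  case (Suc K)
  show ?case
  proof (cases "j \<le> v_idx t (Suc K) + K")
    case True
    then show ?thesis
      using Suc.IH Suc.prems by fastforce
  next
    case False
    then show ?thesis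
      using Suc.prems v_idx_Suc[of "Suc K" t]
      by (intro bexI[of _ "Suc K"] bexI[of _ "j - v_idx t (Suc K)"]) auto
  qed
qed

section \<open>Types: a variable label together with a check\<close>

definition label_checks :: "nat \<Rightarrow> nat \<Rightarrow> nat \<Rightarrow> check set" where
  "label_checks l t k = Local ` {1..l - t} \<union> RightC ` {1..k - 1} \<union> LeftC ` {k..t}"

fun check_labels :: "nat \<Rightarrow> check \<Rightarrow> nat set" where
  "check_labels t (Local m) = {1..t + 1}"
| "check_labels t (RightC i) = {i + 1..t + 1}"
| "check_labels t (LeftC i) = {1..i}"

definition label_size :: "nat \<Rightarrow> nat \<Rightarrow> nat \<Rightarrow> nat" where
  "label_size r t k = (if k \<le> t then width r t else r - t * width r t)"

fun label_index :: "nat \<Rightarrow> nat \<Rightarrow> check \<Rightarrow> nat" where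
  "label_index t k (Local m) = k"
| "label_index t k (RightC i) = s_idx t k + i"
| "label_index t k (LeftC i) = v_idx t k + i"

text \<open>The recursion on types lies between the one on edges and the one on labels: variable
  nodes are merged by label, while local checks stay apart until \<open>type_vn_Local\<close>. The
  exponent \<open>label_size r t k - 1\<close> leaves out the recipient.\<close>

definition type_cn :: "nat \<Rightarrow> nat \<Rightarrow> (check \<Rightarrow> real) \<Rightarrow> (nat \<Rightarrow> check \<Rightarrow> real) \<Rightarrow> nat \<Rightarrow> check \<Rightarrow> real" where
  "type_cn r t q x k c = 1 - (1 - q c) *
     ((1 - x k c) ^ (label_size r t k - 1) * (\<Prod>j\<in>check_labels t c - {k}. (1 - x j c) ^ label_size r t j))"

primrec type_vn :: "nat \<Rightarrow> nat \<Rightarrow> nat \<Rightarrow> real \<Rightarrow> (check \<Rightarrow> real) \<Rightarrow> nat \<Rightarrow> nat \<Rightarrow> check \<Rightarrow> real" where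
  "type_vn l r t \<epsilon> q 0 = (\<lambda>k c. 1)"
| "type_vn l r t \<epsilon> q (Suc n) =
     (\<lambda>k c. \<epsilon> * (\<Prod>c'\<in>label_checks l t k - {c}. type_cn r t q (type_vn l r t \<epsilon> q n) k c'))"

lemma label_checks_iff [simp]:
  "Local m \<in> label_checks l t k \<longleftrightarrow> m \<in> {1..l - t}"
  "RightC i \<in> label_checks l t k \<longleftrightarrow> i \<in> {1..k - 1}"
  "LeftC i \<in> label_checks l t k \<longleftrightarrow> i \<in> {k..t}"
  by (auto simp: label_checks_def)

lemma edge_label_eq: "edge_label l r t e = label_index t (vn_label l r t (fst e)) (snd e)"
  by (cases e; cases "snd e") auto

section \<open>Label classes and reduction of the edge recursion to types\<close>

locale semi_global =
  fixes l r t :: nat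
  assumes l_ge_3: "3 \<le> l" and l_less_r: "l < r" and t_ge_1: "1 \<le> t" and t_le: "t \<le> l - 2"
begin

abbreviation "w \<equiv> width r t"
abbreviation "lab \<equiv> vn_label l r t"
abbreviation "E \<equiv> sg_edges l r t"

lemma w_pos: "0 < w"
  using l_ge_3 l_less_r t_le by (simp add: width_def div_greater_zero_iff)

lemma w_bound: "t * w + w \<le> r"
  using mult_width_le[of "t + 1" t r] by simp

text \<open>For \<open>i\<close> between \<open>1\<close> and \<open>t\<close>, the node
  \<open>v\<close> meets \<open>RightC i\<close> when \<open>i * w < v\<close>, that is
  \<open>i \<le> (v - 1) div w\<close>; such indices form an initial segment.\<close>

lemma lab_eq:
  assumes "v \<in> {1..r}"
  shows "lab v = min t ((v - 1) div w) + 1"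
proof -
  have "{i. (v, RightC i) \<in> E} = {i \<in> {1..t}. i * w < v}"
    using assms by (auto simp: sg_edges_def)
  also have "\<dots> = {1..min t ((v - 1) div w)}"
    using assms w_pos by (auto simp: less_eq_div_iff_mult_less_eq)
  finally show ?thesis
    by (simp add: vn_label_def)
qed

lemma less_lab_iff: "v \<in> {1..r} \<Longrightarrow> i \<in> {1..t} \<Longrightarrow> i < lab v \<longleftrightarrow> i * w < v"
  using w_pos by (auto simp: lab_eq less_Suc_eq_le less_eq_div_iff_mult_less_eq)

lemma lab_range: "v \<in> {1..r} \<Longrightarrow> lab v \<in> {1..t + 1}"
  by (simp add: lab_eq)

text \<open>The label steps up just past the multiples of \<open>w\<close>, up to
  \<open>t * w\<close>. Each class is thus an interval of length \<open>w\<close>, except that the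
  last one takes all remaining nodes.\<close>

lemma lab_class:
  assumes "k \<in> {1..t + 1}"
  shows "{v \<in> {1..r}. lab v = k} = {(k - 1) * w + 1..(k - 1) * w + label_size r t k}"
proof -
  have le: "(k - 1) * w + label_size r t k \<le> r"
  proof (cases "k \<le> t")
    case True
    then have "(k - 1) * w + label_size r t k = k * w"
      using assms by (cases k) (auto simp: label_size_def)
    then show ?thesis
      using mult_width_le[of k t r] assms by simp
  next
    case False
    then have "k = t + 1"
      using assms by auto
    then show ?thesis
      using w_bound by (simp add: label_size_def)
  qed
  have "lab v = k \<longleftrightarrow> (k - 1) * w + 1 \<le> v \<and> v \<le> (k - 1) * w + label_size r t k" if v: "v \<in> {1..r}" for v
  proof -
    have "lab v = k \<longleftrightarrow> k - 1 < lab v \<and> \<not> k < lab v"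
      using assms by auto
    also have "k - 1 < lab v \<longleftrightarrow> (k - 1) * w < v"
    \<comment> \<open>There is no coupling check of index \<open>0\<close>, so
      \<open>less_lab_iff\<close> does not reach the case \<open>k = 1\<close>.\<close>
    proof (cases "k = 1")
      case True
      then show ?thesis
        using lab_range[OF v] v by simp
    next
      case False
      then have "k - 1 \<in> {1..t}"
        using assms by auto
      then show ?thesis
        by (rule less_lab_iff[OF v])
    qed
    also have "\<not> k < lab v \<longleftrightarrow> v \<le> (k - 1) * w + label_size r t k"
    proof (cases "k \<le> t")
      case True
      then have "(k - 1) * w + label_size r t k = k * w"
        using assms by (cases k) (auto simp: label_size_def)
      then show ?thesis
        using less_lab_iff[OF v, of k] True assms by auto
    next
      case False
      then have "k = t + 1"
        using assms by auto
      then show ?thesis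
        using lab_range[OF v] v w_bound by (auto simp: label_size_def)
    qed
    finally show ?thesis
      by auto
  qed
  note iff = this
  show ?thesis
  proof (rule set_eqI)
    fix v
    show "v \<in> {v \<in> {1..r}. lab v = k} \<longleftrightarrow> v \<in> {(k - 1) * w + 1..(k - 1) * w + label_size r t k}"
      using iff[of v] le by (cases "v \<in> {1..r}") auto
  qed
qed

lemma card_lab_class: "k \<in> {1..t + 1} \<Longrightarrow> card {v \<in> {1..r}. lab v = k} = label_size r t k"
  by (simp only: lab_class) simp

lemma label_size_pos: "0 < label_size r t k"
  using w_pos w_bound by (auto simp: label_size_def)

lemma ex_lab:
  assumes "k \<in> {1..t + 1}"
  obtains v where "v \<in> {1..r}" "lab v = k"
proof -
  have "card {v \<in> {1..r}. lab v = k} > 0"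
    using card_lab_class[OF assms] label_size_pos by simp
  then show ?thesis
    using that by (auto simp: card_gt_0_iff)
qed

text \<open>Left and right coupling checks of one index are complementary: \<open>v\<close> meets
  \<open>RightC i\<close> if \<open>i < lab v\<close> and \<open>LeftC i\<close> otherwise. Hence
  the neighbourhood of a variable node depends on its label only.\<close>

lemma sg_edges_iff: "(v, c) \<in> E \<longleftrightarrow> v \<in> {1..r} \<and> c \<in> label_checks l t (lab v)"
proof (cases "v \<in> {1..r}")
  case True
  have range: "1 \<le> lab v" "lab v \<le> t + 1"
    using lab_range[OF True] by auto
  show ?thesis
  proof (cases c)
    case (Local m)
    then show ?thesis
      using True by (auto simp: sg_edges_def)
  next
    case (RightC i)
    have "(v, RightC i) \<in> E \<longleftrightarrow> i \<in> {1..t} \<and> i < lab v"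
      using True less_lab_iff[OF True, of i] by (auto simp: sg_edges_def)
    then show ?thesis
      using True range RightC by auto
  next
    case (LeftC i)
    have "(v, LeftC i) \<in> E \<longleftrightarrow> i \<in> {1..t} \<and> \<not> i < lab v"
      using True less_lab_iff[OF True, of i] by (auto simp: sg_edges_def)
    then show ?thesis
      using True range LeftC by auto
  qed
next
  case False
  then show ?thesis
    using fst_sg_edges[of "(v, c)" l r t] by auto
qed

lemma check_labels_iff:
  assumes "k \<in> {1..t + 1}" "c \<in> snd ` E"
  shows "c \<in> label_checks l t k \<longleftrightarrow> k \<in> check_labels t c"
proof -
  have "(\<exists>m\<in>{1..l - t}. c = Local m) \<or> (\<exists>i\<in>{1..t}. c = RightC i) \<or> (\<exists>i\<in>{1..t}. c = LeftC i)"
    using assms(2) by (auto simp: sg_edges_def)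
  then show ?thesis
    using assms(1) by (auto simp: label_checks_def)
qed

lemma edges_at_check:
  assumes "c \<in> snd ` E"
  shows "{h \<in> E. snd h = c} = (\<lambda>v. (v, c)) ` {v \<in> {1..r}. lab v \<in> check_labels t c}"
proof -
  have "(v, c) \<in> E \<longleftrightarrow> v \<in> {1..r} \<and> lab v \<in> check_labels t c" for v
    using sg_edges_iff check_labels_iff[OF lab_range assms] by blast
  then show ?thesis
    by (auto simp: image_iff)
qed

lemma check_labels_subset: "c \<in> snd ` E \<Longrightarrow> check_labels t c \<subseteq> {1..t + 1}"
  by (auto simp: sg_edges_def)

lemma prod_over_check:
  fixes f :: "nat \<Rightarrow> real"
  assumes c: "c \<in> snd ` E" and "finite J" "J \<subseteq> check_labels t c"
  shows "(\<Prod>v\<in>{v \<in> {1..r}. lab v \<in> J}. f (lab v)) = (\<Prod>j\<in>J. f j ^ label_size r t j)"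
proof -
  define V where "V = {v \<in> {1..r}. lab v \<in> J}"
  have "(\<Prod>v\<in>V. f (lab v)) = (\<Prod>j\<in>J. \<Prod>v\<in>{v \<in> V. lab v = j}. f (lab v))"
    by (rule prod.group[symmetric]) (use \<open>finite J\<close> in \<open>auto simp: V_def\<close>)
  also have "\<dots> = (\<Prod>j\<in>J. f j ^ label_size r t j)"
  proof (rule prod.cong[OF refl])
    fix j assume j: "j \<in> J"
    then have "{v \<in> V. lab v = j} = {v \<in> {1..r}. lab v = j}"
      by (auto simp: V_def)
    moreover have "j \<in> {1..t + 1}"
      using j assms check_labels_subset[OF c] by blast
    ultimately show "(\<Prod>v\<in>{v \<in> V. lab v = j}. f (lab v)) = f j ^ label_size r t j"
      using card_lab_class[of j] by simp
  qed
  finally show ?thesis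
    by (simp add: V_def)
qed

text \<open>The label class of \<open>v\<close> loses \<open>v\<close> itself, which lowers its
  exponent by one; every other class seen by the check enters in full.\<close>

lemma prod_over_other_at_check:
  fixes f :: "nat \<Rightarrow> real"
  assumes e: "(v, c) \<in> E"
  shows "(\<Prod>h\<in>other_at_cn E (v, c). f (lab (fst h)))
    = f (lab v) ^ (label_size r t (lab v) - 1) * (\<Prod>j\<in>check_labels t c - {lab v}. f j ^ label_size r t j)"
proof -
  have c: "c \<in> snd ` E" and v: "v \<in> {1..r}"
    using e sg_edges_iff by force+
  define J where "J = check_labels t c"
  have "finite J"
    using check_labels_subset[OF c] unfolding J_def by (rule finite_subset) simp
  have labv: "lab v \<in> J" "lab v \<in> {1..t + 1}"
    using e check_labels_iff[OF lab_range[OF v] c] sg_edges_iff lab_range[OF v] by (auto simp: J_def)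
  have "other_at_cn E (v, c) = {h \<in> E. snd h = c} - {(v, c)}"
    by (auto simp: other_at_cn_def)
  also have "\<dots> = (\<lambda>v. (v, c)) ` ({v \<in> {1..r}. lab v \<in> J} - {v})"
    unfolding edges_at_check[OF c] J_def by auto
  finally have "(\<Prod>h\<in>other_at_cn E (v, c). f (lab (fst h))) = (\<Prod>v'\<in>{v \<in> {1..r}. lab v \<in> J} - {v}. f (lab v'))"
    by (simp add: prod.reindex inj_on_def)
  also have "{v \<in> {1..r}. lab v \<in> J} - {v} = ({v' \<in> {1..r}. lab v' = lab v} - {v}) \<union> {v' \<in> {1..r}. lab v' \<in> J - {lab v}}"
    using labv by auto
  also have "(\<Prod>v'\<in>\<dots>. f (lab v')) = (\<Prod>v'\<in>{v' \<in> {1..r}. lab v' = lab v} - {v}. f (lab v'))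
      * (\<Prod>v'\<in>{v' \<in> {1..r}. lab v' \<in> J - {lab v}}. f (lab v'))"
    by (rule prod.union_disjoint) auto
  also have "(\<Prod>v'\<in>{v' \<in> {1..r}. lab v' \<in> J - {lab v}}. f (lab v')) = (\<Prod>j\<in>J - {lab v}. f j ^ label_size r t j)"
    using \<open>finite J\<close> by (intro prod_over_check[OF c]) (auto simp: J_def)
  also have "(\<Prod>v'\<in>{v' \<in> {1..r}. lab v' = lab v} - {v}. f (lab v')) = f (lab v) ^ (label_size r t (lab v) - 1)"
    using v card_lab_class[OF labv(2)] by simp
  finally show ?thesis
    by (simp add: J_def)
qed

text \<open>By induction the incoming values at a check depend on the label of the sender only, so
  the product over its edges collapses to one power per label class; at a variable node the product
  runs over the checks of its label.\<close>

lemma de_vn_eq_type_vn: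
  assumes "(v, c) \<in> E"
  shows "de_vn E \<epsilon> q n (v, c) = type_vn l r t \<epsilon> q n (lab v) c"
  using assms
proof (induction n arbitrary: v c)
  case (Suc n)
  have cn: "de_cn E q (de_vn E \<epsilon> q n) (v, c') = type_cn r t q (type_vn l r t \<epsilon> q n) (lab v) c'" if "(v, c') \<in> E" for c'
  proof -
    have "(\<Prod>h\<in>other_at_cn E (v, c'). 1 - de_vn E \<epsilon> q n h)
        = (\<Prod>h\<in>other_at_cn E (v, c'). 1 - type_vn l r t \<epsilon> q n (lab (fst h)) c')"
      using Suc.IH by (intro prod.cong) (auto simp: other_at_cn_def)
    then show ?thesis
      unfolding de_cn_def type_cn_def by (simp add: prod_over_other_at_check[OF that, of "\<lambda>k. 1 - type_vn l r t \<epsilon> q n k c'"])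
  qed
  have "other_at_vn E (v, c) = Pair v ` (label_checks l t (lab v) - {c})"
    using Suc.prems sg_edges_iff by (auto simp: other_at_vn_def)
  then have "(\<Prod>g\<in>other_at_vn E (v, c). de_cn E q (de_vn E \<epsilon> q n) g)
      = (\<Prod>c'\<in>label_checks l t (lab v) - {c}. de_cn E q (de_vn E \<epsilon> q n) (v, c'))"
    by (simp add: prod.reindex inj_on_def)
  also have "\<dots> = (\<Prod>c'\<in>label_checks l t (lab v) - {c}. type_cn r t q (type_vn l r t \<epsilon> q n) (lab v) c')"
    using Suc.prems sg_edges_iff by (intro prod.cong refl cn) auto
  finally show ?case
    by simp
qed simp

lemma de_cn_eq_type_cn:
  assumes "(v, c) \<in> E"
  shows "de_cn E q (de_vn E \<epsilon> q n) (v, c) = type_cn r t q (type_vn l r t \<epsilon> q n) (lab v) c"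
proof -
  have "(\<Prod>h\<in>other_at_cn E (v, c). 1 - de_vn E \<epsilon> q n h)
      = (\<Prod>h\<in>other_at_cn E (v, c). 1 - type_vn l r t \<epsilon> q n (lab (fst h)) c)"
    using de_vn_eq_type_vn by (intro prod.cong) (auto simp: other_at_cn_def)
  then show ?thesis
    unfolding de_cn_def type_cn_def
    by (simp add: prod_over_other_at_check[OF assms, of "\<lambda>k. 1 - type_vn l r t \<epsilon> q n k c"])
qed

lemma prod_checks:
  fixes f :: "check \<Rightarrow> real"
  assumes "finite I" "finite J" "finite K"
  shows "(\<Prod>c\<in>Local ` I \<union> RightC ` J \<union> LeftC ` K. f c)
       = (\<Prod>m\<in>I. f (Local m)) * (\<Prod>j\<in>J. f (RightC j)) * (\<Prod>j\<in>K. f (LeftC j))"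
proof -
  have "(\<Prod>c\<in>Local ` I \<union> RightC ` J \<union> LeftC ` K. f c)
      = (\<Prod>c\<in>Local ` I. f c) * (\<Prod>c\<in>RightC ` J. f c) * (\<Prod>c\<in>LeftC ` K. f c)"
  proof -
    have "(Local ` I \<union> RightC ` J) \<inter> LeftC ` K = {}" "Local ` I \<inter> RightC ` J = {}"
      by blast+
    then show ?thesis
      using assms by (simp add: prod.union_disjoint)
  qed
  then show ?thesis
    by (simp add: prod.reindex inj_on_def)
qed

text \<open>A variable node meets \<open>l - t\<close> local checks with a common factor; one of
  these factors is lost exactly when the recipient is itself local.\<close>

lemma prod_label_checks_minus:
  fixes f :: "check \<Rightarrow> real"
  assumes f: "\<forall>m\<in>{1..l - t}. f (Local m) = f (Local 1)"
  shows "m \<in> {1..l - t} \<Longrightarrow> (\<Prod>c\<in>label_checks l t k - {Local m}. f c)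
      = f (Local 1) ^ (l - t - 1) * (\<Prod>j\<in>{1..k - 1}. f (RightC j)) * (\<Prod>j\<in>{k..t}. f (LeftC j))"
    and "(\<Prod>c\<in>label_checks l t k - {RightC i}. f c)
      = f (Local 1) ^ (l - t) * (\<Prod>j\<in>{1..k - 1} - {i}. f (RightC j)) * (\<Prod>j\<in>{k..t}. f (LeftC j))"
    and "(\<Prod>c\<in>label_checks l t k - {LeftC i}. f c)
      = f (Local 1) ^ (l - t) * (\<Prod>j\<in>{1..k - 1}. f (RightC j)) * (\<Prod>j\<in>{k..t} - {i}. f (LeftC j))"
proof -
  have power: "(\<Prod>m\<in>I. f (Local m)) = f (Local 1) ^ card I" if "I \<subseteq> {1..l - t}" for I
  proof -
    have "(\<Prod>m\<in>I. f (Local m)) = (\<Prod>m\<in>I. f (Local 1))"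
      using that f by (intro prod.cong refl) blast
    then show ?thesis
      by simp
  qed
  have "label_checks l t k - {Local m} = Local ` ({1..l - t} - {m}) \<union> RightC ` {1..k - 1} \<union> LeftC ` {k..t}" for m
    by (auto simp: label_checks_def)
  then show "m \<in> {1..l - t} \<Longrightarrow> (\<Prod>c\<in>label_checks l t k - {Local m}. f c)
      = f (Local 1) ^ (l - t - 1) * (\<Prod>j\<in>{1..k - 1}. f (RightC j)) * (\<Prod>j\<in>{k..t}. f (LeftC j))"
    by (simp add: prod_checks power)
  have "label_checks l t k - {RightC i} = Local ` {1..l - t} \<union> RightC ` ({1..k - 1} - {i}) \<union> LeftC ` {k..t}"
    by (auto simp: label_checks_def)
  then show "(\<Prod>c\<in>label_checks l t k - {RightC i}. f c)
      = f (Local 1) ^ (l - t) * (\<Prod>j\<in>{1..k - 1} - {i}. f (RightC j)) * (\<Prod>j\<in>{k..t}. f (LeftC j))"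
    by (simp add: prod_checks power)
  have "label_checks l t k - {LeftC i} = Local ` {1..l - t} \<union> RightC ` {1..k - 1} \<union> LeftC ` ({k..t} - {i})"
    by (auto simp: label_checks_def)
  then show "(\<Prod>c\<in>label_checks l t k - {LeftC i}. f c)
      = f (Local 1) ^ (l - t) * (\<Prod>j\<in>{1..k - 1}. f (RightC j)) * (\<Prod>j\<in>{k..t} - {i}. f (LeftC j))"
    by (simp add: prod_checks power)
qed

lemma type_cn_Local_cong:
  assumes "q (Local m) = q (Local m')" "\<And>j. x j (Local m) = x j (Local m')"
  shows "type_cn r t q x k (Local m) = type_cn r t q x k (Local m')"
  using assms by (simp add: type_cn_def)

text \<open>Local checks see the same variable nodes and have no external message, so they are
  interchangeable. This is what turns products over local checks into powers.\<close>

lemma type_vn_Local: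
  assumes q: "\<And>m. q (Local m) = 0" and "m \<in> {1..l - t}"
  shows "type_vn l r t \<epsilon> q n k (Local m) = type_vn l r t \<epsilon> q n k (Local 1)"
  using assms(2)
proof (induction n arbitrary: k m)
  case (Suc n)
  have "\<forall>m\<in>{1..l - t}. type_cn r t q (type_vn l r t \<epsilon> q n) k (Local m) = type_cn r t q (type_vn l r t \<epsilon> q n) k (Local 1)"
  proof
    fix m assume "m \<in> {1..l - t}"
    from Suc.IH[OF this] show "type_cn r t q (type_vn l r t \<epsilon> q n) k (Local m) = type_cn r t q (type_vn l r t \<epsilon> q n) k (Local 1)"
      by (intro type_cn_Local_cong) (simp_all add: q)
  qed
  note eq = prod_label_checks_minus(1)[where f = "type_cn r t q (type_vn l r t \<epsilon> q n) k", OF this]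
  have "1 \<in> {1..l - t}"
    using Suc.prems by auto
  show ?case
    unfolding type_vn.simps(2) eq[OF Suc.prems] eq[OF \<open>1 \<in> {1..l - t}\<close>] by (rule refl)
qed simp

lemma type_cn_Local:
  assumes q: "\<And>m. q (Local m) = 0" and "m \<in> {1..l - t}"
  shows "type_cn r t q (type_vn l r t \<epsilon> q n) k (Local m) = type_cn r t q (type_vn l r t \<epsilon> q n) k (Local 1)"
  using type_vn_Local[where q = q, OF q assms(2)] by (intro type_cn_Local_cong) (auto simp: q)

lemma type_vn_Suc:
  fixes \<epsilon> :: real and n :: nat
  assumes q: "\<And>m. q (Local m) = 0"
  defines "u \<equiv> type_cn r t q (type_vn l r t \<epsilon> q n)"
  shows "type_vn l r t \<epsilon> q (Suc n) k (Local 1)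
      = \<epsilon> * u k (Local 1) ^ (l - t - 1) * (\<Prod>j\<in>{1..k - 1}. u k (RightC j)) * (\<Prod>j\<in>{k..t}. u k (LeftC j))"
    and "type_vn l r t \<epsilon> q (Suc n) k (RightC i)
      = \<epsilon> * u k (Local 1) ^ (l - t) * (\<Prod>j\<in>{1..k - 1} - {i}. u k (RightC j)) * (\<Prod>j\<in>{k..t}. u k (LeftC j))"
    and "type_vn l r t \<epsilon> q (Suc n) k (LeftC i)
      = \<epsilon> * u k (Local 1) ^ (l - t) * (\<Prod>j\<in>{1..k - 1}. u k (RightC j)) * (\<Prod>j\<in>{k..t} - {i}. u k (LeftC j))"
proof -
  have "1 \<in> {1..l - t}"
    using l_ge_3 t_le by auto
  have "\<forall>m\<in>{1..l - t}. type_cn r t q (type_vn l r t \<epsilon> q n) k (Local m) = type_cn r t q (type_vn l r t \<epsilon> q n) k (Local 1)"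
    using type_cn_Local[where q = q, OF q] by blast
  note eq = prod_label_checks_minus[where f = "type_cn r t q (type_vn l r t \<epsilon> q n) k", OF this]
  show "type_vn l r t \<epsilon> q (Suc n) k (Local 1)
      = \<epsilon> * u k (Local 1) ^ (l - t - 1) * (\<Prod>j\<in>{1..k - 1}. u k (RightC j)) * (\<Prod>j\<in>{k..t}. u k (LeftC j))"
    unfolding type_vn.simps(2) eq(1)[OF \<open>1 \<in> {1..l - t}\<close>] u_def by (simp only: mult.assoc)
  show "type_vn l r t \<epsilon> q (Suc n) k (RightC i)
      = \<epsilon> * u k (Local 1) ^ (l - t) * (\<Prod>j\<in>{1..k - 1} - {i}. u k (RightC j)) * (\<Prod>j\<in>{k..t}. u k (LeftC j))"
    unfolding type_vn.simps(2) eq(2) u_def by (simp only: mult.assoc)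
  show "type_vn l r t \<epsilon> q (Suc n) k (LeftC i)
      = \<epsilon> * u k (Local 1) ^ (l - t) * (\<Prod>j\<in>{1..k - 1}. u k (RightC j)) * (\<Prod>j\<in>{k..t} - {i}. u k (LeftC j))"
    unfolding type_vn.simps(2) eq(3) u_def by (simp only: mult.assoc)
qed

text \<open>Class \<open>t + 1\<close> is split off because its size \<open>r - t * w\<close> may
  differ from \<open>w\<close>. No such factor occurs at \<open>LeftC i\<close>, which sees labels
  up to \<open>i \<le> t\<close> only.\<close>

lemma type_cn_formulas:
  shows "k \<in> {1..t} \<Longrightarrow> q (Local 1) = 0 \<Longrightarrow> type_cn r t q x k (Local 1)
      = 1 - (1 - x k (Local 1)) ^ (w - 1) * (1 - x (t + 1) (Local 1)) ^ (r - t * w)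
          * (\<Prod>j\<in>{1..t} - {k}. (1 - x j (Local 1)) ^ w)"
    and "q (Local 1) = 0 \<Longrightarrow> type_cn r t q x (t + 1) (Local 1)
      = 1 - (1 - x (t + 1) (Local 1)) ^ (r - t * w - 1) * (\<Prod>j\<in>{1..t}. (1 - x j (Local 1)) ^ w)"
    and "k \<in> {i + 1..t} \<Longrightarrow> type_cn r t q x k (RightC i)
      = 1 - (1 - q (RightC i)) * (1 - x k (RightC i)) ^ (w - 1) * (1 - x (t + 1) (RightC i)) ^ (r - t * w)
          * (\<Prod>j\<in>{i + 1..t} - {k}. (1 - x j (RightC i)) ^ w)"
    and "i \<le> t \<Longrightarrow> type_cn r t q x (t + 1) (RightC i)
      = 1 - (1 - q (RightC i)) * (1 - x (t + 1) (RightC i)) ^ (r - t * w - 1)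
          * (\<Prod>j\<in>{i + 1..t}. (1 - x j (RightC i)) ^ w)"
    and "i \<le> t \<Longrightarrow> k \<in> {1..i} \<Longrightarrow> type_cn r t q x k (LeftC i)
      = 1 - (1 - q (LeftC i)) * (1 - x k (LeftC i)) ^ (w - 1) * (\<Prod>j\<in>{1..i} - {k}. (1 - x j (LeftC i)) ^ w)"
proof -
  have low: "(\<Prod>j\<in>J. f j ^ label_size r t j) = (\<Prod>j\<in>J. f j ^ w)" if "J \<subseteq> {..t}" for J and f :: "nat \<Rightarrow> real"
    using that by (intro prod.cong) (auto simp: label_size_def)
  have sz: "label_size r t k = w" if "k \<le> t" for k
    using that by (simp add: label_size_def)
  have sz': "label_size r t (t + 1) = r - t * w"
    by (simp add: label_size_def)
  have top: "(\<Prod>j\<in>{i + 1..t + 1} - {k}. f j ^ label_size r t j)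
      = f (t + 1) ^ (r - t * w) * (\<Prod>j\<in>{i + 1..t} - {k}. f j ^ w)" if "k \<le> t" "i \<le> t" for i k and f :: "nat \<Rightarrow> real"
  proof -
    have "{i + 1..t + 1} - {k} = insert (t + 1) ({i + 1..t} - {k})"
      using that by auto
    moreover have "(\<Prod>j\<in>{i + 1..t} - {k}. f j ^ label_size r t j) = (\<Prod>j\<in>{i + 1..t} - {k}. f j ^ w)"
      by (intro low) auto
    ultimately show ?thesis
      by (simp add: sz'[simplified])
  qed
  have top': "{i + 1..t + 1} - {t + 1} = {i + 1..t}" if "i \<le> t" for i
    by auto
  show "k \<in> {1..t} \<Longrightarrow> q (Local 1) = 0 \<Longrightarrow> type_cn r t q x k (Local 1)
      = 1 - (1 - x k (Local 1)) ^ (w - 1) * (1 - x (t + 1) (Local 1)) ^ (r - t * w)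
          * (\<Prod>j\<in>{1..t} - {k}. (1 - x j (Local 1)) ^ w)"
    using top[of k 0 "\<lambda>j. 1 - x j (Local 1)"] by (simp add: type_cn_def sz)
  show "q (Local 1) = 0 \<Longrightarrow> type_cn r t q x (t + 1) (Local 1)
      = 1 - (1 - x (t + 1) (Local 1)) ^ (r - t * w - 1) * (\<Prod>j\<in>{1..t}. (1 - x j (Local 1)) ^ w)"
    using top'[of 0] low[of "{1..t}" "\<lambda>j. 1 - x j (Local 1)"] sz' by (simp add: type_cn_def)
  show "k \<in> {i + 1..t} \<Longrightarrow> type_cn r t q x k (RightC i)
      = 1 - (1 - q (RightC i)) * (1 - x k (RightC i)) ^ (w - 1) * (1 - x (t + 1) (RightC i)) ^ (r - t * w)
          * (\<Prod>j\<in>{i + 1..t} - {k}. (1 - x j (RightC i)) ^ w)"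
    using top[of k i "\<lambda>j. 1 - x j (RightC i)"] by (simp add: type_cn_def sz)
  show "i \<le> t \<Longrightarrow> type_cn r t q x (t + 1) (RightC i)
      = 1 - (1 - q (RightC i)) * (1 - x (t + 1) (RightC i)) ^ (r - t * w - 1)
          * (\<Prod>j\<in>{i + 1..t}. (1 - x j (RightC i)) ^ w)"
    using top'[of i] low[of "{i + 1..t}" "\<lambda>j. 1 - x j (RightC i)"] sz' by (simp add: type_cn_def)
  show "i \<le> t \<Longrightarrow> k \<in> {1..i} \<Longrightarrow> type_cn r t q x k (LeftC i)
      = 1 - (1 - q (LeftC i)) * (1 - x k (LeftC i)) ^ (w - 1) * (\<Prod>j\<in>{1..i} - {k}. (1 - x j (LeftC i)) ^ w)"
    using low[of "{1..i} - {k}" "\<lambda>j. 1 - x j (LeftC i)"] by (auto simp: type_cn_def sz)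
qed

text \<open>The values for local, right and left checks lie in disjoint ranges separated by
  \<open>t + 1\<close> and \<open>v_idx t 1\<close>, and within the last two the index functions are
  injective. A label thus fixes the type up to the choice of a local check.\<close>

lemma label_index_cases:
  assumes "k \<in> {1..t + 1}" "c \<in> label_checks l t k" "k' \<in> {1..t + 1}" "c' \<in> label_checks l t k'"
    and "label_index t k c = label_index t k' c'"
  shows "k = k' \<and> (c = c' \<or> (\<exists>m\<in>{1..l - t}. \<exists>m'\<in>{1..l - t}. c = Local m \<and> c' = Local m'))"
proof -
  have s: "t + 1 < s_idx t k + i" "s_idx t k + i \<le> v_idx t 1" if "k \<in> {1..t + 1}" "i \<in> {1..k - 1}" for k i
    using s_idx_bounds[OF t_ge_1 that] by auto
  have v: "v_idx t 1 < v_idx t k + i" if "k \<in> {1..t + 1}" "i \<in> {k..t}" for k i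
    using v_idx_bound[OF that] .
  have "t + 1 \<le> v_idx t 1"
    using s_idx_last[OF t_ge_1] s_idx_mono[of 1 "t + 1" t] s_idx_1[of t] by simp
  then have lv: "t + 1 < v_idx t k + i" if "k \<in> {1..t + 1}" "i \<in> {k..t}" for k i
    using v[OF that] by simp
  show ?thesis
  proof (cases c)
    case c: (Local m)
    show ?thesis
    proof (cases c')
      case (Local m')
      then show ?thesis
        using c assms by simp
    next
      case (RightC i')
      then show ?thesis
        using c assms s(1)[OF assms(3), of i'] by simp
    next
      case (LeftC i')
      then show ?thesis
        using c assms lv[OF assms(3), of i'] by simp
    qed
  next
    case c: (RightC i)
    show ?thesis
    proof (cases c')
      case (Local m)
      then show ?thesis
        using c assms s(1)[OF assms(1), of i] by simp
    next
      case (RightC i')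
      then show ?thesis
        using c assms s_idx_inj[OF assms(1) _ assms(3), of i i'] by simp
    next
      case (LeftC i')
      then show ?thesis
        using c assms s(2)[OF assms(1), of i] v[OF assms(3), of i'] by simp
    qed
  next
    case c: (LeftC i)
    show ?thesis
    proof (cases c')
      case (Local m)
      then show ?thesis
        using c assms lv[OF assms(1), of i] by simp
    next
      case (RightC i')
      then show ?thesis
        using c assms s(2)[OF assms(3), of i'] v[OF assms(1), of i] by simp
    next
      case (LeftC i')
      then show ?thesis
        using c assms v_idx_inj[OF assms(1) _ assms(3), of i i'] by simp
    qed
  qed
qed

lemma label_index_surj:
  assumes "j \<in> {1..(t + 1)\<^sup>2}"
  shows "\<exists>k\<in>{1..t + 1}. \<exists>c\<in>label_checks l t k. j = label_index t k c"
proof -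
  have "1 \<in> {1..l - t}"
    using l_ge_3 t_le by auto
  consider "j \<in> {1..t + 1}" | "t + 1 < j" "j \<le> v_idx t 1" | "v_idx t 1 < j"
    using assms by fastforce
  then show ?thesis
  proof cases
    case 1
    then show ?thesis
      using \<open>1 \<in> {1..l - t}\<close> by (intro bexI[of _ j] bexI[of _ "Local 1"]) auto
  next
    case 2
    then obtain k i where "k \<in> {1..t + 1}" "i \<in> {1..k - 1}" "j = s_idx t k + i"
      using s_idx_surj[of t j "t + 1"] s_idx_last[OF t_ge_1] s_idx_Suc[of "t + 1" t] by auto
    then show ?thesis
      by (intro bexI[of _ k] bexI[of _ "RightC i"]) auto
  next
    case 3
    then obtain k i where "k \<in> {1..t}" "i \<in> {k..t}" "j = v_idx t k + i"
      using v_idx_surj[of t j t] v_idx_last[OF t_ge_1] assms by auto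
    then show ?thesis
      by (intro bexI[of _ k] bexI[of _ "LeftC i"]) auto
  qed
qed

end

section \<open>Density evolution of the target and the helper\<close>

text \<open>Some edge must carry the label, as otherwise the description would hold of every
  number.\<close>

lemma the_common_limit:
  assumes "e \<in> S" "P e" "\<And>e. e \<in> S \<Longrightarrow> P e \<Longrightarrow> limit_in_prob M (Y e) p"
  shows "(THE p. \<forall>e\<in>S. P e \<longrightarrow> limit_in_prob M (Y e) p) = p"
  using assms by (intro the_equality) (auto intro: limit_in_prob_unique)

lemma de_cn_unit:
  assumes "q (snd g) \<in> {0..1}" "\<And>h. x h \<in> {0..1}"
  shows "de_cn A q x g \<in> {0..1}"
  unfolding de_cn_def using assms by (intro unit_one_minus unit_mult unit_prod)

lemma de_cn_mono:
  assumes "q (snd g) \<in> {0..1}" "\<And>h. 0 \<le> x h \<and> x h \<le> y h \<and> y h \<le> 1"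
  shows "de_cn A q x g \<le> de_cn A q y g"
proof -
  have "(\<Prod>h\<in>other_at_cn A g. 1 - y h) \<le> (\<Prod>h\<in>other_at_cn A g. 1 - x h)"
    using assms(2) by (intro prod_mono) auto
  then show ?thesis
    unfolding de_cn_def using assms(1) by (intro diff_left_mono mult_left_mono) auto
qed

text \<open>The start value \<open>1\<close> is the largest possible and the iteration is monotone,
  so the comparison of the first two iterates propagates.\<close>

lemma de_vn_decreasing:
  assumes \<epsilon>: "\<epsilon> \<in> {0..1}" and q: "\<And>g. g \<in> A \<Longrightarrow> q (snd g) \<in> {0..1}"
  shows "de_vn A \<epsilon> q (Suc n) e \<le> de_vn A \<epsilon> q n e"
proof (induction n arbitrary: e)
  case 0
  show ?case
    using de_vn_unit[of \<epsilon> A q "Suc 0" e] assms by simp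
next
  case (Suc n)
  have unit: "de_vn A \<epsilon> q m h \<in> {0..1}" for m h
    using assms by (rule de_vn_unit)
  have qg: "q (snd g) \<in> {0..1}" if "g \<in> other_at_vn A e" for g
    using that q[of g] by (simp add: other_at_vn_def)
  have "(\<Prod>g\<in>other_at_vn A e. de_cn A q (de_vn A \<epsilon> q (Suc n)) g)
      \<le> (\<Prod>g\<in>other_at_vn A e. de_cn A q (de_vn A \<epsilon> q n) g)"
  proof (intro prod_mono conjI)
    fix g assume g: "g \<in> other_at_vn A e"
    show "0 \<le> de_cn A q (de_vn A \<epsilon> q (Suc n)) g"
      using de_cn_unit[of q g "de_vn A \<epsilon> q (Suc n)" A, OF qg[OF g] unit] by simp
    show "de_cn A q (de_vn A \<epsilon> q (Suc n)) g \<le> de_cn A q (de_vn A \<epsilon> q n) g"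
      using Suc.IH unit[of "Suc n"] unit[of n] by (intro de_cn_mono qg[OF g]) (simp del: de_vn.simps)
  qed
  then show ?case
    unfolding de_vn.simps(2)[of A \<epsilon> q "Suc n"] de_vn.simps(2)[of A \<epsilon> q n]
    using \<epsilon> by (intro mult_left_mono) (simp_all only: de_vn.simps atLeastAtMost_iff)
qed

lemma convergent_de_vn:
  assumes "\<epsilon> \<in> {0..1}" "\<And>g. g \<in> A \<Longrightarrow> q (snd g) \<in> {0..1}"
  shows "convergent (\<lambda>n. de_vn A \<epsilon> q n e)"
proof -
  have "decseq (\<lambda>n. de_vn A \<epsilon> q n e)"
    by (rule decseq_SucI) (rule de_vn_decreasing[where q = q, OF assms])
  moreover have "\<forall>n. 0 \<le> de_vn A \<epsilon> q n e"
    using de_vn_unit[of \<epsilon> A q _ e, OF assms] by simp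
  ultimately obtain a where "(\<lambda>n. de_vn A \<epsilon> q n e) \<longlonglongrightarrow> a"
    using decseq_convergent[of "\<lambda>n. de_vn A \<epsilon> q n e" 0] by blast
  then show ?thesis
    by (rule convergentI)
qed

lemma convergent_de_cn:
  assumes "\<And>h. convergent (\<lambda>n. x n h)"
  shows "convergent (\<lambda>n. de_cn A q (x n) g)"
proof -
  have "(\<lambda>n. x n h) \<longlonglongrightarrow> lim (\<lambda>n. x n h)" for h
    using assms by (simp add: convergent_LIMSEQ_iff)
  then have "(\<lambda>n. de_cn A q (x n) g) \<longlonglongrightarrow> 1 - (1 - q (snd g)) * (\<Prod>h\<in>other_at_cn A g. 1 - lim (\<lambda>n. x n h))"
    unfolding de_cn_def by (intro tendsto_intros)
  then show ?thesis
    by (rule convergentI)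
qed

section \<open>The helper recursion as a target recursion\<close>

context
  fixes l r t :: nat and \<epsilon> :: real and \<delta>R :: "nat \<Rightarrow> real"
begin

text \<open>An inactive check behaves like a check whose external message is always erased.\<close>

lemma de_cn_LeftC_erased: "de_cn A (ext_prob (\<lambda>_. 1) \<delta>R) x (v, LeftC i) = 1"
  by (simp add: de_cn_def)

lemma de_cn_helper_edges:
  "g \<in> helper_edges l r t \<Longrightarrow> de_cn (helper_edges l r t) q x g = de_cn (sg_edges l r t) q x g"
proof -
  assume "g \<in> helper_edges l r t"
  then have "other_at_cn (helper_edges l r t) g = other_at_cn (sg_edges l r t) g"
    by (auto simp: other_at_cn_def helper_edges_def)
  then show ?thesis
    by (simp add: de_cn_def)
qed

text \<open>Leaving out the inactive checks removes only factors \<open>1\<close> from the products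
  at variable nodes. Edges \<open>e\<close> to inactive checks are included, since their messages
  determine the output.\<close>

lemma de_vn_helper_edges:
  "de_vn (helper_edges l r t) \<epsilon> (ext_prob (\<lambda>_. 1) \<delta>R) n e = de_vn (sg_edges l r t) \<epsilon> (ext_prob (\<lambda>_. 1) \<delta>R) n e"
proof (induction n arbitrary: e)
  case (Suc n)
  define q where "q = ext_prob (\<lambda>_. 1) \<delta>R"
  define x where "x = de_vn (sg_edges l r t) \<epsilon> q n"
  have x: "de_vn (helper_edges l r t) \<epsilon> q n = x"
    using Suc by (auto simp: x_def q_def)
  have "(\<Prod>g\<in>other_at_vn (helper_edges l r t) e. de_cn (helper_edges l r t) q x g)
      = (\<Prod>g\<in>other_at_vn (helper_edges l r t) e. de_cn (sg_edges l r t) q x g)"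
    by (intro prod.cong refl de_cn_helper_edges) (auto simp: other_at_vn_def)
  also have "\<dots> = (\<Prod>g\<in>other_at_vn (sg_edges l r t) e. de_cn (sg_edges l r t) q x g)"
    using finite_subset[OF _ finite_sg_edges, of "other_at_vn (sg_edges l r t) e" l r t]
    by (intro prod.mono_neutral_left)
       (auto simp: other_at_vn_def helper_edges_def q_def de_cn_LeftC_erased)
  finally show ?case
    by (simp add: q_def[symmetric] x) (simp add: x_def)
qed simp

end

context semi_global
begin

lemma type_eq_of_edge_label:
  assumes "k \<in> {1..t + 1}" "c \<in> label_checks l t k" "e \<in> E" "edge_label l r t e = label_index t k c"
    and q: "\<And>m. q (Local m) = 0"
  shows "type_vn l r t \<epsilon> q n (lab (fst e)) (snd e) = type_vn l r t \<epsilon> q n k c"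
    and "type_cn r t q (type_vn l r t \<epsilon> q n) (lab (fst e)) (snd e) = type_cn r t q (type_vn l r t \<epsilon> q n) k c"
proof -
  have "fst e \<in> {1..r}" "snd e \<in> label_checks l t (lab (fst e))"
    using assms(3) sg_edges_iff[of "fst e" "snd e"] by auto
  then have *: "lab (fst e) = k \<and> (snd e = c \<or> (\<exists>m\<in>{1..l - t}. \<exists>m'\<in>{1..l - t}. snd e = Local m \<and> c = Local m'))"
    using assms lab_range by (intro label_index_cases) (auto simp: edge_label_eq)
  then show "type_vn l r t \<epsilon> q n (lab (fst e)) (snd e) = type_vn l r t \<epsilon> q n k c"
    using type_vn_Local[where q = q, OF q] by metis
  show "type_cn r t q (type_vn l r t \<epsilon> q n) (lab (fst e)) (snd e) = type_cn r t q (type_vn l r t \<epsilon> q n) k c"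
    using * type_cn_Local[where q = q, OF q] by metis
qed

lemma ex_edge_of_label:
  assumes "k \<in> {1..t + 1}" "c \<in> label_checks l t k"
  obtains v where "(v, c) \<in> E" "lab v = k" "edge_label l r t (v, c) = label_index t k c"
proof -
  obtain v where "v \<in> {1..r}" "lab v = k"
    using ex_lab[OF assms(1)] .
  then show ?thesis
    using that assms(2) sg_edges_iff[of v c] by (simp add: edge_label_eq)
qed

lemma label_of_edge:
  assumes "e \<in> E"
  shows "lab (fst e) \<in> {1..t + 1}" "snd e \<in> label_checks l t (lab (fst e))"
    and "edge_label l r t e = label_index t (lab (fst e)) (snd e)"
  using assms sg_edges_iff[of "fst e" "snd e"] lab_range by (auto simp: edge_label_eq)

end

section \<open>Formulas of the target\<close>

locale de_setup = semi_global l r t for l r t +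
  fixes \<epsilon> :: real and \<delta>L \<delta>R :: "nat \<Rightarrow> real"
  assumes \<epsilon>: "\<epsilon> \<in> {0..1}"
    and \<delta>L: "\<forall>i\<in>{1..t}. \<delta>L i \<in> {0..1}" and \<delta>R: "\<forall>i\<in>{1..t}. \<delta>R i \<in> {0..1}"
begin

abbreviation "q \<equiv> ext_prob \<delta>L \<delta>R"
abbreviation "X \<equiv> type_vn l r t \<epsilon> q"
abbreviation "U n \<equiv> type_cn r t q (type_vn l r t \<epsilon> q (n - 1))"
abbreviation "x \<equiv> target_x l r t \<epsilon> \<delta>L \<delta>R"
abbreviation "u \<equiv> target_u l r t \<epsilon> \<delta>L \<delta>R"

lemma q_Local: "q (Local m) = 0"
  by simp

lemma target_vn_limit_type:
  assumes "k \<in> {1..t + 1}" "c \<in> label_checks l t k" "e \<in> E" "edge_label l r t e = label_index t k c"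
  shows "target_vn_limit l r t \<epsilon> \<delta>L \<delta>R n e (X n k c)"
proof -
  have "de_vn E \<epsilon> q n e = X n k c"
    using de_vn_eq_type_vn[of "fst e" "snd e" \<epsilon> q n] type_eq_of_edge_label(1)[where q = q, OF assms q_Local] assms(3) by simp
  then show ?thesis
    using vn_fraction_limit[OF order_refl \<epsilon> \<delta>L \<delta>R assms(3), of n] by (simp add: target_vn_limit_def)
qed

lemma target_cn_limit_type:
  assumes "k \<in> {1..t + 1}" "c \<in> label_checks l t k" "e \<in> E" "edge_label l r t e = label_index t k c"
  shows "target_cn_limit l r t \<epsilon> \<delta>L \<delta>R n e (U n k c)"
proof -
  have "de_cn E q (de_vn E \<epsilon> q (n - 1)) e = U n k c"
    using de_cn_eq_type_cn[of "fst e" "snd e" q \<epsilon> "n - 1"] type_eq_of_edge_label(2)[where q = q, OF assms q_Local] assms(3) by simp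
  then show ?thesis
    using cn_fraction_limit[OF order_refl \<epsilon> \<delta>L \<delta>R assms(3), of n] by (simp add: target_cn_limit_def)
qed

lemma target_x_eq:
  assumes "k \<in> {1..t + 1}" "c \<in> label_checks l t k"
  shows "x n (label_index t k c) = X n k c"
proof -
  obtain v where "(v, c) \<in> E" "edge_label l r t (v, c) = label_index t k c"
    using ex_edge_of_label[OF assms] .
  then show ?thesis
    unfolding target_x_def target_vn_limit_def
    by (intro the_common_limit) (use target_vn_limit_type[OF assms] in \<open>auto simp: target_vn_limit_def\<close>)
qed

lemma target_u_eq:
  assumes "k \<in> {1..t + 1}" "c \<in> label_checks l t k"
  shows "u n (label_index t k c) = U n k c"
proof -
  obtain v where "(v, c) \<in> E" "edge_label l r t (v, c) = label_index t k c"
    using ex_edge_of_label[OF assms] .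
  then show ?thesis
    unfolding target_u_def target_cn_limit_def
    by (intro the_common_limit) (use target_cn_limit_type[OF assms] in \<open>auto simp: target_cn_limit_def\<close>)
qed

lemma target_vn_limit_x:
  assumes "e \<in> E"
  shows "target_vn_limit l r t \<epsilon> \<delta>L \<delta>R n e (x n (edge_label l r t e))"
  using target_vn_limit_type[OF label_of_edge(1,2)[OF assms] assms label_of_edge(3)[OF assms]]
    target_x_eq[OF label_of_edge(1,2)[OF assms]] label_of_edge(3)[OF assms] by simp

lemma target_cn_limit_u:
  assumes "e \<in> E"
  shows "target_cn_limit l r t \<epsilon> \<delta>L \<delta>R n e (u n (edge_label l r t e))"
  using target_cn_limit_type[OF label_of_edge(1,2)[OF assms] assms label_of_edge(3)[OF assms]]
    target_u_eq[OF label_of_edge(1,2)[OF assms]] label_of_edge(3)[OF assms] by simp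

lemma Local_1: "Local 1 \<in> label_checks l t k"
  using l_ge_3 t_le by auto

lemma x_types:
  shows "k \<in> {1..t + 1} \<Longrightarrow> x n k = X n k (Local 1)"
    and "k \<in> {1..t + 1} \<Longrightarrow> i \<in> {1..k - 1} \<Longrightarrow> x n (s_idx t k + i) = X n k (RightC i)"
    and "k \<in> {1..t + 1} \<Longrightarrow> i \<in> {k..t} \<Longrightarrow> x n (v_idx t k + i) = X n k (LeftC i)"
  using target_x_eq[of k "Local 1" n] target_x_eq[of k "RightC i" n] target_x_eq[of k "LeftC i" n] Local_1[of k]
  by simp_all

lemma u_types:
  shows "k \<in> {1..t + 1} \<Longrightarrow> u n k = U n k (Local 1)"
    and "k \<in> {1..t + 1} \<Longrightarrow> i \<in> {1..k - 1} \<Longrightarrow> u n (s_idx t k + i) = U n k (RightC i)"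
    and "k \<in> {1..t + 1} \<Longrightarrow> i \<in> {k..t} \<Longrightarrow> u n (v_idx t k + i) = U n k (LeftC i)"
  using target_u_eq[of k "Local 1" n] target_u_eq[of k "RightC i" n] target_u_eq[of k "LeftC i" n] Local_1[of k]
  by simp_all

lemma x_0: "j \<in> {1..(t + 1)\<^sup>2} \<Longrightarrow> x 0 j = 1"
  using label_index_surj[of j] target_x_eq[of _ _ 0] by fastforce

lemma X_formulas:
  assumes "n \<ge> 1"
  shows "X n k (Local 1) = \<epsilon> * U n k (Local 1) ^ (l - t - 1) * (\<Prod>j\<in>{1..k - 1}. U n k (RightC j)) * (\<Prod>j\<in>{k..t}. U n k (LeftC j))"
    and "X n k (RightC i) = \<epsilon> * U n k (Local 1) ^ (l - t) * (\<Prod>j\<in>{1..k - 1} - {i}. U n k (RightC j)) * (\<Prod>j\<in>{k..t}. U n k (LeftC j))"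
    and "X n k (LeftC i) = \<epsilon> * U n k (Local 1) ^ (l - t) * (\<Prod>j\<in>{1..k - 1}. U n k (RightC j)) * (\<Prod>j\<in>{k..t} - {i}. U n k (LeftC j))"
proof -
  obtain m where n: "n = Suc m"
    using assms by (cases n) auto
  note eq = type_vn_Suc[where q = q and \<epsilon> = \<epsilon> and n = m, OF q_Local]
  show "X n k (Local 1) = \<epsilon> * U n k (Local 1) ^ (l - t - 1) * (\<Prod>j\<in>{1..k - 1}. U n k (RightC j)) * (\<Prod>j\<in>{k..t}. U n k (LeftC j))"
    unfolding n diff_Suc_1 by (rule eq(1))
  show "X n k (RightC i) = \<epsilon> * U n k (Local 1) ^ (l - t) * (\<Prod>j\<in>{1..k - 1} - {i}. U n k (RightC j)) * (\<Prod>j\<in>{k..t}. U n k (LeftC j))"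
    unfolding n diff_Suc_1 by (rule eq(2))
  show "X n k (LeftC i) = \<epsilon> * U n k (Local 1) ^ (l - t) * (\<Prod>j\<in>{1..k - 1}. U n k (RightC j)) * (\<Prod>j\<in>{k..t} - {i}. U n k (LeftC j))"
    unfolding n diff_Suc_1 by (rule eq(3))
qed

lemma x_formulas:
  assumes "n \<ge> 1" and k: "k \<in> {1..t + 1}"
  shows "x n k = \<epsilon> * u n k ^ (l - t - 1) * (\<Prod>j\<in>{1..k - 1}. u n (s_idx t k + j)) * (\<Prod>j\<in>{k..t}. u n (v_idx t k + j))"
    and "i \<in> {1..k - 1} \<Longrightarrow> x n (s_idx t k + i)
      = \<epsilon> * u n k ^ (l - t) * (\<Prod>j\<in>{1..k - 1} - {i}. u n (s_idx t k + j)) * (\<Prod>j\<in>{k..t}. u n (v_idx t k + j))"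
    and "i \<in> {k..t} \<Longrightarrow> x n (v_idx t k + i)
      = \<epsilon> * u n k ^ (l - t) * (\<Prod>j\<in>{1..k - 1}. u n (s_idx t k + j)) * (\<Prod>j\<in>{k..t} - {i}. u n (v_idx t k + j))"
proof -
  have R: "(\<Prod>j\<in>J. u n (s_idx t k + j)) = (\<Prod>j\<in>J. U n k (RightC j))" if "J \<subseteq> {1..k - 1}" for J
    using that k by (intro prod.cong refl u_types(2)) auto
  have V: "(\<Prod>j\<in>J. u n (v_idx t k + j)) = (\<Prod>j\<in>J. U n k (LeftC j))" if "J \<subseteq> {k..t}" for J
    using that k by (intro prod.cong refl u_types(3)) auto
  note X = X_formulas[OF assms(1)]
  show "x n k = \<epsilon> * u n k ^ (l - t - 1) * (\<Prod>j\<in>{1..k - 1}. u n (s_idx t k + j)) * (\<Prod>j\<in>{k..t}. u n (v_idx t k + j))"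
    unfolding R[OF order_refl] V[OF order_refl] u_types(1)[OF k] x_types(1)[OF k] by (rule X(1))
  show "i \<in> {1..k - 1} \<Longrightarrow> x n (s_idx t k + i)
      = \<epsilon> * u n k ^ (l - t) * (\<Prod>j\<in>{1..k - 1} - {i}. u n (s_idx t k + j)) * (\<Prod>j\<in>{k..t}. u n (v_idx t k + j))"
    unfolding R[OF Diff_subset] V[OF order_refl] u_types(1)[OF k] x_types(2)[OF k] by (rule X(2))
  show "i \<in> {k..t} \<Longrightarrow> x n (v_idx t k + i)
      = \<epsilon> * u n k ^ (l - t) * (\<Prod>j\<in>{1..k - 1}. u n (s_idx t k + j)) * (\<Prod>j\<in>{k..t} - {i}. u n (v_idx t k + j))"
    unfolding R[OF order_refl] V[OF Diff_subset] u_types(1)[OF k] x_types(3)[OF k] by (rule X(3))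
qed

lemma u_formulas:
  shows "k \<in> {1..t} \<Longrightarrow> u n k = 1 - (1 - x (n - 1) k) ^ (w - 1) * (1 - x (n - 1) (t + 1)) ^ (r - t * w)
      * (\<Prod>j\<in>{1..t} - {k}. (1 - x (n - 1) j) ^ w)"
    and "u n (t + 1) = 1 - (1 - x (n - 1) (t + 1)) ^ (r - t * w - 1) * (\<Prod>j\<in>{1..t}. (1 - x (n - 1) j) ^ w)"
    and "i \<in> {1..t} \<Longrightarrow> k \<in> {i + 1..t} \<Longrightarrow> u n (s_idx t k + i)
      = 1 - (1 - \<delta>R i) * (1 - x (n - 1) (s_idx t k + i)) ^ (w - 1)
          * (1 - x (n - 1) (s_idx t (t + 1) + i)) ^ (r - t * w)
          * (\<Prod>j\<in>{i + 1..t} - {k}. (1 - x (n - 1) (s_idx t j + i)) ^ w)"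
    and "i \<in> {1..t} \<Longrightarrow> u n (s_idx t (t + 1) + i)
      = 1 - (1 - \<delta>R i) * (1 - x (n - 1) (s_idx t (t + 1) + i)) ^ (r - t * w - 1)
          * (\<Prod>j\<in>{i + 1..t}. (1 - x (n - 1) (s_idx t j + i)) ^ w)"
    and "i \<in> {1..t} \<Longrightarrow> k \<in> {1..i} \<Longrightarrow> u n (v_idx t k + i)
      = 1 - (1 - \<delta>L i) * (1 - x (n - 1) (v_idx t k + i)) ^ (w - 1)
          * (\<Prod>j\<in>{1..i} - {k}. (1 - x (n - 1) (v_idx t j + i)) ^ w)"
proof -
  have L: "(\<Prod>j\<in>J. (1 - x m j) ^ w) = (\<Prod>j\<in>J. (1 - X m j (Local 1)) ^ w)" if "J \<subseteq> {1..t}" for J m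
    using that by (intro prod.cong refl) (auto simp: x_types(1) subset_iff)
  have R: "(\<Prod>j\<in>J. (1 - x m (s_idx t j + i)) ^ w) = (\<Prod>j\<in>J. (1 - X m j (RightC i)) ^ w)"
    if "J \<subseteq> {i + 1..t}" "i \<in> {1..t}" for J i m
    using that by (intro prod.cong refl) (auto simp: x_types(2) subset_iff)
  have V: "(\<Prod>j\<in>J. (1 - x m (v_idx t j + i)) ^ w) = (\<Prod>j\<in>J. (1 - X m j (LeftC i)) ^ w)"
    if "J \<subseteq> {1..i}" "i \<in> {1..t}" for J i m
    using that by (intro prod.cong refl) (auto simp: x_types(3) subset_iff)
  note f = type_cn_formulas[where q = q and x = "X (n - 1)"]
  show "k \<in> {1..t} \<Longrightarrow> u n k = 1 - (1 - x (n - 1) k) ^ (w - 1) * (1 - x (n - 1) (t + 1)) ^ (r - t * w)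
      * (\<Prod>j\<in>{1..t} - {k}. (1 - x (n - 1) j) ^ w)"
    using f(1)[of k] by (simp add: L x_types(1) u_types(1))
  show "u n (t + 1) = 1 - (1 - x (n - 1) (t + 1)) ^ (r - t * w - 1) * (\<Prod>j\<in>{1..t}. (1 - x (n - 1) j) ^ w)"
    using f(2) x_types(1)[of "t + 1" "n - 1"] u_types(1)[of "t + 1" n] by (simp add: L)
  show "i \<in> {1..t} \<Longrightarrow> k \<in> {i + 1..t} \<Longrightarrow> u n (s_idx t k + i)
      = 1 - (1 - \<delta>R i) * (1 - x (n - 1) (s_idx t k + i)) ^ (w - 1)
          * (1 - x (n - 1) (s_idx t (t + 1) + i)) ^ (r - t * w)
          * (\<Prod>j\<in>{i + 1..t} - {k}. (1 - x (n - 1) (s_idx t j + i)) ^ w)"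
    using f(3)[of k i] x_types(2)[of "t + 1" i "n - 1"] x_types(2)[of k i "n - 1"] u_types(2)[of k i n]
      R[of "{i + 1..t} - {k}" i] by auto
  show "i \<in> {1..t} \<Longrightarrow> u n (s_idx t (t + 1) + i)
      = 1 - (1 - \<delta>R i) * (1 - x (n - 1) (s_idx t (t + 1) + i)) ^ (r - t * w - 1)
          * (\<Prod>j\<in>{i + 1..t}. (1 - x (n - 1) (s_idx t j + i)) ^ w)"
    using f(4)[of i] x_types(2)[of "t + 1" i "n - 1"] u_types(2)[of "t + 1" i n] R[of "{i + 1..t}" i] by auto
  show "i \<in> {1..t} \<Longrightarrow> k \<in> {1..i} \<Longrightarrow> u n (v_idx t k + i)
      = 1 - (1 - \<delta>L i) * (1 - x (n - 1) (v_idx t k + i)) ^ (w - 1)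
          * (\<Prod>j\<in>{1..i} - {k}. (1 - x (n - 1) (v_idx t j + i)) ^ w)"
    using f(5)[of i k] x_types(3)[of k i "n - 1"] u_types(3)[of k i n] V[of "{1..i} - {k}" i] by auto
qed

end

section \<open>Formulas of the helper and limits over iterations\<close>

locale helper_setup = de_setup l r t \<epsilon> "\<lambda>_. 1" \<delta>R for l r t \<epsilon> \<delta>R
begin

abbreviation "y \<equiv> helper_x l r t \<epsilon> \<delta>R"
abbreviation "z \<equiv> helper_u l r t \<epsilon> \<delta>R"

lemma helper_edges_subset: "helper_edges l r t \<subseteq> E"
  by (auto simp: helper_edges_def)

lemma helper_vn_limit_type:
  assumes "k \<in> {1..t + 1}" "c \<in> label_checks l t k" "e \<in> E" "edge_label l r t e = label_index t k c"
  shows "helper_vn_limit l r t \<epsilon> \<delta>R n e (X n k c)"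
proof -
  have "de_vn E \<epsilon> q n e = X n k c"
    using de_vn_eq_type_vn[of "fst e" "snd e" \<epsilon> q n] type_eq_of_edge_label(1)[where q = q, OF assms q_Local] assms(3) by simp
  then show ?thesis
    using vn_fraction_limit[OF helper_edges_subset \<epsilon> \<delta>L \<delta>R assms(3), of n]
    by (simp add: helper_vn_limit_def de_vn_helper_edges)
qed

lemma helper_cn_limit_type:
  assumes "k \<in> {1..t + 1}" "c \<in> label_checks l t k" "e \<in> helper_edges l r t" "edge_label l r t e = label_index t k c"
  shows "helper_cn_limit l r t \<epsilon> \<delta>R n e (U n k c)"
proof -
  have e: "e \<in> E"
    using assms(3) helper_edges_subset by blast
  have "de_cn E q (de_vn E \<epsilon> q (n - 1)) e = U n k c"
    using de_cn_eq_type_cn[of "fst e" "snd e" q \<epsilon> "n - 1"] type_eq_of_edge_label(2)[where q = q, OF assms(1,2) e assms(4) q_Local] e by simp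
  moreover have "de_vn (helper_edges l r t) \<epsilon> q (n - 1) = de_vn E \<epsilon> q (n - 1)"
    by (rule ext) (rule de_vn_helper_edges)
  ultimately show ?thesis
    using cn_fraction_limit[OF helper_edges_subset \<epsilon> \<delta>L \<delta>R e, of n]
    by (simp add: helper_cn_limit_def de_cn_helper_edges[OF assms(3)])
qed

lemma helper_x_eq:
  assumes "k \<in> {1..t + 1}" "c \<in> label_checks l t k"
  shows "y n (label_index t k c) = X n k c"
proof -
  obtain v where "(v, c) \<in> E" "edge_label l r t (v, c) = label_index t k c"
    using ex_edge_of_label[OF assms] .
  then show ?thesis
    unfolding helper_x_def helper_vn_limit_def
    by (intro the_common_limit) (use helper_vn_limit_type[OF assms] in \<open>auto simp: helper_vn_limit_def\<close>)
qed

lemma helper_u_eq: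
  assumes "k \<in> {1..t + 1}" "c \<in> label_checks l t k" "\<And>i. c \<noteq> LeftC i"
  shows "z n (label_index t k c) = U n k c"
proof -
  obtain v where v: "(v, c) \<in> E" "edge_label l r t (v, c) = label_index t k c"
    using ex_edge_of_label[OF assms(1,2)] .
  then have "(v, c) \<in> helper_edges l r t"
    using assms(3) by (simp add: helper_edges_def)
  then show ?thesis
    unfolding helper_u_def helper_cn_limit_def
    by (intro the_common_limit) (use v helper_cn_limit_type[OF assms(1,2)] in \<open>auto simp: helper_cn_limit_def\<close>)
qed

lemma helper_vn_limit_y:
  assumes "e \<in> E"
  shows "helper_vn_limit l r t \<epsilon> \<delta>R n e (y n (edge_label l r t e))"
  using helper_vn_limit_type[OF label_of_edge(1,2)[OF assms] assms label_of_edge(3)[OF assms]]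
    helper_x_eq[OF label_of_edge(1,2)[OF assms]] label_of_edge(3)[OF assms] by simp

lemma helper_cn_limit_z:
  assumes "e \<in> helper_edges l r t"
  shows "helper_cn_limit l r t \<epsilon> \<delta>R n e (z n (edge_label l r t e))"
proof -
  have e: "e \<in> E"
    using assms helper_edges_subset by blast
  have "\<And>i. snd e \<noteq> LeftC i"
    using assms by (auto simp: helper_edges_def)
  then show ?thesis
    using helper_cn_limit_type[OF label_of_edge(1,2)[OF e] assms label_of_edge(3)[OF e]]
      helper_u_eq[OF label_of_edge(1,2)[OF e]] label_of_edge(3)[OF e] by simp
qed

lemma y_eq_x: "j \<in> {1..(t + 1)\<^sup>2} \<Longrightarrow> y n j = x n j"
  using label_index_surj[of j] helper_x_eq[of _ _ n] target_x_eq[of _ _ n] by fastforce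

text \<open>Here \<open>x\<close> belongs to the target with left erasure probability
  \<open>1\<close>; the identification carries the target formulas over to the helper.\<close>

lemma y_types:
  shows "k \<in> {1..t + 1} \<Longrightarrow> y n k = x n k"
    and "k \<in> {1..t + 1} \<Longrightarrow> i \<in> {1..k - 1} \<Longrightarrow> y n (s_idx t k + i) = x n (s_idx t k + i)"
    and "k \<in> {1..t + 1} \<Longrightarrow> i \<in> {k..t} \<Longrightarrow> y n (v_idx t k + i) = x n (v_idx t k + i)"
  using helper_x_eq[of k "Local 1" n] helper_x_eq[of k "RightC i" n] helper_x_eq[of k "LeftC i" n] Local_1[of k]
  by (simp_all add: x_types)

lemma z_types:
  shows "k \<in> {1..t + 1} \<Longrightarrow> z n k = u n k"
    and "k \<in> {1..t + 1} \<Longrightarrow> i \<in> {1..k - 1} \<Longrightarrow> z n (s_idx t k + i) = u n (s_idx t k + i)"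
  using helper_u_eq[of k "Local 1" n] helper_u_eq[of k "RightC i" n] Local_1[of k]
  by (simp_all add: u_types)

text \<open>An external message that is always erased makes every message of the check an erasure,
  so the left factors disappear from the target formulas.\<close>

lemma u_left: "k \<in> {1..t + 1} \<Longrightarrow> i \<in> {k..t} \<Longrightarrow> u n (v_idx t k + i) = 1"
  by (simp add: u_types type_cn_def)

lemma prod_u_left: "k \<in> {1..t + 1} \<Longrightarrow> J \<subseteq> {k..t} \<Longrightarrow> (\<Prod>j\<in>J. u n (v_idx t k + j)) = 1"
  by (intro prod.neutral) (auto simp: u_left subset_iff)

lemma prod_z_right:
  "k \<in> {1..t + 1} \<Longrightarrow> J \<subseteq> {1..k - 1} \<Longrightarrow> (\<Prod>j\<in>J. z n (s_idx t k + j)) = (\<Prod>j\<in>J. u n (s_idx t k + j))"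
  by (intro prod.cong refl z_types(2)) auto

lemma y_formulas:
  assumes "n \<ge> 1" and k: "k \<in> {1..t + 1}"
  shows "y n k = \<epsilon> * z n k ^ (l - t - 1) * (\<Prod>j\<in>{1..k - 1}. z n (s_idx t k + j))"
    and "i \<in> {1..k - 1} \<Longrightarrow> y n (s_idx t k + i)
      = \<epsilon> * z n k ^ (l - t) * (\<Prod>j\<in>{1..k - 1} - {i}. z n (s_idx t k + j))"
    and "i \<in> {k..t} \<Longrightarrow> y n (v_idx t k + i)
      = \<epsilon> * z n k ^ (l - t) * (\<Prod>j\<in>{1..k - 1}. z n (s_idx t k + j))"
  using x_formulas(1)[OF assms] x_formulas(2)[OF assms, of i] x_formulas(3)[OF assms, of i]
  unfolding y_types(1)[OF k] z_types(1)[OF k] prod_z_right[OF k order_refl] prod_z_right[OF k Diff_subset]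
    prod_u_left[OF k order_refl] prod_u_left[OF k Diff_subset]
  by (simp_all add: y_types(2,3)[OF k])

lemma z_formulas:
  shows "k \<in> {1..t} \<Longrightarrow> z n k = 1 - (1 - y (n - 1) k) ^ (w - 1) * (1 - y (n - 1) (t + 1)) ^ (r - t * w)
      * (\<Prod>j\<in>{1..t} - {k}. (1 - y (n - 1) j) ^ w)"
    and "z n (t + 1) = 1 - (1 - y (n - 1) (t + 1)) ^ (r - t * w - 1) * (\<Prod>j\<in>{1..t}. (1 - y (n - 1) j) ^ w)"
    and "i \<in> {1..t} \<Longrightarrow> k \<in> {i + 1..t} \<Longrightarrow> z n (s_idx t k + i)
      = 1 - (1 - \<delta>R i) * (1 - y (n - 1) (s_idx t k + i)) ^ (w - 1)
          * (1 - y (n - 1) (s_idx t (t + 1) + i)) ^ (r - t * w)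
          * (\<Prod>j\<in>{i + 1..t} - {k}. (1 - y (n - 1) (s_idx t j + i)) ^ w)"
    and "i \<in> {1..t} \<Longrightarrow> z n (s_idx t (t + 1) + i)
      = 1 - (1 - \<delta>R i) * (1 - y (n - 1) (s_idx t (t + 1) + i)) ^ (r - t * w - 1)
          * (\<Prod>j\<in>{i + 1..t}. (1 - y (n - 1) (s_idx t j + i)) ^ w)"
proof -
  have L: "(\<Prod>j\<in>J. (1 - y m j) ^ w) = (\<Prod>j\<in>J. (1 - x m j) ^ w)" if "J \<subseteq> {1..t}" for J m
    using that by (intro prod.cong refl) (auto simp: y_types(1) subset_iff)
  have R: "(\<Prod>j\<in>J. (1 - y m (s_idx t j + i)) ^ w) = (\<Prod>j\<in>J. (1 - x m (s_idx t j + i)) ^ w)"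
    if "J \<subseteq> {i + 1..t}" "i \<in> {1..t}" for J i m
    using that by (intro prod.cong refl) (auto simp: y_types(2) subset_iff)
  show "k \<in> {1..t} \<Longrightarrow> z n k = 1 - (1 - y (n - 1) k) ^ (w - 1) * (1 - y (n - 1) (t + 1)) ^ (r - t * w)
      * (\<Prod>j\<in>{1..t} - {k}. (1 - y (n - 1) j) ^ w)"
    using u_formulas(1)[of k n] by (simp add: L y_types(1) z_types(1))
  show "z n (t + 1) = 1 - (1 - y (n - 1) (t + 1)) ^ (r - t * w - 1) * (\<Prod>j\<in>{1..t}. (1 - y (n - 1) j) ^ w)"
    using u_formulas(2)[of n] y_types(1)[of "t + 1" "n - 1"] z_types(1)[of "t + 1" n] by (simp add: L)
  show "i \<in> {1..t} \<Longrightarrow> k \<in> {i + 1..t} \<Longrightarrow> z n (s_idx t k + i)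
      = 1 - (1 - \<delta>R i) * (1 - y (n - 1) (s_idx t k + i)) ^ (w - 1)
          * (1 - y (n - 1) (s_idx t (t + 1) + i)) ^ (r - t * w)
          * (\<Prod>j\<in>{i + 1..t} - {k}. (1 - y (n - 1) (s_idx t j + i)) ^ w)"
    using u_formulas(3)[of i k n] y_types(2)[of "t + 1" i "n - 1"] y_types(2)[of k i "n - 1"] z_types(2)[of k i n]
      R[of "{i + 1..t} - {k}" i] by auto
  show "i \<in> {1..t} \<Longrightarrow> z n (s_idx t (t + 1) + i)
      = 1 - (1 - \<delta>R i) * (1 - y (n - 1) (s_idx t (t + 1) + i)) ^ (r - t * w - 1)
          * (\<Prod>j\<in>{i + 1..t}. (1 - y (n - 1) (s_idx t j + i)) ^ w)"
    using u_formulas(4)[of i n] y_types(2)[of "t + 1" i "n - 1"] z_types(2)[of "t + 1" i n] R[of "{i + 1..t}" i] by auto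
qed

text \<open>\<open>LeftC i\<close> sees exactly the labels from \<open>1\<close> to
  \<open>i\<close>; as \<open>i \<le> t\<close>, each of these classes has \<open>w\<close> nodes,
  which explains the exponent.\<close>

lemma helper_out_limit_eq:
  assumes i: "i \<in> {1..t}"
  shows "helper_out_limit l r t \<epsilon> \<delta>R n i (1 - (\<Prod>k\<in>{1..i}. (1 - y n (v_idx t k + i)) ^ w))"
proof -
  obtain v where v: "(v, LeftC i) \<in> E"
    using ex_edge_of_label[of 1 "LeftC i"] i by auto
  then have c: "LeftC i \<in> snd ` E"
    by force
  have "(\<Prod>h\<in>{h \<in> E. snd h = LeftC i}. 1 - de_vn E \<epsilon> q n h)
      = (\<Prod>h\<in>{h \<in> E. snd h = LeftC i}. 1 - X n (lab (fst h)) (LeftC i))"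
    using de_vn_eq_type_vn by (intro prod.cong refl) auto
  also have "\<dots> = (\<Prod>v\<in>{v \<in> {1..r}. lab v \<in> {1..i}}. 1 - X n (lab v) (LeftC i))"
    unfolding edges_at_check[OF c] by (simp add: prod.reindex inj_on_def)
  also have "\<dots> = (\<Prod>k\<in>{1..i}. (1 - X n k (LeftC i)) ^ label_size r t k)"
    by (rule prod_over_check[OF c]) auto
  also have "\<dots> = (\<Prod>k\<in>{1..i}. (1 - y n (v_idx t k + i)) ^ w)"
    using i by (intro prod.cong refl) (auto simp: label_size_def y_types(3) x_types(3))
  finally show ?thesis
    using out_fraction_limit[OF helper_edges_subset \<epsilon> \<delta>L \<delta>R v, of n]
    by (simp add: helper_out_limit_def de_vn_helper_edges)
qed

lemma helper_out_eq:
  assumes "i \<in> {1..t}"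
  shows "helper_out l r t \<epsilon> \<delta>R n i = 1 - (\<Prod>k\<in>{1..i}. (1 - y n (v_idx t k + i)) ^ w)"
  unfolding helper_out_def using helper_out_limit_eq[OF assms]
  by (intro the_equality) (auto simp: helper_out_limit_def intro: limit_in_prob_unique)

lemma convergent_y_type:
  assumes "k \<in> {1..t + 1}" "c \<in> label_checks l t k"
  shows "convergent (\<lambda>n. y n (label_index t k c))"
proof -
  obtain v where v: "(v, c) \<in> E" "lab v = k"
    using ex_edge_of_label[OF assms] .
  have "convergent (\<lambda>n. de_vn E \<epsilon> q n (v, c))"
    using \<epsilon> ext_prob_unit[OF \<delta>L \<delta>R] by (rule convergent_de_vn)
  then show ?thesis
    using v by (simp add: helper_x_eq[OF assms] de_vn_eq_type_vn)
qed

lemma convergent_z_type: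
  assumes "k \<in> {1..t + 1}" "c \<in> label_checks l t k" "\<And>i. c \<noteq> LeftC i"
  shows "convergent (\<lambda>n. z n (label_index t k c))"
proof -
  obtain v where v: "(v, c) \<in> E" "lab v = k"
    using ex_edge_of_label[OF assms(1,2)] .
  have "convergent (\<lambda>n. de_vn E \<epsilon> q n h)" for h
    using \<epsilon> ext_prob_unit[OF \<delta>L \<delta>R] by (rule convergent_de_vn)
  then have "convergent (\<lambda>n. de_cn E q (de_vn E \<epsilon> q n) (v, c))"
    by (rule convergent_de_cn)
  \<comment> \<open>Check messages of iteration \<open>Suc n\<close> use the variable messages of
    iteration \<open>n\<close>; the shift does not affect convergence.\<close>
  then have "convergent (\<lambda>n. U (Suc n) k c)"
    using v by (simp add: de_cn_eq_type_cn)
  then have "convergent (\<lambda>n. U n k c)"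
    by (subst (asm) convergent_Suc_iff)
  then show ?thesis
    by (simp add: helper_u_eq[OF assms])
qed

lemma convergent_y_left: "k \<in> {1..t + 1} \<Longrightarrow> i \<in> {k..t} \<Longrightarrow> convergent (\<lambda>n. y n (v_idx t k + i))"
  using convergent_y_type[of k "LeftC i"] by simp

lemma convergent_z:
  shows "k \<in> {1..t + 1} \<Longrightarrow> convergent (\<lambda>n. z n k)"
    and "k \<in> {1..t + 1} \<Longrightarrow> i \<in> {1..k - 1} \<Longrightarrow> convergent (\<lambda>n. z n (s_idx t k + i))"
  using convergent_z_type[of k "Local 1"] convergent_z_type[of k "RightC i"] Local_1[of k] by simp_all

lemma helper_out_tendsto:
  assumes i: "i \<in> {1..t}"
  shows "(\<lambda>n. helper_out l r t \<epsilon> \<delta>R n i) \<longlonglongrightarrow> 1 - (\<Prod>k\<in>{1..i}. (1 - lim (\<lambda>n. y n (v_idx t k + i))) ^ w)"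
proof -
  have "(\<lambda>n. y n (v_idx t k + i)) \<longlonglongrightarrow> lim (\<lambda>n. y n (v_idx t k + i))" if "k \<in> {1..i}" for k
    using convergent_y_left[of k i] that i by (simp add: convergent_LIMSEQ_iff)
  then show ?thesis
    unfolding helper_out_eq[OF i] by (intro tendsto_intros)
qed

text \<open>Both sides of \<open>y_formulas(3)\<close> converge. That formula starts at iteration
  \<open>1\<close>, hence the passage to \<open>Suc n\<close>.\<close>

lemma lim_y_left:
  assumes k: "k \<in> {1..t + 1}" and i: "i \<in> {k..t}"
  shows "lim (\<lambda>n. y n (v_idx t k + i))
    = \<epsilon> * lim (\<lambda>n. z n k) ^ (l - t) * (\<Prod>j\<in>{1..k - 1}. lim (\<lambda>n. z n (s_idx t k + j)))"
proof (rule limI, rule LIMSEQ_imp_Suc)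
  have "(\<lambda>n. z n k) \<longlonglongrightarrow> lim (\<lambda>n. z n k)"
    using convergent_z(1)[OF k] by (simp add: convergent_LIMSEQ_iff)
  then have zk: "(\<lambda>n. z (Suc n) k) \<longlonglongrightarrow> lim (\<lambda>n. z n k)"
    by (rule LIMSEQ_Suc)
  have zs: "(\<lambda>n. z (Suc n) (s_idx t k + j)) \<longlonglongrightarrow> lim (\<lambda>n. z n (s_idx t k + j))" if "j \<in> {1..k - 1}" for j
    using convergent_z(2)[OF k that] by (intro LIMSEQ_Suc) (simp add: convergent_LIMSEQ_iff)
  have eq: "y (Suc n) (v_idx t k + i)
      = \<epsilon> * z (Suc n) k ^ (l - t) * (\<Prod>j\<in>{1..k - 1}. z (Suc n) (s_idx t k + j))" for n
    using y_formulas(3)[OF _ k i, of "Suc n"] by simp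
  show "(\<lambda>n. y (Suc n) (v_idx t k + i))
      \<longlonglongrightarrow> \<epsilon> * lim (\<lambda>n. z n k) ^ (l - t) * (\<Prod>j\<in>{1..k - 1}. lim (\<lambda>n. z n (s_idx t k + j)))"
    unfolding eq using zk zs by (intro tendsto_intros)
qed

end

theorem theorem2:
  fixes l r t w :: nat and \<epsilon> :: real and \<delta>L \<delta>R :: "nat \<Rightarrow> real"
    and s v :: "nat \<Rightarrow> nat"
    and x u y z :: "nat \<Rightarrow> nat \<Rightarrow> real"
    and y_inf z_inf \<delta>O :: "nat \<Rightarrow> real"
  assumes "3 \<le> l" and "l < r" and "1 \<le> t" and "t \<le> l - 2"
    and "\<epsilon> \<in> {0..1}"
    and "\<forall>i \<in> {1..t}. \<delta>L i \<in> {0..1}" and "\<forall>i \<in> {1..t}. \<delta>R i \<in> {0..1}"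
    and w_def: "w = width r t" and s_def: "s = s_idx t" and v_def: "v = v_idx t"
    \<comment> \<open>target: \<open>x\<close> from VN to CN, \<open>u\<close> from CN to VN\<close>
    and x_def: "x = target_x l r t \<epsilon> \<delta>L \<delta>R" and u_def: "u = target_u l r t \<epsilon> \<delta>L \<delta>R"
    \<comment> \<open>helper: \<open>y\<close> from VN to CN, \<open>z\<close> from CN to VN\<close>
    and y_def: "y = helper_x l r t \<epsilon> \<delta>R" and z_def: "z = helper_u l r t \<epsilon> \<delta>R"
    and y_inf_def: "y_inf = (\<lambda>j. lim (\<lambda>n. y n j))"
    and z_inf_def: "z_inf = (\<lambda>j. lim (\<lambda>n. z n j))"
    and \<delta>O_def: "\<delta>O = helper_delta_O l r t \<epsilon> \<delta>R"
  shows
    \<comment> \<open>the limiting fractions exist and depend on the edge label only\<close>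
    "(\<forall>n. \<forall>e \<in> sg_edges l r t. target_vn_limit l r t \<epsilon> \<delta>L \<delta>R n e (x n (edge_label l r t e)))
    \<and> (\<forall>n\<ge>1. \<forall>e \<in> sg_edges l r t. target_cn_limit l r t \<epsilon> \<delta>L \<delta>R n e (u n (edge_label l r t e)))
    \<and> (\<forall>n. \<forall>e \<in> sg_edges l r t. helper_vn_limit l r t \<epsilon> \<delta>R n e (y n (edge_label l r t e)))
    \<and> (\<forall>n\<ge>1. \<forall>e \<in> helper_edges l r t. helper_cn_limit l r t \<epsilon> \<delta>R n e (z n (edge_label l r t e)))
    \<and> (\<forall>n. \<forall>i \<in> {1..t}. helper_out_limit l r t \<epsilon> \<delta>R n i (helper_out l r t \<epsilon> \<delta>R n i))
    \<comment> \<open>target\<close>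
    \<and> (\<forall>j \<in> {1..(t + 1)^2}. x 0 j = 1)
    \<and> (\<forall>n\<ge>1. \<forall>k \<in> {1..t + 1}.
       x n k = \<epsilon> * u n k ^ (l - t - 1) * (\<Prod>j\<in>{1..k - 1}. u n (s k + j)) * (\<Prod>j\<in>{k..t}. u n (v k + j)))
    \<and> (\<forall>n\<ge>1. \<forall>k \<in> {1..t + 1}. \<forall>i \<in> {1..k - 1}.
       x n (s k + i) = \<epsilon> * u n k ^ (l - t) * (\<Prod>j\<in>{1..k - 1} - {i}. u n (s k + j)) * (\<Prod>j\<in>{k..t}. u n (v k + j)))
    \<and> (\<forall>n\<ge>1. \<forall>k \<in> {1..t + 1}. \<forall>i \<in> {k..t}.
       x n (v k + i) = \<epsilon> * u n k ^ (l - t) * (\<Prod>j\<in>{1..k - 1}. u n (s k + j)) * (\<Prod>j\<in>{k..t} - {i}. u n (v k + j)))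
    \<and> (\<forall>n\<ge>1. \<forall>k \<in> {1..t}.
       u n k = 1 - (1 - x (n - 1) k) ^ (w - 1) * (1 - x (n - 1) (t + 1)) ^ (r - t * w)
                 * (\<Prod>j\<in>{1..t} - {k}. (1 - x (n - 1) j) ^ w))
    \<and> (\<forall>n\<ge>1.
       u n (t + 1) = 1 - (1 - x (n - 1) (t + 1)) ^ (r - t * w - 1) * (\<Prod>j\<in>{1..t}. (1 - x (n - 1) j) ^ w))
    \<and> (\<forall>n\<ge>1. \<forall>i \<in> {1..t}. \<forall>k \<in> {i + 1..t}.
       u n (s k + i) = 1 - (1 - \<delta>R i) * (1 - x (n - 1) (s k + i)) ^ (w - 1)
                         * (1 - x (n - 1) (s (t + 1) + i)) ^ (r - t * w)
                         * (\<Prod>j\<in>{i + 1..t} - {k}. (1 - x (n - 1) (s j + i)) ^ w))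
    \<and> (\<forall>n\<ge>1. \<forall>i \<in> {1..t}.
       u n (s (t + 1) + i) = 1 - (1 - \<delta>R i) * (1 - x (n - 1) (s (t + 1) + i)) ^ (r - t * w - 1)
                               * (\<Prod>j\<in>{i + 1..t}. (1 - x (n - 1) (s j + i)) ^ w))
    \<and> (\<forall>n\<ge>1. \<forall>i \<in> {1..t}. \<forall>k \<in> {1..i}.
       u n (v k + i) = 1 - (1 - \<delta>L i) * (1 - x (n - 1) (v k + i)) ^ (w - 1)
                         * (\<Prod>j\<in>{1..i} - {k}. (1 - x (n - 1) (v j + i)) ^ w))
    \<comment> \<open>helper\<close>
    \<and> (\<forall>j \<in> {1..(t + 1)^2}. y 0 j = 1)
    \<and> (\<forall>n\<ge>1. \<forall>k \<in> {1..t + 1}.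
       y n k = \<epsilon> * z n k ^ (l - t - 1) * (\<Prod>j\<in>{1..k - 1}. z n (s k + j)))
    \<and> (\<forall>n\<ge>1. \<forall>k \<in> {1..t + 1}. \<forall>i \<in> {1..k - 1}.
       y n (s k + i) = \<epsilon> * z n k ^ (l - t) * (\<Prod>j\<in>{1..k - 1} - {i}. z n (s k + j)))
    \<and> (\<forall>n\<ge>1. \<forall>k \<in> {1..t}.
       z n k = 1 - (1 - y (n - 1) k) ^ (w - 1) * (1 - y (n - 1) (t + 1)) ^ (r - t * w)
                 * (\<Prod>j\<in>{1..t} - {k}. (1 - y (n - 1) j) ^ w))
    \<and> (\<forall>n\<ge>1.
       z n (t + 1) = 1 - (1 - y (n - 1) (t + 1)) ^ (r - t * w - 1) * (\<Prod>j\<in>{1..t}. (1 - y (n - 1) j) ^ w))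
    \<and> (\<forall>n\<ge>1. \<forall>i \<in> {1..t}. \<forall>k \<in> {i + 1..t}.
       z n (s k + i) = 1 - (1 - \<delta>R i) * (1 - y (n - 1) (s k + i)) ^ (w - 1)
                         * (1 - y (n - 1) (s (t + 1) + i)) ^ (r - t * w)
                         * (\<Prod>j\<in>{i + 1..t} - {k}. (1 - y (n - 1) (s j + i)) ^ w))
    \<and> (\<forall>n\<ge>1. \<forall>i \<in> {1..t}.
       z n (s (t + 1) + i) = 1 - (1 - \<delta>R i) * (1 - y (n - 1) (s (t + 1) + i)) ^ (r - t * w - 1)
                               * (\<Prod>j\<in>{i + 1..t}. (1 - y (n - 1) (s j + i)) ^ w))
    \<comment> \<open>outgoing erasure fractions of the helper\<close>
    \<and> (\<forall>k \<in> {1..t + 1}. convergent (\<lambda>n. z n k))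
    \<and> (\<forall>k \<in> {1..t + 1}. \<forall>i \<in> {1..k - 1}. convergent (\<lambda>n. z n (s k + i)))
    \<and> (\<forall>i \<in> {1..t}. \<forall>k \<in> {1..i}. convergent (\<lambda>n. y n (v k + i)))
    \<and> (\<forall>i \<in> {1..t}. convergent (\<lambda>n. helper_out l r t \<epsilon> \<delta>R n i))
    \<and> (\<forall>i \<in> {1..t}. \<delta>O i = 1 - (\<Prod>k\<in>{1..i}. (1 - y_inf (v k + i)) ^ w))
    \<and> (\<forall>i \<in> {1..t}. \<forall>k \<in> {1..i}.
       y_inf (v k + i) = \<epsilon> * z_inf k ^ (l - t) * (\<Prod>j\<in>{1..k - 1}. z_inf (s k + j)))"
proof -
  interpret target: de_setup l r t \<epsilon> \<delta>L \<delta>R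
    using assms(1-7) by unfold_locales
  \<comment> \<open>A second instance of the density evolution setup, with left erasure probability
    \<open>1\<close> in place of \<open>\<delta>L\<close>.\<close>
  interpret helper: helper_setup l r t \<epsilon> \<delta>R
    using assms(1-7) by unfold_locales auto
  have out: "helper_out_limit l r t \<epsilon> \<delta>R n i (helper_out l r t \<epsilon> \<delta>R n i)" if "i \<in> {1..t}" for n i
    using helper.helper_out_limit_eq[OF that] helper.helper_out_eq[OF that] by simp
  have range: "k \<in> {1..t + 1}" "i \<in> {k..t}" if "i \<in> {1..t}" "k \<in> {1..i}" for i k
    using that by auto
  show ?thesis
    unfolding w_def s_def v_def x_def u_def y_def z_def y_inf_def z_inf_def \<delta>O_def helper_delta_O_def
    \<comment> \<open>One rule per conjunct follows, in the order of the statement.\<close>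
    apply (intro conjI allI impI ballI)
    apply (rule target.target_vn_limit_x, assumption)
    apply (rule target.target_cn_limit_u, assumption)
    apply (rule helper.helper_vn_limit_y, assumption)
    apply (rule helper.helper_cn_limit_z, assumption)
    apply (rule out, assumption)
    apply (rule target.x_0, assumption)
    apply (rule target.x_formulas(1); assumption)
    apply (rule target.x_formulas(2); assumption)
    apply (rule target.x_formulas(3); assumption)
    apply (rule target.u_formulas(1); assumption)
    apply (rule target.u_formulas(2))
    apply (rule target.u_formulas(3); assumption)
    apply (rule target.u_formulas(4); assumption)
    apply (rule target.u_formulas(5); assumption)
    apply (simp only: helper.y_eq_x helper.x_0)
    apply (rule helper.y_formulas(1); assumption)
    apply (rule helper.y_formulas(2); assumption)
    apply (rule helper.z_formulas(1); assumption)
    apply (rule helper.z_formulas(2))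
    apply (rule helper.z_formulas(3); assumption)
    apply (rule helper.z_formulas(4); assumption)
    apply (rule helper.convergent_z(1); assumption)
    apply (rule helper.convergent_z(2); assumption)
    apply (rule helper.convergent_y_left[OF range]; assumption)
    apply (rule convergentI[OF helper.helper_out_tendsto]; assumption)
    apply (rule limI[OF helper.helper_out_tendsto]; assumption)
    apply (rule helper.lim_y_left[OF range]; assumption)
    done
qed

end
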